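(* Let $\rho$ be a Lévy measure on $\mathbb{R}\setminus\{0\}$ and $\lambda$ the Lebesgue measure on $[0,\infty)$. For any $W\sim CRSM(\rho,\lambda)$, the signed point process $Z$ on $[0,\infty)^2$ defined by the hierarchical model $$W=\sum_{i=1}^\infty w_i\delta_{\theta_i},\quad W\sim CRSM(\rho,\lambda),$$ $$D=\sum_{i=1}^\infty\sum_{j=1}^\infty n_{ij}\delta_{(\theta_i,\theta_j)}=D_+-D_-,\quad D_+\mid W_+\sim PP(W_+\times W_+),\ D_-\mid W_-\sim PP(W_-\times W_-),$$ $$Z=\sum_{i=1}^\infty\sum_{j=1}^\infty \mathrm{sign}(n_{ij}+n_{ji})\min(|n_{ij}+n_{ji}|,1)\,\delta_{(\theta_i,\theta_j)},$$ with $D_+$ and $D_-$ independent, is jointly exchangeable.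
   Context: $W\sim CRSM(\rho,\lambda)$ means that $W=\sum_iw_i\delta_{\theta_i}$, $w_i\in\mathbb{R}\setminus\{0\}$, $\theta_i\in[0,\infty)$, is a completely random signed measure on $[0,\infty)$ (a random real-valued countably additive set function on bounded Borel sets, with independent values on disjoint sets) without fixed atoms and without deterministic component, i.e. $W(B)=\int_{\mathbb{R}\setminus\{0\}}x\,\Psi(B\times dx)$ for a Poisson process $\Psi$ on $[0,\infty)\times(\mathbb{R}\setminus\{0\})$ with intensity $\lambda(d\theta)\rho(dw)$, where $\int_{\mathbb{R}\setminus\{0\}}(1\wedge|w|)\rho(dw)<\infty$. $W_+=\sum_{i:w_i>0}w_i\delta_{\theta_i}$ and $W_-=\sum_{i:w_i<0}|w_i|\delta_{\theta_i}$ form its Jordan decomposition; they are independent completely random measures. $PP(\mu)$ denotes the law of a Poisson process with mean measure $\mu$, which is allowed to have atoms. A random signed measure $\xi$ on $[0,\infty)^2$ is jointly exchangeable if for every $h>0$ and every permutation $\pi$ of $\mathbb{N}$, with $A_j=[h(j-1),hj]$, $j\in\mathbb{N}$, the arrays satisfy $(\xi(A_{i}\times A_{j}))_{(i,j)\in\mathbb{N}^2}\stackrel{d}{=}(\xi(A_{\pi(i)}\times A_{\pi(j)}))_{(i,j)\in\mathbb{N}^2}$. *)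

theory Defs
  imports "HOL-Probability.Probability"
begin

section \<open>Random measures and Poisson processes\<close>

text \<open>The \<sigma>-algebra on the measures on \<open>S\<close> generated by the evaluations \<open>N \<mapsto> N(A)\<close>.
  Only the measurable space is of interest, as for \<^const>\<open>subprob_algebra\<close>.\<close>

definition measure_algebra :: "'b measure \<Rightarrow> 'b measure measure" where
  "measure_algebra S =
    (SUP A\<in>sets S. vimage_algebra {N. sets N = sets S} (\<lambda>N. emeasure N A) borel)"

lemma space_measure_algebra: "space (measure_algebra S) = {N. sets N = sets S}"
  by (auto simp: measure_algebra_def space_Sup_eq_UN)

lemma measurable_emeasure_measure_algebra [measurable]:
  "A \<in> sets S \<Longrightarrow> (\<lambda>N. emeasure N A) \<in> borel_measurable (measure_algebra S)"
  by (auto intro!: measurable_Sup1 measurable_vimage_algebra1 simp: measure_algebra_def)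

text \<open>Finite or countable sums of Dirac measures: \<open>distr (count_space I) S x\<close> is
  \<open>\<Sum>i\<in>I. \<delta>\<^bsub>x i\<^esub>\<close>. Repeated points are allowed.\<close>

definition point_measures :: "'b measure \<Rightarrow> 'b measure measure" where
  "point_measures S = restrict_space (measure_algebra S)
    {N. \<exists>(I :: nat set) x. x \<in> I \<rightarrow> space S \<and> N = distr (count_space I) S x}"

text \<open>The mean measure \<open>\<mu>\<close> may have atoms and sets of infinite mass, on which the
  process has infinitely many points almost surely.\<close>

definition poisson_process :: "'a measure \<Rightarrow> 'b measure \<Rightarrow> ('a \<Rightarrow> 'b measure) \<Rightarrow> bool" where
  "poisson_process M \<mu> N \<longleftrightarrow>
     prob_space M \<and>
     N \<in> M \<rightarrow>\<^sub>M point_measures \<mu> \<and>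
     (\<forall>A\<in>sets \<mu>. emeasure \<mu> A < \<infinity> \<longrightarrow>
        (\<forall>k. measure M {\<omega> \<in> space M. emeasure (N \<omega>) A = of_nat k} =
             exp (- measure \<mu> A) * measure \<mu> A ^ k / fact k)) \<and>
     (\<forall>A\<in>sets \<mu>. emeasure \<mu> A = \<infinity> \<longrightarrow> (AE \<omega> in M. emeasure (N \<omega>) A = \<infinity>)) \<and>
     (\<forall>(n :: nat) A. (\<forall>i<n. A i \<in> sets \<mu>) \<and> disjoint_family_on A {..<n} \<longrightarrow>
        prob_space.indep_vars M (\<lambda>_. borel) (\<lambda>i \<omega>. emeasure (N \<omega>) (A i)) {..<n})"

definition locally_finite_point_process ::
    "'a measure \<Rightarrow> 'b::metric_space measure \<Rightarrow> ('a \<Rightarrow> 'b measure) \<Rightarrow> bool" where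
  "locally_finite_point_process M S N \<longleftrightarrow>
     N \<in> M \<rightarrow>\<^sub>M point_measures S \<and>
     (\<forall>\<omega>\<in>space M. \<forall>B\<in>sets S. bounded B \<longrightarrow> emeasure (N \<omega>) B < \<infinity>)"

definition regular_conditional_distribution ::
    "'a measure \<Rightarrow> 'a measure \<Rightarrow> 'c measure \<Rightarrow> ('a \<Rightarrow> 'c) \<Rightarrow> ('a \<Rightarrow> 'c measure) \<Rightarrow> bool" where
  "regular_conditional_distribution M F T Y K \<longleftrightarrow>
     K \<in> F \<rightarrow>\<^sub>M prob_algebra T \<and>
     (\<forall>A\<in>sets F. \<forall>B\<in>sets T.
        emeasure M (A \<inter> (Y -` B \<inter> space M)) = (\<integral>\<^sup>+\<omega>\<in>A. emeasure (K \<omega>) B \<partial>M))"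

text \<open>\<open>N | V \<sim> PP(\<mu>)\<close>, where \<open>V\<close> is a random measure on \<open>S\<close> and \<open>\<mu>\<close> is a random measure
  on \<open>T\<close>, in the applications a function of \<open>V\<close>: the regular conditional distribution of
  \<open>N\<close> given \<open>\<sigma>(V)\<close> is almost surely the law of a Poisson process with mean measure \<open>\<mu>\<close>.\<close>

definition conditionally_poisson ::
    "'a measure \<Rightarrow> 'b measure \<Rightarrow> ('a \<Rightarrow> 'b measure) \<Rightarrow> 'c measure \<Rightarrow> ('a \<Rightarrow> 'c measure) \<Rightarrow>
     ('a \<Rightarrow> 'c measure) \<Rightarrow> bool" where
  "conditionally_poisson M S V T \<mu> N \<longleftrightarrow>
     (\<exists>K. regular_conditional_distribution M
            (vimage_algebra (space M) V (measure_algebra S)) (point_measures T) N K \<and>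
          (AE \<omega> in M. poisson_process (K \<omega>) (\<mu> \<omega>) (\<lambda>N'. N')))"


section \<open>Completely random signed measures\<close>

text \<open>A random signed measure is a set function which is meaningful on the bounded Borel
  subsets of \<open>S\<close> only.\<close>

definition bounded_borel :: "'b::metric_space set \<Rightarrow> 'b set set" where
  "bounded_borel S = {B \<in> sets borel. B \<subseteq> S \<and> bounded B}"

definition random_signed_measure ::
    "'a measure \<Rightarrow> 'b::metric_space set \<Rightarrow> ('a \<Rightarrow> 'b set \<Rightarrow> real) \<Rightarrow> bool" where
  "random_signed_measure M S \<xi> \<longleftrightarrow>
     (\<forall>B\<in>bounded_borel S. (\<lambda>\<omega>. \<xi> \<omega> B) \<in> borel_measurable M) \<and>
     (\<forall>\<omega>\<in>space M. \<forall>B :: nat \<Rightarrow> 'b set.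
        (\<forall>i. B i \<in> bounded_borel S) \<and> disjoint_family B \<and> bounded (\<Union>i. B i) \<longrightarrow>
        (\<lambda>i. \<xi> \<omega> (B i)) sums \<xi> \<omega> (\<Union>i. B i))"

definition completely_random_signed_measure ::
    "'a measure \<Rightarrow> 'b::metric_space set \<Rightarrow> ('a \<Rightarrow> 'b set \<Rightarrow> real) \<Rightarrow> bool" where
  "completely_random_signed_measure M S \<xi> \<longleftrightarrow>
     random_signed_measure M S \<xi> \<and>
     (\<forall>(n :: nat) B. (\<forall>i<n. B i \<in> bounded_borel S) \<and> disjoint_family_on B {..<n} \<longrightarrow>
        prob_space.indep_vars M (\<lambda>_. borel) (\<lambda>i \<omega>. \<xi> \<omega> (B i)) {..<n})"

definition levy_measure :: "real measure \<Rightarrow> bool" where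
  "levy_measure \<rho> \<longleftrightarrow>
     sets \<rho> = sets (restrict_space borel (- {0})) \<and>
     (\<integral>\<^sup>+w. min 1 (ennreal \<bar>w\<bar>) \<partial>\<rho>) < \<infinity>"

definition CRSM ::
    "'a measure \<Rightarrow> real measure \<Rightarrow> real measure \<Rightarrow> ('a \<Rightarrow> real set \<Rightarrow> real) \<Rightarrow> bool" where
  "CRSM M \<rho> \<Lambda> W \<longleftrightarrow>
     completely_random_signed_measure M (space \<Lambda>) W \<and>
     (\<exists>\<Psi>. poisson_process M (\<Lambda> \<Otimes>\<^sub>M \<rho>) \<Psi> \<and>
        (\<forall>\<omega>\<in>space M. \<forall>B\<in>sets \<Lambda>. bounded B \<longrightarrow>
           set_integrable (\<Psi> \<omega>) (B \<times> space \<rho>) snd \<and>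
           W \<omega> B = (LINT p:B \<times> space \<rho>|\<Psi> \<omega>. snd p)))"

abbreviation half_line :: "real measure" where
  "half_line \<equiv> restrict_space borel {0..}"

abbreviation quadrant :: "(real \<times> real) measure" where
  "quadrant \<equiv> half_line \<Otimes>\<^sub>M half_line"

text \<open>A realization of a CRSM on the half-line is \<open>w = \<Sum>i. w\<^sub>i \<delta>\<^bsub>\<theta>\<^sub>i\<^esub>\<close> with distinct
  \<open>\<theta>\<^sub>i\<close>: its atoms are the \<open>\<theta>\<^sub>i\<close> and \<open>w\<^sub>i = w {\<theta>\<^sub>i}\<close>. Since \<^const>\<open>ennreal\<close>
  truncates at \<open>0\<close>, the next two definitions are the measures \<open>\<Sum>i:w\<^sub>i>0. w\<^sub>i \<delta>\<^bsub>\<theta>\<^sub>i\<^esub>\<close>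
  and \<open>\<Sum>i:w\<^sub>i<0. \<bar>w\<^sub>i\<bar> \<delta>\<^bsub>\<theta>\<^sub>i\<^esub>\<close> on the Borel sets of the half-line.\<close>

definition jordan_pos :: "(real set \<Rightarrow> real) \<Rightarrow> real measure" where
  "jordan_pos w =
     distr (density (count_space {0..}) (\<lambda>\<theta>. ennreal (w {\<theta>}))) half_line (\<lambda>\<theta>. \<theta>)"

definition jordan_neg :: "(real set \<Rightarrow> real) \<Rightarrow> real measure" where
  "jordan_neg w =
     distr (density (count_space {0..}) (\<lambda>\<theta>. ennreal (- w {\<theta>}))) half_line (\<lambda>\<theta>. \<theta>)"

definition atoms :: "(real set \<Rightarrow> real) \<Rightarrow> real set" where
  "atoms w = {\<theta>. 0 \<le> \<theta> \<and> w {\<theta>} \<noteq> 0}"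


section \<open>The signed network and joint exchangeability\<close>

definition signed_difference :: "'b measure \<Rightarrow> 'b measure \<Rightarrow> 'b set \<Rightarrow> real" where
  "signed_difference D\<^sub>p D\<^sub>m B = measure D\<^sub>p B - measure D\<^sub>m B"

text \<open>Here \<open>d {(\<theta>\<^sub>i, \<theta>\<^sub>j)}\<close> is the multiplicity \<open>n\<^bsub>ij\<^esub>\<close>.\<close>

definition signed_graph ::
    "(real set \<Rightarrow> real) \<Rightarrow> ((real \<times> real) set \<Rightarrow> real) \<Rightarrow> (real \<times> real) set \<Rightarrow> real" where
  "signed_graph w d B =
     (\<Sum>\<^sub>\<infinity>(x, y)\<in>B \<inter> atoms w \<times> atoms w.
        sgn (d {(x, y)} + d {(y, x)}) * min \<bar>d {(x, y)} + d {(y, x)}\<bar> 1)"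

text \<open>The blocks are numbered from \<open>0\<close>: \<open>block h j\<close> is \<open>A\<^bsub>j+1\<^esub>\<close>.\<close>

definition block :: "real \<Rightarrow> nat \<Rightarrow> real set" where
  "block h j = {h * real j .. h * (real j + 1)}"

definition jointly_exchangeable ::
    "'a measure \<Rightarrow> ('a \<Rightarrow> (real \<times> real) set \<Rightarrow> real) \<Rightarrow> bool" where
  "jointly_exchangeable M \<xi> \<longleftrightarrow>
     random_signed_measure M ({0..} \<times> {0..}) \<xi> \<and>
     (\<forall>h>0. \<forall>\<pi> :: nat \<Rightarrow> nat. bij \<pi> \<longrightarrow>
        distr M (\<Pi>\<^sub>M _\<in>UNIV. borel) (\<lambda>\<omega> (i, j). \<xi> \<omega> (block h i \<times> block h j)) =
        distr M (\<Pi>\<^sub>M _\<in>UNIV. borel) (\<lambda>\<omega> (i, j). \<xi> \<omega> (block h (\<pi> i) \<times> block h (\<pi> j))))"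

end

theory Submission
  imports Defs
begin

text \<open>Almost surely every point of \<open>D\<^sub>p\<close> and \<open>D\<^sub>m\<close> lies over atoms of \<open>W\<close>, so \<open>Z\<close> is
  almost surely a function of the pair \<open>(D\<^sub>p, D\<^sub>m)\<close>. This pair is independent, hence only the
  laws of \<open>D\<^sub>p\<close> and of \<open>D\<^sub>m\<close> matter. Cut the half-line into cells of equal length.
  The counts of \<open>D\<^sub>p\<close> on products of cells have a joint law that is a mixture of Poisson laws,
  determined by the joint law of the masses which \<open>W\<^sub>p\<close> gives to the cells. Those masses are
  limits, over refinements of the cells, of sums of the positive parts of the values of \<open>W\<close> on
  subcells; as these values are independent and identically distributed, the law is invariant under
  permutations of the cells. For a dyadic refinement of the blocks \<open>A\<^sub>j\<close>, a permutation of the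
  blocks permutes the cells, and for fine cells the array of \<open>Z\<close> on the blocks is a fixed
  function of the counts.\<close>

section \<open>Cells of the half-line\<close>

text \<open>The conditional law of a point process given its Jordan part speaks about counts on
  fixed sets, whereas the atoms of W form a random set with uncountable complement. That no point
  lies over a non-atom cannot be had by removing one null event per location; it needs estimates on
  cells that are uniform in the mesh. The truncated edge weight is not additive, so the value of Z
  on a pair of blocks is not a sum of values computed from arbitrary cells. It is matched exactly,
  from some random mesh on, when the cells separate the finitely many points in a bounded square.
  Since this is an eventual equality and not merely a limit, probabilities of arbitrary
  finite-dimensional events converge, and the invariance that holds exactly at each mesh passes to
  Z. Two refinements are nested: blocks are cut into cells to count points, and these cells are cut
  again to recover Jordan masses from values of W. \<open>block_map\<close> carries the permutation
  through both. The blocks are closed and overlap in endpoints, which is harmless because almost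
  surely no fixed location is an atom.\<close>

definition cell :: "real \<Rightarrow> nat \<Rightarrow> real set" where
  "cell \<delta> k = {\<delta> * real k ..< \<delta> * (real k + 1)}"

definition cell_index :: "real \<Rightarrow> real \<Rightarrow> nat" where
  "cell_index \<delta> x = nat \<lfloor>x / \<delta>\<rfloor>"

lemma mem_cell_iff:
  assumes "0 < \<delta>"
  shows "x \<in> cell \<delta> k \<longleftrightarrow> 0 \<le> x \<and> k = cell_index \<delta> x"
proof
  assume x: "x \<in> cell \<delta> k"
  then have "real k \<le> x / \<delta>" "x / \<delta> < real k + 1"
    using assms by (auto simp: cell_def field_simps)
  then have "\<lfloor>x / \<delta>\<rfloor> = int k"
    by (intro floor_unique) auto
  moreover have "0 \<le> x"
    using x assms by (auto simp: cell_def intro: order_trans[of 0 "\<delta> * real k"])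
  ultimately show "0 \<le> x \<and> k = cell_index \<delta> x"
    by (simp add: cell_index_def)
next
  assume *: "0 \<le> x \<and> k = cell_index \<delta> x"
  then have "0 \<le> x / \<delta>"
    using assms by auto
  then have "real k = real_of_int \<lfloor>x / \<delta>\<rfloor>"
    using * by (simp add: cell_index_def)
  then have "real k \<le> x / \<delta>" "x / \<delta> < real k + 1"
    by linarith+
  then show "x \<in> cell \<delta> k"
    using assms by (auto simp: cell_def field_simps)
qed

lemma disjoint_family_cell: "0 < \<delta> \<Longrightarrow> disjoint_family (cell \<delta>)"
  by (auto simp: disjoint_family_on_def mem_cell_iff)

text \<open>The multiples of \<delta> are among the multiples of \<delta> / m, so the grids are
  nested and the coarse index is an integer quotient of the fine one.\<close>

lemma cell_index_refine:
  assumes "0 < \<delta>" "0 < m" "0 \<le> x"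
  shows "cell_index \<delta> x = cell_index (\<delta> / real m) x div m"
proof -
  define k where "k = cell_index (\<delta> / real m) x"
  have "x \<in> cell (\<delta> / real m) k"
    using assms by (simp add: mem_cell_iff k_def)
  then have x: "real k \<le> x * real m / \<delta>" "x * real m / \<delta> < real k + 1"
    using assms by (auto simp: cell_def field_simps)
  \<comment> \<open>The remainder is at most m - 1, so even the upper end k + 1 of the fine cell
    stays within the coarse cell.\<close>
  have "m * (k div m) \<le> k" "k + 1 \<le> m * (k div m) + m"
    using assms dividend_less_times_div[of m k] by auto
  then have "real (m * (k div m)) \<le> real k" "real (k + 1) \<le> real (m * (k div m) + m)"
    by (simp_all only: of_nat_le_iff)
  then have "real m * real (k div m) \<le> x * real m / \<delta>" "x * real m / \<delta> < real m * (real (k div m) + 1)"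
    using x by (auto simp: algebra_simps)
  then have "real m * real (k div m) * \<delta> \<le> x * real m" "x * real m < real m * (real (k div m) + 1) * \<delta>"
    using assms by (simp_all add: pos_le_divide_eq pos_divide_less_eq)
  then have "real m * (\<delta> * real (k div m)) \<le> real m * x" "real m * x < real m * (\<delta> * (real (k div m) + 1))"
    by (simp_all add: algebra_simps)
  then have "x \<in> cell \<delta> (k div m)"
    using assms by (simp add: cell_def)
  then show ?thesis
    using assms by (simp add: mem_cell_iff k_def)
qed

lemma cell_refine:
  assumes "0 < \<delta>" "0 < m"
  shows "cell \<delta> k = (\<Union>r<m. cell (\<delta> / real m) (k * m + r))"
proof -
  have div: "k = j div m \<longleftrightarrow> (\<exists>r<m. k * m + r = j)" for j :: nat
    using assms by (auto intro!: exI[of _ "j mod m"])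
  have "x \<in> cell \<delta> k \<longleftrightarrow> 0 \<le> x \<and> k = cell_index (\<delta> / real m) x div m" for x
    using assms by (auto simp: mem_cell_iff cell_index_refine[of \<delta> m])
  also have "\<dots> x \<longleftrightarrow> x \<in> (\<Union>r<m. cell (\<delta> / real m) (k * m + r))" for x
    unfolding div using assms by (auto simp: mem_cell_iff)
  finally show ?thesis
    by blast
qed

lemma cell_subset_half_line: "0 < \<delta> \<Longrightarrow> cell \<delta> k \<subseteq> {0..}"
  by (auto simp: mem_cell_iff)

lemma cell_in_bounded_borel: "0 < \<delta> \<Longrightarrow> cell \<delta> k \<in> bounded_borel {0..}"
  using cell_subset_half_line[of \<delta> k]
  by (auto simp: bounded_borel_def cell_def intro: bounded_subset[OF bounded_closed_interval])

lemma cell_in_sets_half_line: "0 < \<delta> \<Longrightarrow> cell \<delta> k \<in> sets half_line"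
  using cell_in_bounded_borel[of \<delta> k] by (auto simp: bounded_borel_def sets_restrict_space_iff)

lemma bounded_borel_half_line: "B \<in> bounded_borel {0..} \<Longrightarrow> B \<in> sets half_line"
  by (auto simp: bounded_borel_def sets_restrict_space_iff)

lemma bounded_borel_Int_borel: "B \<in> bounded_borel S \<Longrightarrow> C \<in> sets borel \<Longrightarrow> B \<inter> C \<in> bounded_borel S"
  by (auto simp: bounded_borel_def intro: bounded_subset)

lemma cell_borel [measurable]: "cell \<delta> k \<in> sets borel"
  by (auto simp: cell_def)

text \<open>The index map that \<open>\<sigma>\<close> induces on an m-fold refinement: each coarse
  cell moves as a whole and positions inside it are kept.\<close>

definition block_map :: "(nat \<Rightarrow> nat) \<Rightarrow> nat \<Rightarrow> nat \<Rightarrow> nat" where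
  "block_map \<sigma> m k = \<sigma> (k div m) * m + k mod m"

lemma block_map_eq: "r < m \<Longrightarrow> block_map \<sigma> m (k * m + r) = \<sigma> k * m + r"
  by (simp add: block_map_def)

lemma inj_block_map:
  assumes "inj \<sigma>" "0 < m"
  shows "inj (block_map \<sigma> m)"
proof (rule injI)
  fix i j assume eq: "block_map \<sigma> m i = block_map \<sigma> m j"
  have "block_map \<sigma> m k div m = \<sigma> (k div m)" "block_map \<sigma> m k mod m = k mod m" for k
    using assms by (simp_all add: block_map_def)
  then have "\<sigma> (i div m) = \<sigma> (j div m)" "i mod m = j mod m"
    using eq by metis+
  then show "i = j"
    using assms by (metis div_mult_mod_eq injD)
qed

lemma block_index_less:
  fixes k r :: nat
  assumes "k < q" "r < m"
  shows "k * m + r < q * m"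
proof -
  have "k * m + r < Suc k * m"
    using assms by simp
  also have "\<dots> \<le> q * m"
    using assms by (intro mult_le_mono1) simp
  finally show ?thesis .
qed

section \<open>Dyadic cells shrinking to a point\<close>

definition dyadic_cell :: "real \<Rightarrow> nat \<Rightarrow> real \<Rightarrow> real set" where
  "dyadic_cell h n x = cell (h / 2 ^ n) (cell_index (h / 2 ^ n) x)"

lemma mem_dyadic_cell: "0 < h \<Longrightarrow> 0 \<le> x \<Longrightarrow> x \<in> dyadic_cell h n x"
  by (simp add: dyadic_cell_def mem_cell_iff)

lemma decseq_dyadic_cell:
  assumes "0 < h" "0 \<le> x"
  shows "decseq (\<lambda>n. dyadic_cell h n x)"
proof (rule decseq_SucI, rule subsetI)
  fix n y assume y: "y \<in> dyadic_cell h (Suc n) x"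
  with assms cell_index_refine[of "h / 2 ^ n" 2 x] cell_index_refine[of "h / 2 ^ n" 2 y]
  show "y \<in> dyadic_cell h n x"
    by (simp add: dyadic_cell_def mem_cell_iff field_simps)
qed

lemma mesh_LIMSEQ: "(\<lambda>n. h / 2 ^ n :: real) \<longlonglongrightarrow> 0"
  using tendsto_mult[OF tendsto_const[of h] LIMSEQ_realpow_zero[of "1/2"]]
  by (simp add: power_one_over divide_simps)

lemma eventually_dyadic_cells_separate:
  assumes "0 < h" "0 \<le> x" "0 \<le> y" "x \<noteq> y"
  shows "eventually (\<lambda>n. y \<notin> dyadic_cell h n x) sequentially"
proof -
  have "eventually (\<lambda>n. h / 2 ^ n < \<bar>x - y\<bar>) sequentially"
    using assms by (intro order_tendstoD[OF mesh_LIMSEQ]) auto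
  then show ?thesis
  proof eventually_elim
    case (elim n)
    show ?case
    proof
      assume "y \<in> dyadic_cell h n x"
      moreover have "x \<in> dyadic_cell h n x"
        using assms by (simp add: mem_dyadic_cell)
      ultimately have "\<bar>x - y\<bar> < h / 2 ^ n"
        unfolding dyadic_cell_def cell_def by (auto simp: algebra_simps abs_less_iff)
      with elim show False by simp
    qed
  qed
qed

lemma INT_dyadic_cell:
  assumes "0 < h" "0 \<le> x"
  shows "(\<Inter>n. dyadic_cell h n x) = {x}"
proof -
  have "y = x" if y: "\<forall>n. y \<in> dyadic_cell h n x" for y
  proof (rule ccontr)
    assume "y \<noteq> x"
    moreover have "0 \<le> y"
      using y assms by (auto simp: dyadic_cell_def mem_cell_iff)
    ultimately have "eventually (\<lambda>n. y \<notin> dyadic_cell h n x) sequentially"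
      using assms by (intro eventually_dyadic_cells_separate) auto
    with y show False by simp
  qed
  then show ?thesis
    using mem_dyadic_cell[OF assms] by auto
qed

text \<open>A finite set has finitely many pairs, so one mesh separates them all. This is what later
  makes cell sums exact instead of approximate.\<close>

lemma eventually_inj_on_cell_index:
  assumes "0 < h" "finite F" "F \<subseteq> {0..}"
  shows "eventually (\<lambda>n. inj_on (cell_index (h / 2 ^ n)) F) sequentially"
proof -
  have "eventually (\<lambda>n. \<forall>x\<in>F. \<forall>y\<in>F. x \<noteq> y \<longrightarrow> y \<notin> dyadic_cell h n x) sequentially"
    using assms eventually_dyadic_cells_separate[OF assms(1)]
    by (intro eventually_ball_finite ballI) (auto simp: subset_eq)
  then show ?thesis
  proof eventually_elim
    case (elim n)
    then show ?case
      using assms by (auto simp: inj_on_def dyadic_cell_def mem_cell_iff subset_eq)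
  qed
qed

text \<open>Continuity from above along the decreasing cells, which applies because bounded sets
  have finite mass.\<close>

lemma measure_dyadic_cell_LIMSEQ:
  assumes h: "0 < h" "0 \<le> x" and V: "sets V = sets half_line"
    and fin: "\<And>B. B \<in> bounded_borel {0..} \<Longrightarrow> emeasure V B < \<infinity>"
  shows "(\<lambda>n. measure V (dyadic_cell h n x)) \<longlonglongrightarrow> measure V {x}"
proof -
  have "(\<lambda>n. measure V (dyadic_cell h n x)) \<longlonglongrightarrow> measure V (\<Inter>n. dyadic_cell h n x)"
    using h fin[OF cell_in_bounded_borel] cell_in_sets_half_line
    by (intro Lim_measure_decseq decseq_dyadic_cell)
       (auto simp: V dyadic_cell_def less_top[symmetric])
  then show ?thesis
    by (simp add: INT_dyadic_cell h)
qed

section \<open>Purely atomic signed measures\<close>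

text \<open>Integrability with respect to the counting measure encodes absolute summability of the
  atoms in a bounded set, with no enumeration of the atoms to carry around.\<close>

definition purely_atomic :: "(real set \<Rightarrow> real) \<Rightarrow> bool" where
  "purely_atomic w \<longleftrightarrow> (\<forall>B\<in>bounded_borel {0..}.
     integrable (count_space B) (\<lambda>\<theta>. w {\<theta>}) \<and> w B = (\<integral>\<theta>. w {\<theta>} \<partial>count_space B))"

text \<open>Reduces the negative side to the positive side of \<open>- w\<close>, so that only
  \<open>jordan_pos\<close> has to be studied.\<close>

lemma jordan_neg_eq: "jordan_neg w = jordan_pos (\<lambda>B. - w B)"
  by (simp add: jordan_neg_def jordan_pos_def)

lemma purely_atomic_uminus: "purely_atomic w \<Longrightarrow> purely_atomic (\<lambda>B. - w B)"
  by (simp add: purely_atomic_def)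

lemma sets_jordan_pos [simp, measurable_cong]: "sets (jordan_pos w) = sets half_line"
  by (simp add: jordan_pos_def)

lemma space_jordan_pos [simp]: "space (jordan_pos w) = {0..}"
  by (simp add: jordan_pos_def space_restrict_space)

lemma emeasure_jordan_pos:
  assumes "B \<in> sets half_line"
  shows "emeasure (jordan_pos w) B = (\<integral>\<^sup>+\<theta>. ennreal (w {\<theta>}) \<partial>count_space B)"
proof -
  have B: "B \<subseteq> {0..}"
    using sets.sets_into_space[OF assms] by (auto simp: space_restrict_space)
  have "emeasure (jordan_pos w) B = emeasure (density (count_space {0..}) (\<lambda>\<theta>. ennreal (w {\<theta>}))) B"
    using assms B unfolding jordan_pos_def
    by (subst emeasure_distr)
       (auto simp: space_density space_restrict_space Int_absorb2 measurable_def sets_restrict_space)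
  also have "\<dots> = (\<integral>\<^sup>+\<theta>. ennreal (w {\<theta>}) * indicator B \<theta> \<partial>count_space {0..})"
    using B by (subst emeasure_density) auto
  also have "\<dots> = (\<integral>\<^sup>+\<theta>. ennreal (w {\<theta>}) \<partial>count_space B)"
    using B by (subst nn_integral_restrict_space[symmetric])
      (auto simp: restrict_count_space Int_absorb1 Int_absorb2)
  finally show ?thesis .
qed

lemma measure_jordan_pos_singleton:
  assumes "0 \<le> x"
  shows "measure (jordan_pos w) {x} = max 0 (w {x})"
proof -
  have "{x} \<in> sets half_line"
    using assms by (auto simp: sets_restrict_space_iff)
  then have "emeasure (jordan_pos w) {x} = ennreal (w {x})"
    by (subst emeasure_jordan_pos) (auto simp: nn_integral_count_space_finite)
  then show ?thesis
    by (cases "0 \<le> w {x}") (simp_all add: measure_def ennreal_neg)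
qed

lemma emeasure_jordan_pos_finite:
  assumes "purely_atomic w" "B \<in> bounded_borel {0..}"
  shows "emeasure (jordan_pos w) B < \<infinity>"
proof -
  have "integrable (count_space B) (\<lambda>\<theta>. w {\<theta>})"
    using assms by (auto simp: purely_atomic_def)
  then have "(\<integral>\<^sup>+\<theta>. ennreal (norm (w {\<theta>})) \<partial>count_space B) < \<infinity>"
    by (simp add: integrable_iff_bounded)
  moreover have "(\<integral>\<^sup>+\<theta>. ennreal (w {\<theta>}) \<partial>count_space B) \<le> (\<integral>\<^sup>+\<theta>. ennreal (norm (w {\<theta>})) \<partial>count_space B)"
    by (intro nn_integral_mono) (auto intro!: ennreal_leI)
  ultimately show ?thesis
    using assms by (simp add: emeasure_jordan_pos bounded_borel_half_line)
qed

text \<open>A real integral is the difference of the integrals of the positive and the negative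
  part, and for the counting measure these are the two Jordan masses.\<close>

lemma purely_atomic_eq_jordan_diff:
  assumes "purely_atomic w" "B \<in> bounded_borel {0..}"
  shows "w B = measure (jordan_pos w) B - measure (jordan_neg w) B"
proof -
  have "integrable (count_space B) (\<lambda>\<theta>. w {\<theta>})" and w: "w B = (\<integral>\<theta>. w {\<theta>} \<partial>count_space B)"
    using assms by (auto simp: purely_atomic_def)
  then show ?thesis
    using assms by (simp add: jordan_neg_eq measure_def emeasure_jordan_pos bounded_borel_half_line
        real_lebesgue_integral_def[of "count_space B"])
qed

text \<open>The easy half of the variational description of the positive part; it bounds cell sums
  from above.\<close>

lemma purely_atomic_le_jordan_pos:
  assumes "purely_atomic w" "B \<in> bounded_borel {0..}"
  shows "max 0 (w B) \<le> measure (jordan_pos w) B"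
proof (rule max.boundedI)
  show "w B \<le> measure (jordan_pos w) B"
    using purely_atomic_eq_jordan_diff[OF assms] measure_nonneg[of "jordan_neg w" B] by linarith
qed (rule measure_nonneg)

lemma purely_atomic_dyadic_cell_LIMSEQ:
  assumes "purely_atomic w" "0 < h" "0 \<le> x"
  shows "(\<lambda>n. w (dyadic_cell h n x)) \<longlonglongrightarrow> w {x}"
proof -
  have "(\<lambda>n. measure (jordan_pos w) (dyadic_cell h n x) - measure (jordan_neg w) (dyadic_cell h n x))
     \<longlonglongrightarrow> measure (jordan_pos w) {x} - measure (jordan_neg w) {x}"
    using assms emeasure_jordan_pos_finite purely_atomic_uminus unfolding jordan_neg_eq
    by (intro tendsto_diff measure_dyadic_cell_LIMSEQ) auto
  moreover have "{x} \<in> bounded_borel {0..}" "dyadic_cell h n x \<in> bounded_borel {0..}" for n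
    using assms cell_in_bounded_borel[of "h / 2 ^ n" "cell_index (h / 2 ^ n) x"]
    by (auto simp: bounded_borel_def dyadic_cell_def)
  ultimately show ?thesis
    using assms by (simp add: purely_atomic_eq_jordan_diff)
qed

text \<open>The form as an unordered sum supplies finite sets of atoms that carry almost all of the
  mass.\<close>

lemma jordan_pos_has_sum:
  assumes "purely_atomic w" "B \<in> bounded_borel {0..}"
  shows "((\<lambda>\<theta>. max 0 (w {\<theta>})) has_sum measure (jordan_pos w) B) B"
proof -
  let ?p = "\<lambda>\<theta>. max 0 (w {\<theta>})"
  have "integrable (count_space B) (\<lambda>\<theta>. w {\<theta>})"
    using assms by (auto simp: purely_atomic_def)
  then have int: "integrable (count_space B) ?p"
    by (rule Bochner_Integration.integrable_bound) auto
  then have abs: "Infinite_Set_Sum.abs_summable_on ?p B"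
    by (simp add: Infinite_Set_Sum.abs_summable_on_def)
  have "measure (jordan_pos w) B = (\<integral>\<theta>. ?p \<theta> \<partial>count_space B)"
    using assms int by (subst integral_eq_nn_integral)
      (auto simp: measure_def emeasure_jordan_pos bounded_borel_half_line max_def ennreal_neg
        intro!: arg_cong[where f=enn2real] nn_integral_cong)
  also have "\<dots> = infsum ?p B"
    using infsetsum_infsum[OF abs] by (simp add: infsetsum_def)
  finally have "measure (jordan_pos w) B = infsum ?p B" .
  moreover have "?p summable_on B"
    by (rule abs_summable_summable[OF abs_summable_equivalent[THEN iffD2, OF abs]])
  ultimately show ?thesis
    using has_sum_infsum by fastforce
qed

text \<open>Upper bound: on each cell the positive part of the value is at most the Jordan mass.
  Lower bound: finitely many atoms carry more than any given number below the mass, and once the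
  cells separate these atoms, their cells alone contribute almost as much.\<close>

lemma cells_jordan_pos_LIMSEQ:
  assumes w: "purely_atomic w" and h: "0 < h" and B: "B \<in> bounded_borel {0..}"
    and Q: "\<And>n. finite (Q n)" "\<And>n. B \<subseteq> (\<Union>k\<in>Q n. cell (h / 2 ^ n) k)"
  shows "(\<lambda>n. \<Sum>k\<in>Q n. max 0 (w (B \<inter> cell (h / 2 ^ n) k))) \<longlonglongrightarrow> measure (jordan_pos w) B"
    (is "?a \<longlonglongrightarrow> _")
proof (rule order_tendstoI)
  have BI [simp]: "B \<inter> cell \<delta> k \<in> bounded_borel {0..}" for \<delta> k
    using B by (rule bounded_borel_Int_borel) auto
  have fin: "emeasure (jordan_pos w) C \<noteq> \<infinity>" if "C \<in> bounded_borel {0..}" for C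
    using emeasure_jordan_pos_finite[OF w that] by simp
  have le: "?a n \<le> measure (jordan_pos w) B" for n
  proof -
    have "?a n \<le> (\<Sum>k\<in>Q n. measure (jordan_pos w) (B \<inter> cell (h / 2 ^ n) k))"
      by (intro sum_mono purely_atomic_le_jordan_pos w) simp
    also have "\<dots> = measure (jordan_pos w) (\<Union>k\<in>Q n. B \<inter> cell (h / 2 ^ n) k)"
      using h Q disjoint_family_cell[of "h / 2 ^ n"] bounded_borel_half_line[OF BI] fin[OF BI]
      by (intro measure_finite_Union[symmetric]) (fastforce simp: disjoint_family_on_def)+
    also have "(\<Union>k\<in>Q n. B \<inter> cell (h / 2 ^ n) k) = B"
      using Q(2)[of n] by auto
    finally show ?thesis .
  qed
  {
    fix a assume "measure (jordan_pos w) B < a"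
    with le show "eventually (\<lambda>n. ?a n < a) sequentially"
      by (auto intro!: always_eventually intro: le_less_trans)
  next
    fix a assume a: "a < measure (jordan_pos w) B"
    obtain F where F: "finite F" "F \<subseteq> B" "a < (\<Sum>\<theta>\<in>F. max 0 (w {\<theta>}))"
    proof -
      have "eventually (\<lambda>F. a < (\<Sum>\<theta>\<in>F. max 0 (w {\<theta>}))) (finite_subsets_at_top B)"
        using jordan_pos_has_sum[OF w B] a unfolding has_sum_def by (auto dest: order_tendstoD)
      then show ?thesis
        using that unfolding eventually_finite_subsets_at_top by blast
    qed
    have F0: "F \<subseteq> {0..}"
      using F(2) B by (auto simp: bounded_borel_def)
    let ?b = "\<lambda>n. \<Sum>\<theta>\<in>F. max 0 (w (B \<inter> dyadic_cell h n \<theta>))"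
    \<comment> \<open>The limit along dyadic cells is known for whole cells, so it is applied to the
      trace of \<open>w\<close> on \<open>B\<close>.\<close>
    have wB: "purely_atomic (\<lambda>C. w (B \<inter> C))"
      unfolding purely_atomic_def
    proof (intro ballI conjI)
      fix C :: "real set" assume C: "C \<in> bounded_borel {0..}"
      then have BC: "B \<inter> C \<in> bounded_borel {0..}"
        using B by (intro bounded_borel_Int_borel) (auto simp: bounded_borel_def)
      have w0: "w {} = 0"
      proof -
        have "{} \<in> bounded_borel {0::real..}"
          by (simp add: bounded_borel_def)
        then have "w {} = (\<integral>\<theta>. w {\<theta>} \<partial>count_space {})"
          using w unfolding purely_atomic_def by blast
        then show ?thesis
          by (simp add: lebesgue_integral_count_space_finite)
      qed
      have eq: "(\<lambda>\<theta>. w (B \<inter> {\<theta>})) = (\<lambda>\<theta>. indicator B \<theta> *\<^sub>R w {\<theta>})"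
        by (auto simp: fun_eq_iff indicator_def w0)
      have r: "count_space (B \<inter> C) = restrict_space (count_space C) B"
        by (simp add: restrict_count_space Int_commute)
      have i: "integrable (count_space (B \<inter> C)) (\<lambda>\<theta>. w {\<theta>})"
           and wi: "w (B \<inter> C) = (\<integral>\<theta>. w {\<theta>} \<partial>count_space (B \<inter> C))"
        using w BC by (auto simp: purely_atomic_def)
      show "integrable (count_space C) (\<lambda>\<theta>. w (B \<inter> {\<theta>}))"
        using i unfolding eq r by (subst (asm) integrable_restrict_space) auto
      show "w (B \<inter> C) = (\<integral>\<theta>. w (B \<inter> {\<theta>}) \<partial>count_space C)"
        unfolding eq wi r by (subst integral_restrict_space) auto
    qed
    have "?b \<longlonglongrightarrow> (\<Sum>\<theta>\<in>F. max 0 (w (B \<inter> {\<theta>})))"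
      using F0 h by (intro tendsto_sum tendsto_max tendsto_const
          purely_atomic_dyadic_cell_LIMSEQ[OF wB]) auto
    also have "(\<Sum>\<theta>\<in>F. max 0 (w (B \<inter> {\<theta>}))) = (\<Sum>\<theta>\<in>F. max 0 (w {\<theta>}))"
      using F(2) by (intro sum.cong refl) (auto simp: Int_absorb1)
    finally have "eventually (\<lambda>n. a < ?b n) sequentially"
      using F(3) by (rule order_tendstoD)
    then show "eventually (\<lambda>n. a < ?a n) sequentially"
      using eventually_inj_on_cell_index[OF h F(1) F0]
    proof eventually_elim
      case (elim n)
      \<comment> \<open>Distinct points of \<open>F\<close> lie in distinct cells, so the sum over
        points is a sum over some of the cells of \<open>Q n\<close>; the other cells add
        nonnegative terms.\<close>
      have "?b n = (\<Sum>k\<in>cell_index (h / 2 ^ n) ` F. max 0 (w (B \<inter> cell (h / 2 ^ n) k)))"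
        using elim(2) by (subst sum.reindex) (auto simp: dyadic_cell_def)
      also have "\<dots> \<le> ?a n"
      proof (rule sum_mono2)
        show "cell_index (h / 2 ^ n) ` F \<subseteq> Q n"
          using Q(2)[of n] F(2) h by (auto simp: mem_cell_iff subset_eq)
      qed (use Q in auto)
      finally show ?case
        using elim by simp
    qed
  }
qed

section \<open>Poisson processes\<close>

lemma point_measures_cases:
  assumes "N \<in> space (point_measures S)"
  obtains I :: "nat set" and x where "x \<in> I \<rightarrow> space S" "N = distr (count_space I) S x"
  using assms by (auto simp: point_measures_def space_restrict_space)

lemma sets_point_measures_eq: "N \<in> space (point_measures S) \<Longrightarrow> sets N = sets S"
  by (auto elim!: point_measures_cases)

lemma measurable_emeasure_point_measures [measurable]:
  "A \<in> sets S \<Longrightarrow> (\<lambda>N. emeasure N A) \<in> borel_measurable (point_measures S)"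
  unfolding point_measures_def by (intro measurable_restrict_space1) measurable

lemma emeasure_point_measures:
  assumes "N \<in> space (point_measures S)" "A \<in> sets S"
  shows "emeasure N A \<in> range of_nat \<union> {\<infinity>}"
proof -
  obtain I :: "nat set" and x where x: "x \<in> I \<rightarrow> space S" "N = distr (count_space I) S x"
    using assms by (elim point_measures_cases)
  then have "emeasure N A = emeasure (count_space I) (x -` A \<inter> I)"
    using assms by (simp add: emeasure_distr)
  then show ?thesis
    by (auto simp: emeasure_count_space)
qed

lemma measure_eqI_extended_nat:
  fixes P Q :: "ennreal measure"
  assumes "prob_space P" "prob_space Q" and sets: "sets P = sets borel" "sets Q = sets borel"
    and AE: "AE x in P. x \<in> range of_nat \<union> {\<infinity>}" "AE x in Q. x \<in> range of_nat \<union> {\<infinity>}"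
    and eq: "\<And>k::nat. emeasure P {of_nat k} = emeasure Q {of_nat k}"
  shows "P = Q"
proof -
  let ?C = "range of_nat \<union> {\<infinity>} :: ennreal set"
  interpret P: prob_space P by fact
  interpret Q: prob_space Q by fact
  have N: "countable (range (of_nat :: nat \<Rightarrow> ennreal))" "range of_nat \<in> sets (borel :: ennreal measure)"
    by (simp, rule sets.countable) simp_all
  have count: "emeasure R A = (\<integral>\<^sup>+x. emeasure R {x} \<partial>count_space A)"
    if "sets R = sets borel" "A \<subseteq> ?C" for R and A :: "ennreal set"
    using that by (intro emeasure_countable_singleton) (auto intro: countable_subset[OF that(2)])
  have "emeasure P (range of_nat) = emeasure Q (range of_nat)"
    using sets eq by (subst (1 2) count) (auto intro!: nn_integral_cong)
  moreover have "emeasure R {\<infinity>} = 1 - emeasure R (range of_nat)"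
    if R: "prob_space R" "sets R = sets borel" "AE x in R. x \<in> ?C" for R
  proof -
    interpret R: prob_space R by fact
    have "AE x in R. (x \<in> {\<infinity>}) = (x \<in> space R - range of_nat)"
      using R(3) by eventually_elim (auto simp: sets_eq_imp_space_eq[OF R(2)])
    then have "emeasure R {\<infinity>} = emeasure R (space R - range of_nat)"
      using R(2) N by (intro emeasure_eq_AE) auto
    also have "\<dots> = emeasure R (space R) - emeasure R (range of_nat)"
      using R(2) N by (intro emeasure_compl) auto
    finally show ?thesis
      by (simp add: R.emeasure_space_1)
  qed
  ultimately have "emeasure P {\<infinity>} = emeasure Q {\<infinity>}"
    using assms by simp
  with eq have eq': "emeasure P {x} = emeasure Q {x}" if "x \<in> ?C" for x
    using that by auto
  show ?thesis
  proof (rule measure_eqI)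
    fix A assume "A \<in> sets P"
    then have A [measurable]: "A \<in> sets borel" and AC: "A \<inter> ?C \<in> sets borel"
      using sets N by auto
    have "emeasure R A = emeasure R (A \<inter> ?C)"
      if "sets R = sets borel" "AE x in R. x \<in> ?C" for R
      using that A AC by (intro emeasure_eq_AE) auto
    then have "emeasure P A = emeasure P (A \<inter> ?C)" "emeasure Q A = emeasure Q (A \<inter> ?C)"
      using sets AE by auto
    moreover have "emeasure P (A \<inter> ?C) = emeasure Q (A \<inter> ?C)"
      using sets by (subst (1 2) count) (auto intro!: nn_integral_cong eq')
    ultimately show "emeasure P A = emeasure Q A"
      by simp
  qed (simp add: sets)
qed

text \<open>The mean determines the probability of every finite count; for an infinite mean all
  these probabilities are 0.\<close>

lemma poisson_process_distr_eq:
  assumes N: "poisson_process M \<mu> N" and A: "A \<in> sets \<mu>" "A' \<in> sets \<mu>" "emeasure \<mu> A = emeasure \<mu> A'"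
  shows "distr M borel (\<lambda>\<omega>. emeasure (N \<omega>) A) = distr M borel (\<lambda>\<omega>. emeasure (N \<omega>) A')"
proof -
  interpret prob_space M
    using N by (simp add: poisson_process_def)
  have N_meas [measurable]: "N \<in> M \<rightarrow>\<^sub>M point_measures \<mu>"
    using N by (simp add: poisson_process_def)
  have meas [measurable]: "(\<lambda>\<omega>. emeasure (N \<omega>) C) \<in> borel_measurable M" if "C \<in> sets \<mu>" for C
    using that by measurable
  have pr: "emeasure M {\<omega>\<in>space M. emeasure (N \<omega>) C = of_nat k} =
      (if emeasure \<mu> C < \<infinity> then ennreal (exp (- measure \<mu> C) * measure \<mu> C ^ k / fact k) else 0)"
    if C: "C \<in> sets \<mu>" for C k
  proof (cases "emeasure \<mu> C < \<infinity>")
    case True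
    then show ?thesis
      using N C by (simp add: poisson_process_def emeasure_eq_measure)
  next
    case False
    then have "AE \<omega> in M. emeasure (N \<omega>) C = \<infinity>"
      using N C by (auto simp: poisson_process_def less_top[symmetric])
    then have "AE \<omega> in M. \<not> (emeasure (N \<omega>) C = of_nat k)"
      by eventually_elim simp
    then show ?thesis
      using False C by (auto intro!: emeasure_eq_0_AE)
  qed
  have sp: "N \<omega> \<in> space (point_measures \<mu>)" if "\<omega> \<in> space M" for \<omega>
    using that by (rule measurable_space[OF N_meas])
  have C: "range of_nat \<union> {\<infinity>} \<in> sets (borel :: ennreal measure)"
    by (rule sets.countable) auto
  have AE_val: "AE x in distr M borel (\<lambda>\<omega>. emeasure (N \<omega>) B). x \<in> range of_nat \<union> {\<infinity>}"
    if B: "B \<in> sets \<mu>" for B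
  proof (rule AE_distr_iff[THEN iffD2])
    show "AE \<omega> in M. emeasure (N \<omega>) B \<in> range of_nat \<union> {\<infinity>}"
      using emeasure_point_measures[OF sp B] by (rule AE_I2)
    show "{x \<in> space borel. x \<in> range of_nat \<union> {\<infinity> :: ennreal}} \<in> sets borel"
      using C by (simp only: space_borel Collect_mem_eq UNIV_I simp_thms)
  qed (use B in simp)
  show ?thesis
  proof (rule measure_eqI_extended_nat)
    show "AE x in distr M borel (\<lambda>\<omega>. emeasure (N \<omega>) A). x \<in> range of_nat \<union> {\<infinity>}"
      "AE x in distr M borel (\<lambda>\<omega>. emeasure (N \<omega>) A'). x \<in> range of_nat \<union> {\<infinity>}"
      by (intro AE_val A)+
    show "emeasure (distr M borel (\<lambda>\<omega>. emeasure (N \<omega>) A)) {of_nat k} =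
        emeasure (distr M borel (\<lambda>\<omega>. emeasure (N \<omega>) A')) {of_nat k}" for k
      using A pr[of A k] pr[of A' k]
      by (simp add: emeasure_distr vimage_def Int_def conj_commute measure_def)
  qed (use A in \<open>auto intro!: prob_space_distr\<close>)
qed

text \<open>Characteristic functions converge by dominated convergence, and they determine the
  law.\<close>

lemma (in prob_space) distr_LIMSEQ_unique:
  fixes X Y :: "nat \<Rightarrow> 'a \<Rightarrow> real"
  assumes [measurable]: "\<And>n. X n \<in> borel_measurable M" "\<And>n. Y n \<in> borel_measurable M"
      "X' \<in> borel_measurable M" "Y' \<in> borel_measurable M"
    and eq: "\<And>n. distr M borel (X n) = distr M borel (Y n)"
    and lim: "\<And>\<omega>. \<omega> \<in> space M \<Longrightarrow> (\<lambda>n. X n \<omega>) \<longlonglongrightarrow> X' \<omega>"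
      "\<And>\<omega>. \<omega> \<in> space M \<Longrightarrow> (\<lambda>n. Y n \<omega>) \<longlonglongrightarrow> Y' \<omega>"
  shows "distr M borel X' = distr M borel Y'"
proof (rule Levy_uniqueness)
  have *: "(\<lambda>n. char (distr M borel (U n)) t) \<longlonglongrightarrow> char (distr M borel U') t"
    if [measurable]: "\<And>n. U n \<in> borel_measurable M" "U' \<in> borel_measurable M"
    and U: "\<And>\<omega>. \<omega> \<in> space M \<Longrightarrow> (\<lambda>n. U n \<omega>) \<longlonglongrightarrow> U' \<omega>"
    for U :: "nat \<Rightarrow> 'a \<Rightarrow> real" and U' t
  proof -
    have "(\<lambda>n. CLINT \<omega>|M. iexp (t * U n \<omega>)) \<longlonglongrightarrow> (CLINT \<omega>|M. iexp (t * U' \<omega>))"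
      by (rule integral_dominated_convergence[where w="\<lambda>_. 1"])
         (auto intro!: AE_I2 tendsto_intros U)
    then show ?thesis
      by (simp add: char_def integral_distr)
  qed
  show "char (distr M borel X') = char (distr M borel Y')"
  proof
    fix t
    have "(\<lambda>n. char (distr M borel (X n)) t) \<longlonglongrightarrow> char (distr M borel X') t"
      by (rule *) (auto intro: lim)
    moreover have "(\<lambda>n. char (distr M borel (Y n)) t) \<longlonglongrightarrow> char (distr M borel Y') t"
      by (rule *) (auto intro: lim)
    ultimately show "char (distr M borel X') t = char (distr M borel Y') t"
      unfolding eq by (rule LIMSEQ_unique)
  qed
qed (auto intro!: real_distribution_distr)

text \<open>Summation over the fibres of \<open>t\<close>. Applied to the points of a Poisson
  process, it collects all points with the same location into one atom.\<close>

lemma abs_summable_group_by: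
  fixes a :: "'i \<Rightarrow> real"
  assumes "(\<lambda>i. norm (a i)) summable_on {i\<in>I. t i \<in> B}"
  shows "(\<lambda>\<theta>. norm (infsum a {i\<in>I. t i = \<theta>})) summable_on B"
    and "infsum (\<lambda>\<theta>. infsum a {i\<in>I. t i = \<theta>}) B = infsum a {i\<in>I. t i \<in> B}"
proof -
  let ?J = "\<lambda>\<theta>. {i\<in>I. t i = \<theta>}"
  have bij: "bij_betw snd (Sigma B ?J) {i\<in>I. t i \<in> B}"
    by (auto simp: bij_betw_def inj_on_def image_iff intro!: rev_bexI)
  have abs: "(\<lambda>p. norm (a (snd p))) summable_on Sigma B ?J"
    using assms summable_on_reindex_bij_betw[OF bij, of "\<lambda>i. norm (a i)"] by simp
  then have sum: "(\<lambda>p. a (snd p)) summable_on Sigma B ?J"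
    by (rule abs_summable_summable)
  have "(\<lambda>\<theta>. norm (infsum (\<lambda>i. norm (a i)) (?J \<theta>))) summable_on B"
     and J: "\<forall>\<theta>\<in>B. (\<lambda>i. norm (a i)) summable_on ?J \<theta>"
    using abs Infinite_Sum.abs_summable_on_Sigma_iff[of "\<lambda>p. a (snd p)" B ?J] by auto
  then show "(\<lambda>\<theta>. norm (infsum a (?J \<theta>))) summable_on B"
    by (elim Infinite_Sum.abs_summable_on_comparison_test) (use norm_infsum_bound in \<open>fastforce simp: infsum_nonneg\<close>)
  show "infsum (\<lambda>\<theta>. infsum a (?J \<theta>)) B = infsum a {i\<in>I. t i \<in> B}"
    using infsum_Sigma_banach[OF sum] infsum_reindex_bij_betw[OF bij, of a] by simp
qed

lemma poisson_process_prob: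
  assumes "poisson_process M \<mu> N" "A \<in> sets \<mu>" "emeasure \<mu> A < \<infinity>"
  shows "measure M {\<omega> \<in> space M. emeasure (N \<omega>) A = of_nat k} =
    exp (- measure \<mu> A) * measure \<mu> A ^ k / fact k"
  using assms by (simp add: poisson_process_def)

lemma poisson_process_indep_vars:
  fixes A :: "nat \<Rightarrow> 'b set"
  assumes "poisson_process M \<mu> N" "\<And>i. A i \<in> sets \<mu>" "disjoint_family_on A {..<n}"
  shows "prob_space.indep_vars M (\<lambda>_. borel) (\<lambda>i \<omega>. emeasure (N \<omega>) (A i)) {..<n}"
  using assms by (simp add: poisson_process_def)

section \<open>Completely random signed measures\<close>

text \<open>By Markov's inequality the jumps whose truncated size is at least 1/(n+1) form a set of
  finite mass, and these sets exhaust the space because 0 is excluded. Without this the product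
  measure of a rectangle could not be computed.\<close>

lemma sigma_finite_levy_measure:
  assumes "levy_measure \<rho>"
  shows "sigma_finite_measure \<rho>"
proof
  have sets_\<rho>: "sets \<rho> = sets (restrict_space borel (- {0::real}))"
    and fin: "(\<integral>\<^sup>+w. min 1 (ennreal \<bar>w\<bar>) \<partial>\<rho>) < \<infinity>"
    using assms by (simp_all only: levy_measure_def)
  have space_\<rho>: "space \<rho> = - {0}"
    using sets_eq_imp_space_eq[OF sets_\<rho>] by (simp add: space_restrict_space)
  have id: "(\<lambda>w. w) \<in> borel_measurable \<rho>"
    using measurable_restrict_space1[OF measurable_ident, of borel "- {0::real}"]
    by (simp add: id_def measurable_cong_sets[OF sets_\<rho> refl])
  define E where "E n = {w \<in> space \<rho>. 1 \<le> of_nat (Suc n) * min 1 (ennreal \<bar>w\<bar>)}" for n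
  have meas: "(\<lambda>w. min 1 (ennreal \<bar>w\<bar>)) \<in> borel_measurable \<rho>"
    using id by measurable
  then have E: "E n \<in> sets \<rho>" for n
    unfolding E_def by measurable
  have "emeasure \<rho> (E n) \<noteq> \<infinity>" for n
  proof -
    have "emeasure \<rho> (E n) \<le> of_nat (Suc n) * (\<integral>\<^sup>+w. min 1 (ennreal \<bar>w\<bar>) * indicator (space \<rho>) w \<partial>\<rho>)"
      unfolding E_def
      using nn_integral_Markov_inequality[OF _ sets.top, of "\<lambda>w. min 1 (ennreal \<bar>w\<bar>)" \<rho> "of_nat (Suc n)"] meas by measurable
    also have "(\<integral>\<^sup>+w. min 1 (ennreal \<bar>w\<bar>) * indicator (space \<rho>) w \<partial>\<rho>) = (\<integral>\<^sup>+w. min 1 (ennreal \<bar>w\<bar>) \<partial>\<rho>)"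
      by (intro nn_integral_cong) simp
    also have "of_nat (Suc n) * \<dots> < \<infinity>"
      using fin by (simp add: ennreal_mult_less_top of_nat_less_top del: of_nat_Suc)
    finally show ?thesis
      by simp
  qed
  moreover have "(\<Union>n. E n) = space \<rho>"
  proof -
    have "\<exists>n. 1 \<le> of_nat (Suc n) * min 1 (ennreal \<bar>w\<bar>)" if w: "w \<noteq> 0" for w :: real
    proof -
      obtain n where n: "inverse (real (Suc n)) < \<bar>w\<bar>"
        using reals_Archimedean[of "\<bar>w\<bar>"] w by auto
      then have "1 \<le> real (Suc n) * min 1 \<bar>w\<bar>"
        by (auto simp: min_def field_simps)
      then have "1 \<le> ennreal (real (Suc n) * min 1 \<bar>w\<bar>)"
        using ennreal_leI by fastforce
      also have "\<dots> = of_nat (Suc n) * min 1 (ennreal \<bar>w\<bar>)"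
        by (simp add: ennreal_mult ennreal_of_nat_eq_real_of_nat min_def ennreal_le_1 del: of_nat_Suc)
      finally show ?thesis ..
    qed
    then show ?thesis
      by (auto simp: E_def space_\<rho>)
  qed
  ultimately show "\<exists>A. countable A \<and> A \<subseteq> sets \<rho> \<and> \<Union> A = space \<rho> \<and> (\<forall>a\<in>A. emeasure \<rho> a \<noteq> \<infinity>)"
    using E by (intro exI[of _ "range E"]) auto
qed

lemma space_lborel_half_line: "space (restrict_space lborel {0::real..}) = {0..}"
  by (simp add: space_restrict_space)

lemma bounded_borel_in_sets_lborel_half_line:
  "B \<in> bounded_borel {0..} \<Longrightarrow> B \<in> sets (restrict_space lborel {0::real..}) \<and> bounded B"
  by (auto simp: bounded_borel_def sets_restrict_space_iff)

lemma emeasure_lborel_half_line: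
  "B \<in> bounded_borel {0..} \<Longrightarrow> emeasure (restrict_space lborel {0::real..}) B = emeasure lborel B"
  by (subst emeasure_restrict_space) (auto simp: bounded_borel_def)

lemma emeasure_pair_levy:
  fixes B :: "real set"
  assumes "levy_measure \<rho>" "B \<in> bounded_borel {0..}" "E \<in> sets \<rho>"
  shows "emeasure (restrict_space lborel {0..} \<Otimes>\<^sub>M \<rho>) (B \<times> E) = emeasure lborel B * emeasure \<rho> E"
  using assms bounded_borel_in_sets_lborel_half_line[OF assms(2)] emeasure_lborel_half_line[OF assms(2)]
  by (subst sigma_finite_measure.emeasure_pair_measure_Times[OF sigma_finite_levy_measure]) auto

text \<open>A realization of \<open>\<Psi>\<close> is a countable sum of Dirac measures, so W is an
  absolutely convergent series over its points; grouping them by location exhibits the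
  atoms.\<close>

lemma CRSM_purely_atomic:
  assumes W: "CRSM M \<rho> (restrict_space lborel {0..}) W" and \<omega>: "\<omega> \<in> space M"
  shows "purely_atomic (W \<omega>)"
proof -
  let ?\<Lambda> = "restrict_space lborel {0::real..}"
  obtain \<Psi> where \<Psi>: "poisson_process M (?\<Lambda> \<Otimes>\<^sub>M \<rho>) \<Psi>"
    and int: "\<And>\<omega> B. \<omega> \<in> space M \<Longrightarrow> B \<in> sets ?\<Lambda> \<Longrightarrow> bounded B \<Longrightarrow> set_integrable (\<Psi> \<omega>) (B \<times> space \<rho>) snd"
    and eq: "\<And>\<omega> B. \<omega> \<in> space M \<Longrightarrow> B \<in> sets ?\<Lambda> \<Longrightarrow> bounded B \<Longrightarrow> W \<omega> B = (LINT p:B \<times> space \<rho>|\<Psi> \<omega>. snd p)"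
    using W by (auto simp: CRSM_def)
  have "\<Psi> \<omega> \<in> space (point_measures (?\<Lambda> \<Otimes>\<^sub>M \<rho>))"
    using \<Psi> \<omega> by (auto simp: poisson_process_def dest: measurable_space)
  then obtain I :: "nat set" and x
    where x: "x \<in> I \<rightarrow> space (?\<Lambda> \<Otimes>\<^sub>M \<rho>)" and \<Psi>\<omega>: "\<Psi> \<omega> = distr (count_space I) (?\<Lambda> \<Otimes>\<^sub>M \<rho>) x"
    by (rule point_measures_cases)
  define a where "a i = snd (x i)" for i
  define t where "t i = fst (x i)" for i
  \<comment> \<open>The integral against \<open>\<Psi> \<omega>\<close> is turned into a series over
    indices, where it can be regrouped.\<close>
  have *: "(\<lambda>i. norm (a i)) summable_on {i\<in>I. t i \<in> B} \<and> W \<omega> B = infsum a {i\<in>I. t i \<in> B}"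
    if B: "B \<in> bounded_borel {0..}" for B
  proof -
    have B': "B \<in> sets ?\<Lambda>" "bounded B"
      using bounded_borel_in_sets_lborel_half_line[OF B] by auto
    let ?g = "\<lambda>p. indicat_real (B \<times> space \<rho>) p *\<^sub>R snd p"
    have g: "integrable (\<Psi> \<omega>) ?g" "W \<omega> B = (\<integral>p. ?g p \<partial>\<Psi> \<omega>)"
      using int[OF \<omega> B'] eq[OF \<omega> B'] by (auto simp: set_integrable_def set_lebesgue_integral_def)
    have meas: "?g \<in> borel_measurable (?\<Lambda> \<Otimes>\<^sub>M \<rho>)"
      using borel_measurable_integrable[OF g(1)]
      by (simp add: \<Psi>\<omega> cong: measurable_cong_sets)
    have x': "x \<in> count_space I \<rightarrow>\<^sub>M ?\<Lambda> \<Otimes>\<^sub>M \<rho>"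
      using x by simp
    have ind: "?g (x i) = indicator {i\<in>I. t i \<in> B} i *\<^sub>R a i" if "i \<in> I" for i
    proof -
      have "snd (x i) \<in> space \<rho>"
        using funcset_mem[OF x that] by (auto simp: space_pair_measure)
      then show ?thesis
        using that by (simp add: indicator_def t_def a_def mem_Times_iff)
    qed
    have cs: "count_space {i\<in>I. t i \<in> B} = restrict_space (count_space I) {i\<in>I. t i \<in> B}"
      by (auto simp: restrict_count_space intro!: arg_cong[where f=count_space])
    have "integrable (count_space I) (\<lambda>i. ?g (x i))"
      using integrable_distr[OF x'] g(1) unfolding \<Psi>\<omega> .
    then have "integrable (count_space I) (\<lambda>i. indicator {i\<in>I. t i \<in> B} i *\<^sub>R a i)"
      by (rule Bochner_Integration.integrable_cong[THEN iffD1, rotated -1]) (use ind in auto)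
    then have "integrable (count_space {i\<in>I. t i \<in> B}) a"
      unfolding cs by (subst integrable_restrict_space) auto
    then have abs: "Infinite_Set_Sum.abs_summable_on a {i\<in>I. t i \<in> B}"
      by (simp add: Infinite_Set_Sum.abs_summable_on_def)
    have "W \<omega> B = (\<integral>i. ?g (x i) \<partial>count_space I)"
      using g(2) unfolding \<Psi>\<omega> by (subst (asm) integral_distr[OF x' meas])
    also have "\<dots> = (\<integral>i. indicator {i\<in>I. t i \<in> B} i *\<^sub>R a i \<partial>count_space I)"
      by (rule Bochner_Integration.integral_cong) (use ind in auto)
    also have "\<dots> = (\<integral>i. a i \<partial>count_space {i\<in>I. t i \<in> B})"
      unfolding cs by (subst integral_restrict_space) auto
    also have "\<dots> = infsum a {i\<in>I. t i \<in> B}"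
      using infsetsum_infsum[OF abs] by (simp add: infsetsum_def)
    finally show ?thesis
      using abs_summable_equivalent[THEN iffD2, OF abs] by simp
  qed
  show ?thesis
    unfolding purely_atomic_def
  proof (intro ballI)
    fix B :: "real set" assume B: "B \<in> bounded_borel {0..}"
    \<comment> \<open>The same formula for a single location identifies each group with the atom
      there.\<close>
    have sing: "W \<omega> {\<theta>} = infsum a {i\<in>I. t i = \<theta>}" if "\<theta> \<in> B" for \<theta>
    proof -
      have "{\<theta>} \<in> bounded_borel {0..}"
        using B that by (auto simp: bounded_borel_def)
      from *[OF this] show ?thesis
        by simp
    qed
    have "(\<lambda>\<theta>. norm (infsum a {i\<in>I. t i = \<theta>})) summable_on B"
      using *[OF B] by (intro abs_summable_group_by(1)) simp
    then have "(\<lambda>\<theta>. norm (W \<omega> {\<theta>})) summable_on B"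
      by (rule summable_on_cong[THEN iffD1, rotated]) (simp add: sing)
    then have abs: "Infinite_Set_Sum.abs_summable_on (\<lambda>\<theta>. W \<omega> {\<theta>}) B"
      by (rule abs_summable_equivalent[THEN iffD1])
    have "W \<omega> B = infsum (\<lambda>\<theta>. infsum a {i\<in>I. t i = \<theta>}) B"
      using *[OF B] by (subst abs_summable_group_by(2)) simp_all
    also have "\<dots> = infsum (\<lambda>\<theta>. W \<omega> {\<theta>}) B"
      by (rule infsum_cong) (simp add: sing)
    also have "\<dots> = (\<integral>\<theta>. W \<omega> {\<theta>} \<partial>count_space B)"
      using infsetsum_infsum[OF abs] by (simp add: infsetsum_def)
    finally show "integrable (count_space B) (\<lambda>\<theta>. W \<omega> {\<theta>}) \<and> W \<omega> B = (\<integral>\<theta>. W \<omega> {\<theta>} \<partial>count_space B)"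
      using abs by (simp add: Infinite_Set_Sum.abs_summable_on_def)
  qed
qed

text \<open>A single location has Lebesgue measure 0, so the strip above it has mean measure 0 even
  if \<open>\<rho>\<close> is infinite, and almost surely \<open>\<Psi>\<close> has no point in
  it.\<close>

lemma CRSM_singleton_eq_0:
  assumes \<rho>: "levy_measure \<rho>" and W: "CRSM M \<rho> (restrict_space lborel {0..}) W" and "0 \<le> x"
  shows "AE \<omega> in M. W \<omega> {x} = 0"
proof -
  let ?\<Lambda> = "restrict_space lborel {0::real..}"
  obtain \<Psi> where \<Psi>: "poisson_process M (?\<Lambda> \<Otimes>\<^sub>M \<rho>) \<Psi>"
    and eq: "\<And>\<omega> B. \<omega> \<in> space M \<Longrightarrow> B \<in> sets ?\<Lambda> \<Longrightarrow> bounded B \<Longrightarrow> W \<omega> B = (LINT p:B \<times> space \<rho>|\<Psi> \<omega>. snd p)"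
    using W by (auto simp: CRSM_def)
  interpret prob_space M
    using \<Psi> by (simp add: poisson_process_def)
  have x: "{x} \<in> bounded_borel {0..}"
    using \<open>0 \<le> x\<close> by (simp add: bounded_borel_def)
  let ?A = "{x} \<times> space \<rho>"
  have A: "?A \<in> sets (?\<Lambda> \<Otimes>\<^sub>M \<rho>)"
    using bounded_borel_in_sets_lborel_half_line[OF x] by auto
  have 0: "emeasure (?\<Lambda> \<Otimes>\<^sub>M \<rho>) ?A = 0"
    using emeasure_pair_levy[OF \<rho> x sets.top] by simp
  have \<Psi>_meas [measurable]: "\<Psi> \<in> M \<rightarrow>\<^sub>M point_measures (?\<Lambda> \<Otimes>\<^sub>M \<rho>)"
    using \<Psi> by (simp add: poisson_process_def)
  have "prob {\<omega>\<in>space M. emeasure (\<Psi> \<omega>) ?A = of_nat 0} = 1"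
  proof -
    have "measure (?\<Lambda> \<Otimes>\<^sub>M \<rho>) ?A = 0"
      using 0 by (simp add: measure_def)
    moreover have "prob {\<omega>\<in>space M. emeasure (\<Psi> \<omega>) ?A = of_nat 0} =
        exp (- measure (?\<Lambda> \<Otimes>\<^sub>M \<rho>) ?A) * measure (?\<Lambda> \<Otimes>\<^sub>M \<rho>) ?A ^ 0 / fact 0"
      using 0 by (intro poisson_process_prob[OF \<Psi> A]) simp
    ultimately show ?thesis
      by simp
  qed
  moreover have "{\<omega>\<in>space M. emeasure (\<Psi> \<omega>) ?A = of_nat 0} \<in> sets M"
    using A by measurable
  ultimately have "AE \<omega> in M. emeasure (\<Psi> \<omega>) ?A = 0"
    by (subst (asm) prob_eq_1) auto
  then show ?thesis
    using AE_space
  proof eventually_elim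
    case (elim \<omega>)
    have "\<Psi> \<omega> \<in> space (point_measures (?\<Lambda> \<Otimes>\<^sub>M \<rho>))"
      using elim(2) measurable_space[OF \<Psi>_meas] by auto
    then have "?A \<in> null_sets (\<Psi> \<omega>)"
      using elim(1) A by (auto simp: null_sets_def sets_point_measures_eq)
    then have "(LINT p:?A|\<Psi> \<omega>. snd p) = 0"
      unfolding set_lebesgue_integral_def
      by (intro integral_eq_zero_AE) (auto dest!: AE_not_in elim!: eventually_mono simp: indicator_def)
    then show ?case
      using eq[OF elim(2)] bounded_borel_in_sets_lborel_half_line[OF x] by simp
  qed
qed

text \<open>Approximating the jump size by simple functions makes W a limit of finite weighted sums
  of counts of \<open>\<Psi>\<close>. The counts at distinct levels are independent, and the law of
  each depends on the set only through its length.\<close>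

lemma CRSM_distr_eq:
  assumes \<rho>: "levy_measure \<rho>" and W: "CRSM M \<rho> (restrict_space lborel {0..}) W"
    and B: "B \<in> bounded_borel {0..}" "B' \<in> bounded_borel {0..}" "emeasure lborel B = emeasure lborel B'"
  shows "distr M borel (\<lambda>\<omega>. W \<omega> B) = distr M borel (\<lambda>\<omega>. W \<omega> B')"
proof -
  let ?\<Lambda> = "restrict_space lborel {0::real..}"
  obtain \<Psi> where \<Psi>: "poisson_process M (?\<Lambda> \<Otimes>\<^sub>M \<rho>) \<Psi>"
    and int: "\<And>\<omega> B. \<omega> \<in> space M \<Longrightarrow> B \<in> sets ?\<Lambda> \<Longrightarrow> bounded B \<Longrightarrow> set_integrable (\<Psi> \<omega>) (B \<times> space \<rho>) snd"
    and eq: "\<And>\<omega> B. \<omega> \<in> space M \<Longrightarrow> B \<in> sets ?\<Lambda> \<Longrightarrow> bounded B \<Longrightarrow> W \<omega> B = (LINT p:B \<times> space \<rho>|\<Psi> \<omega>. snd p)"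
    using W by (auto simp: CRSM_def)
  interpret prob_space M
    using \<Psi> by (simp add: poisson_process_def)
  have \<Psi>_meas [measurable]: "\<Psi> \<in> M \<rightarrow>\<^sub>M point_measures (?\<Lambda> \<Otimes>\<^sub>M \<rho>)"
    using \<Psi> by (simp add: poisson_process_def)
  have W_meas: "(\<lambda>\<omega>. W \<omega> C) \<in> borel_measurable M" if "C \<in> bounded_borel {0..}" for C
    using W that by (auto simp: CRSM_def completely_random_signed_measure_def
        random_signed_measure_def space_lborel_half_line)
  have sets_\<rho>: "sets \<rho> = sets (restrict_space borel (- {0::real}))"
    using \<rho> by (auto simp: levy_measure_def)
  have space_\<rho>: "space \<rho> = - {0}"
    using sets_eq_imp_space_eq[OF sets_\<rho>] by (simp add: space_restrict_space)
  have id: "(\<lambda>w. w) \<in> borel_measurable \<rho>"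
    using measurable_restrict_space1[OF measurable_ident, of borel "- {0::real}"]
    by (simp add: id_def measurable_cong_sets[OF sets_\<rho> refl])
  \<comment> \<open>The factor 2 comes with the approximating sequence; it makes twice the jump size
    an integrable bound.\<close>
  obtain s where s: "\<And>n. simple_function \<rho> (s n)"
    and s_lim: "\<And>w. w \<in> space \<rho> \<Longrightarrow> (\<lambda>n. s n w) \<longlonglongrightarrow> w"
    and s_le: "\<And>n w. w \<in> space \<rho> \<Longrightarrow> \<bar>s n w\<bar> \<le> 2 * \<bar>w\<bar>"
    using borel_measurable_implies_sequence_metric[OF id, of 0]
    unfolding dist_real_def diff_zero by blast
  define E where "E n v = s n -` {v} \<inter> space \<rho>" for n v
  have E: "E n v \<in> sets \<rho>" for n v
    unfolding E_def using simple_functionD(2)[OF s] by blast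
  have fin: "finite (s n ` space \<rho>)" for n
    using s by (rule simple_functionD)
  have BE: "C \<times> E n v \<in> sets (?\<Lambda> \<Otimes>\<^sub>M \<rho>)" if "C \<in> bounded_borel {0..}" for C n v
    using E bounded_borel_in_sets_lborel_half_line[OF that] by auto
  \<comment> \<open>On a bounded set only the level v = 0 can have an infinite count, and there the
    factor v removes the term.\<close>
  define X where "X n C \<omega> = (\<Sum>v\<in>s n ` space \<rho>. v * enn2real (emeasure (\<Psi> \<omega>) (C \<times> E n v)))" for n C \<omega>
  have X_meas: "X n C \<in> borel_measurable M" if "C \<in> bounded_borel {0..}" for n C
    unfolding X_def using BE[OF that] by measurable
  have X_lim: "(\<lambda>n. X n C \<omega>) \<longlonglongrightarrow> W \<omega> C" if C: "C \<in> bounded_borel {0..}" and \<omega>: "\<omega> \<in> space M" for C \<omega>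
  proof -
    have C': "C \<in> sets ?\<Lambda>" "bounded C"
      using bounded_borel_in_sets_lborel_half_line[OF C] by auto
    have sets_\<Psi>: "sets (\<Psi> \<omega>) = sets (?\<Lambda> \<Otimes>\<^sub>M \<rho>)"
      using measurable_space[OF \<Psi>_meas \<omega>] by (rule sets_point_measures_eq)
    let ?A = "C \<times> space \<rho>"
    have A: "?A \<in> sets (\<Psi> \<omega>)"
      using C' by (auto simp: sets_\<Psi>)
    have g: "integrable (\<Psi> \<omega>) (\<lambda>p. indicat_real ?A p *\<^sub>R snd p)" "W \<omega> C = (\<integral>p. indicat_real ?A p *\<^sub>R snd p \<partial>\<Psi> \<omega>)"
      using int[OF \<omega> C'] eq[OF \<omega> C'] by (auto simp: set_integrable_def set_lebesgue_integral_def)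
    have g2: "integrable (\<Psi> \<omega>) (\<lambda>p. 2 * norm (indicat_real ?A p *\<^sub>R snd p))"
      using g(1) by (intro integrable_mult_right integrable_norm)
    have dec: "indicat_real ?A p * s n (snd p) = (\<Sum>v\<in>s n ` space \<rho>. v * indicator (C \<times> E n v) p)" for n p
    proof (cases "p \<in> ?A")
      case True
      then have sv: "s n (snd p) \<in> s n ` space \<rho>"
        by auto
      have "(\<Sum>v\<in>s n ` space \<rho>. v * indicator (C \<times> E n v) p) = (\<Sum>v\<in>s n ` space \<rho>. if v = s n (snd p) then v else 0)"
        using True by (intro sum.cong) (auto simp: indicator_def E_def mem_Times_iff)
      also have "\<dots> = s n (snd p)"
        using fin sv by (subst sum.delta) auto
      finally show ?thesis
        using True by simp
    next
      case False
      then have "p \<notin> C \<times> E n v" for v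
        by (auto simp: E_def)
      then show ?thesis
        using False by simp
    qed
    have ind_meas: "(\<lambda>p. v * indicat_real (C \<times> E n v) p) \<in> borel_measurable (\<Psi> \<omega>)" for n v
      using BE[OF C] by (intro borel_measurable_times borel_measurable_indicator) (auto simp: sets_\<Psi>)
    have int_v: "integrable (\<Psi> \<omega>) (\<lambda>p. v * indicat_real (C \<times> E n v) p)" for n v
    proof (rule Bochner_Integration.integrable_bound[OF g2 ind_meas], rule AE_I2)
      fix p
      show "norm (v * indicat_real (C \<times> E n v) p) \<le> norm (2 * norm (indicat_real ?A p *\<^sub>R snd p))"
        using s_le[of "snd p" n] by (auto simp: indicator_def E_def)
    qed
    have X_eq: "X n C \<omega> = (\<integral>p. indicat_real ?A p * s n (snd p) \<partial>\<Psi> \<omega>)" for n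
    proof -
      have "C \<times> E n v \<subseteq> space (\<Psi> \<omega>)" for v
        using BE[OF C] sets.sets_into_space sets_\<Psi> by metis
      then show ?thesis
        unfolding dec X_def
        by (subst Bochner_Integration.integral_sum[OF int_v]) (simp add: measure_def Int_absorb2)
    qed
    have "(\<lambda>n. \<integral>p. indicat_real ?A p * s n (snd p) \<partial>\<Psi> \<omega>) \<longlonglongrightarrow> (\<integral>p. indicat_real ?A p *\<^sub>R snd p \<partial>\<Psi> \<omega>)"
    proof (rule integral_dominated_convergence[OF _ _ g2])
      show "(\<lambda>p. indicat_real ?A p *\<^sub>R snd p) \<in> borel_measurable (\<Psi> \<omega>)"
        using g(1) by (rule borel_measurable_integrable)
      show "(\<lambda>p. indicat_real ?A p * s n (snd p)) \<in> borel_measurable (\<Psi> \<omega>)" for n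
        unfolding dec by (intro borel_measurable_sum ind_meas)
      show "AE p in \<Psi> \<omega>. (\<lambda>n. indicat_real ?A p * s n (snd p)) \<longlonglongrightarrow> indicat_real ?A p *\<^sub>R snd p"
        using s_lim by (intro AE_I2) (auto simp: indicator_def)
      show "AE p in \<Psi> \<omega>. norm (indicat_real ?A p * s n (snd p)) \<le> 2 * norm (indicat_real ?A p *\<^sub>R snd p)" for n
        using s_le by (intro AE_I2) (auto simp: indicator_def)
    qed
    then show ?thesis
      by (simp add: X_eq g(2))
  qed
  have X_distr: "distr M borel (X n B) = distr M borel (X n B')" for n
  proof -
    \<comment> \<open>Independence in \<open>poisson_process\<close> concerns families indexed by
      initial segments of the naturals, so the finitely many levels are enumerated.\<close>
    obtain e where e: "bij_betw e {..<card (s n ` space \<rho>)} (s n ` space \<rho>)"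
      using ex_bij_betw_nat_finite[OF fin[of n]] by (auto simp: atLeast0LessThan)
    let ?K = "{..<card (s n ` space \<rho>)}"
    have K: "?K \<noteq> {}"
      using fin[of n] space_\<rho> by (auto simp: card_gt_0_iff lessThan_empty_iff)
    let ?Y = "\<lambda>C i \<omega>. emeasure (\<Psi> \<omega>) (C \<times> E n (e i))"
    let ?g = "\<lambda>y. \<Sum>i\<in>?K. e i * enn2real (y i)"
    have Y_meas: "?Y C i \<in> borel_measurable M" if "C \<in> bounded_borel {0..}" for C i
      using BE[OF that] by measurable
    have g_meas: "?g \<in> (\<Pi>\<^sub>M i\<in>?K. borel) \<rightarrow>\<^sub>M borel"
      by measurable
    have joint: "distr M (\<Pi>\<^sub>M i\<in>?K. borel) (\<lambda>\<omega>. \<lambda>i\<in>?K. ?Y C i \<omega>) = (\<Pi>\<^sub>M i\<in>?K. distr M borel (?Y C i))"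
      if C: "C \<in> bounded_borel {0..}" for C
    proof -
      have "disjoint_family_on (\<lambda>i. C \<times> E n (e i)) ?K"
        using bij_betw_imp_inj_on[OF e] by (auto simp: disjoint_family_on_def E_def inj_on_def)
      then have "indep_vars (\<lambda>_. borel) (?Y C) ?K"
        using BE[OF C] by (intro poisson_process_indep_vars[OF \<Psi>])
      then show ?thesis
        using K Y_meas[OF C] by (subst (asm) indep_vars_iff_distr_eq_PiM) auto
    qed
    have X_eq: "distr M borel (X n C) = distr (\<Pi>\<^sub>M i\<in>?K. distr M borel (?Y C i)) borel ?g"
      if C: "C \<in> bounded_borel {0..}" for C
    proof -
      have "X n C \<omega> = ?g (\<lambda>i\<in>?K. ?Y C i \<omega>)" for \<omega>
        unfolding X_def by (subst sum.reindex_bij_betw[OF e, symmetric]) (auto intro!: sum.cong)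
      then have "distr M borel (X n C) = distr M borel (?g \<circ> (\<lambda>\<omega>. \<lambda>i\<in>?K. ?Y C i \<omega>))"
        by (intro distr_cong) auto
      also have "\<dots> = distr (distr M (\<Pi>\<^sub>M i\<in>?K. borel) (\<lambda>\<omega>. \<lambda>i\<in>?K. ?Y C i \<omega>)) borel ?g"
        by (rule distr_distr[symmetric, OF g_meas]) (use Y_meas[OF C] in measurable)
      finally show ?thesis
        by (simp add: joint[OF C])
    qed
    have "distr M borel (?Y B i) = distr M borel (?Y B' i)" for i
      using B by (intro poisson_process_distr_eq[OF \<Psi>] BE) (auto simp: emeasure_pair_levy[OF \<rho> _ E])
    then show ?thesis
      by (simp add: X_eq B)
  qed
  show ?thesis
    by (rule distr_LIMSEQ_unique[where X="\<lambda>n. X n B" and Y="\<lambda>n. X n B'"])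
       (auto intro!: X_meas W_meas X_distr X_lim B)
qed

lemma emeasure_lborel_cell: "0 < \<delta> \<Longrightarrow> emeasure lborel (cell \<delta> k) = ennreal \<delta>"
  by (simp add: cell_def algebra_simps)

text \<open>Both vectors have independent coordinates with one common law, as all cells have length
  \<delta>; hence both have the same product measure as their law.\<close>

lemma CRSM_cells_distr_eq:
  assumes \<rho>: "levy_measure \<rho>" and W: "CRSM M \<rho> (restrict_space lborel {0..}) W"
    and \<delta>: "0 < \<delta>" and \<sigma>: "inj \<sigma>"
  shows "distr M (\<Pi>\<^sub>M k\<in>{..<q}. borel) (\<lambda>\<omega>. \<lambda>k\<in>{..<q}. W \<omega> (cell \<delta> (\<sigma> k))) =
         distr M (\<Pi>\<^sub>M k\<in>{..<q}. borel) (\<lambda>\<omega>. \<lambda>k\<in>{..<q}. W \<omega> (cell \<delta> k))"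
\<comment> \<open>The characterization of independence by product measures is applied with a
  nonempty index set.\<close>
proof (cases "q = 0")
  case True
  then show ?thesis
    by (intro distr_cong) (auto simp: restrict_def)
next
  case False
  then have q: "{..<q} \<noteq> {}"
    by auto
  interpret prob_space M
    using W by (auto simp: CRSM_def poisson_process_def)
  have W_meas: "(\<lambda>\<omega>. W \<omega> (cell \<delta> k)) \<in> borel_measurable M" for k
    using W \<delta> by (auto simp: CRSM_def completely_random_signed_measure_def
        random_signed_measure_def space_lborel_half_line cell_in_bounded_borel)
  have indep: "indep_vars (\<lambda>_. borel) (\<lambda>k \<omega>. W \<omega> (B k)) {..<n}"
    if "\<forall>k<n. B k \<in> bounded_borel {0..}" "disjoint_family_on B {..<n}" for n :: nat and B
    using W that by (simp add: CRSM_def completely_random_signed_measure_def space_lborel_half_line)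
  have joint: "distr M (\<Pi>\<^sub>M k\<in>{..<q}. borel) (\<lambda>\<omega>. \<lambda>k\<in>{..<q}. W \<omega> (cell \<delta> (\<tau> k))) =
      (\<Pi>\<^sub>M k\<in>{..<q}. distr M borel (\<lambda>\<omega>. W \<omega> (cell \<delta> (\<tau> k))))" if "inj \<tau>" for \<tau>
  proof -
    have "disjoint_family_on (\<lambda>k. cell \<delta> (\<tau> k)) {..<q}"
      using disjoint_family_cell[OF \<delta>] that by (auto simp: disjoint_family_on_def inj_def)
    then have "indep_vars (\<lambda>_. borel) (\<lambda>k \<omega>. W \<omega> (cell \<delta> (\<tau> k))) {..<q}"
      using indep[of q "\<lambda>k. cell \<delta> (\<tau> k)"] cell_in_bounded_borel[OF \<delta>] by simp
    then show ?thesis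
      using q W_meas by (subst (asm) indep_vars_iff_distr_eq_PiM) auto
  qed
  have "distr M borel (\<lambda>\<omega>. W \<omega> (cell \<delta> (\<sigma> k))) = distr M borel (\<lambda>\<omega>. W \<omega> (cell \<delta> k))" for k
    using \<delta> by (intro CRSM_distr_eq[OF \<rho> W]) (auto simp: cell_in_bounded_borel emeasure_lborel_cell)
  then have "(\<Pi>\<^sub>M k\<in>{..<q}. distr M borel (\<lambda>\<omega>. W \<omega> (cell \<delta> (\<sigma> k)))) =
      (\<Pi>\<^sub>M k\<in>{..<q}. distr M borel (\<lambda>\<omega>. W \<omega> (cell \<delta> k)))"
    by (simp only:)
  then show ?thesis
    unfolding joint[OF \<sigma>] joint[OF inj_on_id2] .
qed

text \<open>Expresses a Jordan mass through values of \<open>w\<close> on cells alone. Both the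
  measurability of the masses and the invariance of their joint law are drawn from this.\<close>

lemma jordan_pos_cell_LIMSEQ:
  assumes "purely_atomic w" "0 < \<delta>"
  shows "(\<lambda>m. \<Sum>r<2 ^ m. max 0 (w (cell (\<delta> / 2 ^ m) (k * 2 ^ m + r))))
    \<longlonglongrightarrow> measure (jordan_pos w) (cell \<delta> k)"
proof -
  let ?Q = "\<lambda>m. (\<lambda>r. k * 2 ^ m + r) ` {..<2 ^ m :: nat}"
  have eq: "cell \<delta> k = (\<Union>j\<in>?Q m. cell (\<delta> / 2 ^ m) j)" for m
    using cell_refine[OF assms(2), of "2 ^ m" k] by simp
  have "(\<lambda>m. \<Sum>j\<in>?Q m. max 0 (w (cell \<delta> k \<inter> cell (\<delta> / 2 ^ m) j))) \<longlonglongrightarrow> measure (jordan_pos w) (cell \<delta> k)"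
    by (rule cells_jordan_pos_LIMSEQ) (use assms cell_in_bounded_borel eq in auto)
  moreover have "(\<Sum>j\<in>?Q m. max 0 (w (cell \<delta> k \<inter> cell (\<delta> / 2 ^ m) j))) =
      (\<Sum>r<2 ^ m. max 0 (w (cell (\<delta> / 2 ^ m) (k * 2 ^ m + r))))" for m
  proof -
    have "cell \<delta> k \<inter> cell (\<delta> / 2 ^ m) (k * 2 ^ m + r) = cell (\<delta> / 2 ^ m) (k * 2 ^ m + r)" if "r < 2 ^ m" for r
      using eq[of m] that by auto
    then show ?thesis
      by (subst sum.reindex) (auto simp: inj_on_def intro!: sum.cong)
  qed
  ultimately show ?thesis
    by simp
qed

lemma sigma_finite_jordan_pos:
  assumes "purely_atomic w"
  shows "sigma_finite_measure (jordan_pos w)"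
proof
  have "(\<Union>k. cell 1 k) = {0..}"
    by (auto simp: mem_cell_iff)
  moreover have "emeasure (jordan_pos w) (cell 1 k) \<noteq> \<infinity>" for k
    using emeasure_jordan_pos_finite[OF assms cell_in_bounded_borel[of 1 k]] by simp
  ultimately show "\<exists>A. countable A \<and> A \<subseteq> sets (jordan_pos w) \<and> \<Union> A = space (jordan_pos w) \<and>
      (\<forall>a\<in>A. emeasure (jordan_pos w) a \<noteq> \<infinity>)"
    using cell_in_sets_half_line[of 1] by (intro exI[of _ "range (cell 1)"]) auto
qed

lemma emeasure_jordan_pos_rectangle:
  assumes w: "purely_atomic w" and "B \<in> bounded_borel {0..}" "C \<in> bounded_borel {0..}"
  shows "emeasure (jordan_pos w \<Otimes>\<^sub>M jordan_pos w) (B \<times> C) =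
    ennreal (measure (jordan_pos w) B * measure (jordan_pos w) C)"
proof -
  have "emeasure (jordan_pos w) B = ennreal (measure (jordan_pos w) B)"
    "emeasure (jordan_pos w) C = ennreal (measure (jordan_pos w) C)"
    using assms emeasure_jordan_pos_finite[OF w] by (auto intro!: emeasure_eq_ennreal_measure simp: less_top[symmetric])
  then show ?thesis
    using assms by (subst sigma_finite_measure.emeasure_pair_measure_Times[OF sigma_finite_jordan_pos[OF w]])
      (auto simp: bounded_borel_half_line ennreal_mult)
qed

text \<open>Every point of a light cell is itself light, so at any mesh the light cells lie in the
  set of points of mass below 1/(j+1). As j grows these sets decrease to the points of mass 0, which
  a purely atomic measure does not charge.\<close>

lemma small_cells_mass_LIMSEQ:
  assumes w: "purely_atomic w" and "0 < \<delta>"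
  shows "\<exists>b. b \<longlonglongrightarrow> 0 \<and> (\<forall>j n. (\<Sum>k<2 ^ n. if measure (jordan_pos w) (cell (\<delta> / 2 ^ n) k) < inverse (real (Suc j))
      then measure (jordan_pos w) (cell (\<delta> / 2 ^ n) k) else 0) \<le> b j)"
proof -
  \<comment> \<open>The Jordan measure before it is restricted to Borel sets. All subsets of the
    half-line are measurable for it, so the sets \<open>A j\<close> need no measurability
    argument.\<close>
  define \<nu> where "\<nu> = density (count_space {0..}) (\<lambda>\<theta>. ennreal (w {\<theta>}))"
  have \<nu>: "emeasure \<nu> B = (\<integral>\<^sup>+\<theta>. ennreal (w {\<theta>}) \<partial>count_space B)" if "B \<subseteq> {0..}" for B
  proof -
    have "emeasure \<nu> B = (\<integral>\<^sup>+\<theta>. ennreal (w {\<theta>}) * indicator B \<theta> \<partial>count_space {0..})"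
      using that by (auto simp: \<nu>_def emeasure_density)
    also have "\<dots> = (\<integral>\<^sup>+\<theta>. ennreal (w {\<theta>}) \<partial>count_space B)"
      using that by (subst nn_integral_restrict_space[symmetric])
        (auto simp: restrict_count_space Int_absorb1 Int_absorb2)
    finally show ?thesis .
  qed
  have V: "emeasure (jordan_pos w) B = emeasure \<nu> B" if "B \<in> bounded_borel {0..}" for B
    using that by (subst \<nu>) (auto simp: emeasure_jordan_pos bounded_borel_half_line bounded_borel_def)
  have sets_\<nu>: "sets \<nu> = Pow {0..}"
    by (simp add: \<nu>_def)
  let ?J = "cell \<delta> 0"
  have J: "?J \<subseteq> {0..}" "?J \<in> bounded_borel {0..}"
    using assms cell_subset_half_line cell_in_bounded_borel by auto
  have finJ: "emeasure \<nu> ?J < \<infinity>"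
    using emeasure_jordan_pos_finite[OF w J(2)] V[OF J(2)] by simp
  have fin: "emeasure \<nu> B \<noteq> \<infinity>" if "B \<subseteq> ?J" for B
    using emeasure_mono[OF that, of \<nu>] finJ J by (auto simp: sets_\<nu> top_unique)
  define A where "A j = {x \<in> ?J. measure \<nu> {x} < inverse (real (Suc j))}" for j
  have AJ: "A j \<subseteq> ?J" for j
    by (auto simp: A_def)
  have "(\<lambda>j. measure \<nu> (A j)) \<longlonglongrightarrow> measure \<nu> (\<Inter>j. A j)"
  proof (rule Lim_measure_decseq)
    show "range A \<subseteq> sets \<nu>"
      using AJ J by (auto simp: sets_\<nu>)
    show "decseq A"
      by (rule decseq_SucI) (force simp: A_def intro: less_le_trans le_imp_inverse_le)
    show "emeasure \<nu> (A j) \<noteq> \<infinity>" for j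
      by (rule fin[OF AJ])
  qed
  also have "measure \<nu> (\<Inter>j. A j) = 0"
  proof -
    have "w {x} \<le> 0" if x: "x \<in> (\<Inter>j. A j)" for x
    proof -
      have "measure \<nu> {x} \<le> 0"
      proof (rule ccontr)
        assume "\<not> ?thesis"
        then obtain j where "inverse (real (Suc j)) < measure \<nu> {x}"
          using reals_Archimedean[of "measure \<nu> {x}"] by auto
        then show False
          using x by (auto simp: A_def dest!: spec[of _ j])
      qed
      moreover have "{x} \<in> bounded_borel {0..}"
        using x J AJ by (auto simp: bounded_borel_def)
      then have "measure \<nu> {x} = max 0 (w {x})"
        using V[of "{x}"] measure_jordan_pos_singleton[of x w] by (auto simp: measure_def bounded_borel_def)
      ultimately show ?thesis
        by simp
    qed
    moreover have "(\<Inter>j. A j) \<subseteq> {0..}"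
      using AJ J by blast
    ultimately have "emeasure \<nu> (\<Inter>j. A j) = 0"
      by (subst \<nu>) (auto simp: nn_integral_0_iff_AE AE_count_space ennreal_neg)
    then show ?thesis
      by (simp add: measure_def)
  qed
  finally have lim: "(\<lambda>j. measure \<nu> (A j)) \<longlonglongrightarrow> 0" .
  have "(\<Sum>k<2 ^ n. if measure (jordan_pos w) (cell (\<delta> / 2 ^ n) k) < inverse (real (Suc j))
      then measure (jordan_pos w) (cell (\<delta> / 2 ^ n) k) else 0) \<le> measure \<nu> (A j)" for j n
  proof -
    let ?c = "cell (\<delta> / 2 ^ n)"
    have cb: "?c k \<in> bounded_borel {0..}" for k
      using assms cell_in_bounded_borel[of "\<delta> / 2 ^ n"] by simp
    have cJ: "?c k \<subseteq> ?J" if "k < 2 ^ n" for k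
      using cell_refine[OF assms(2), of "2 ^ n" 0] that by auto
    have Vc: "measure (jordan_pos w) (?c k) = measure \<nu> (?c k)" for k
      using V[OF cb] by (simp add: measure_def)
    let ?K = "{k\<in>{..<2 ^ n}. measure \<nu> (?c k) < inverse (real (Suc j))}"
    have "(\<Sum>k<2 ^ n. if measure \<nu> (?c k) < inverse (real (Suc j)) then measure \<nu> (?c k) else 0) =
        (\<Sum>k\<in>?K. measure \<nu> (?c k))"
      by (intro sum.inter_filter[symmetric]) simp
    also have "\<dots> = measure \<nu> (\<Union>k\<in>?K. ?c k)"
    proof (rule measure_finite_Union[symmetric])
      show "?c ` ?K \<subseteq> sets \<nu>"
        using cJ J by (auto simp: sets_\<nu>)
      show "disjoint_family_on ?c ?K"
        using disjoint_family_cell[of "\<delta> / 2 ^ n"] assms by (auto intro: disjoint_family_on_mono)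
      show "emeasure \<nu> (?c k) \<noteq> \<infinity>" if "k \<in> ?K" for k
        using that by (intro fin cJ) auto
    qed simp
    also have "\<dots> \<le> measure \<nu> (A j)"
    proof (rule measure_mono_fmeasurable)
      show "(\<Union>k\<in>?K. ?c k) \<subseteq> A j"
      proof
        fix x assume "x \<in> (\<Union>k\<in>?K. ?c k)"
        then obtain k where k: "k \<in> ?K" "x \<in> ?c k"
          by auto
        have "measure \<nu> {x} \<le> measure \<nu> (?c k)"
          using k cJ[of k] J fin[OF cJ, of k]
          by (intro measure_mono_fmeasurable) (auto simp: sets_\<nu> fmeasurable_def less_top)
        then show "x \<in> A j"
          using k cJ[of k] by (auto simp: A_def)
      qed
      show "(\<Union>k\<in>?K. ?c k) \<in> sets \<nu>"
        using cJ J by (auto simp: sets_\<nu>)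
      show "A j \<in> fmeasurable \<nu>"
        using fin[OF AJ, of j] AJ[of j] J by (auto simp: fmeasurable_def sets_\<nu> less_top)
    qed
    finally show ?thesis
      unfolding Vc .
  qed
  with lim show ?thesis
    by (intro exI[of _ "\<lambda>j. measure \<nu> (A j)"]) auto
qed

section \<open>Conditional Poisson processes\<close>

definition poisson_prob :: "nat \<Rightarrow> real \<Rightarrow> real" where
  "poisson_prob k a = exp (- a) * a ^ k / fact k"

lemma poisson_prob_nonneg: "0 \<le> a \<Longrightarrow> 0 \<le> poisson_prob k a"
  by (simp add: poisson_prob_def)

lemma poisson_prob_le_1:
  assumes "0 \<le> a"
  shows "poisson_prob k a \<le> 1"
proof (cases "a = 0")
  case True
  then show ?thesis
    by (cases k) (simp_all add: poisson_prob_def)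
next
  case False
  then show ?thesis
    using assms pmf_le_1[of "poisson_pmf a" k] by (simp add: poisson_prob_def mult.commute)
qed

text \<open>The conditional law enters the rest of the development only through this integrated
  form. With \<open>A\<close> the whole space it describes the counts as a mixture of products of
  Poisson laws; a smaller \<open>A\<close> restricts the masses.\<close>

lemma conditionally_poisson_emeasure:
  fixes R :: "nat \<Rightarrow> 'c set" and k :: "nat \<Rightarrow> nat"
  assumes D: "conditionally_poisson M S V T \<mu> D" and T: "\<And>\<omega>. \<omega> \<in> space M \<Longrightarrow> sets (\<mu> \<omega>) = sets T"
    and R: "\<And>t. R t \<in> sets T" "disjoint_family_on R {..<m}"
    and fin: "\<And>\<omega> t. \<omega> \<in> space M \<Longrightarrow> emeasure (\<mu> \<omega>) (R t) < \<infinity>"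
    and A: "A \<in> sets (vimage_algebra (space M) V (measure_algebra S))"
    and D_meas: "D \<in> M \<rightarrow>\<^sub>M point_measures T"
  shows "emeasure M (A \<inter> {\<omega>\<in>space M. \<forall>t<m. emeasure (D \<omega>) (R t) = of_nat (k t)}) =
    (\<integral>\<^sup>+\<omega>\<in>A. ennreal (\<Prod>t<m. poisson_prob (k t) (measure (\<mu> \<omega>) (R t))) \<partial>M)"
proof -
  let ?F = "vimage_algebra (space M) V (measure_algebra S)"
  obtain K where rcd: "regular_conditional_distribution M ?F (point_measures T) D K"
    and pp: "AE \<omega> in M. poisson_process (K \<omega>) (\<mu> \<omega>) (\<lambda>N'. N')"
    using D unfolding conditionally_poisson_def by (elim exE conjE)
  have K: "K \<in> ?F \<rightarrow>\<^sub>M prob_algebra (point_measures T)"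
    using rcd unfolding regular_conditional_distribution_def by (rule conjunct1)
  have dis: "emeasure M (A \<inter> (D -` B \<inter> space M)) = (\<integral>\<^sup>+\<omega>\<in>A. emeasure (K \<omega>) B \<partial>M)"
    if "B \<in> sets (point_measures T)" for B
    using rcd A that unfolding regular_conditional_distribution_def by (elim conjE) (rule bspec, erule bspec)
  define B where "B = {N \<in> space (point_measures T). \<forall>t<m. emeasure N (R t) = of_nat (k t)}"
  have B: "B \<in> sets (point_measures T)"
    unfolding B_def using R(1) by measurable
  have "D -` B \<inter> space M = {\<omega>\<in>space M. \<forall>t<m. emeasure (D \<omega>) (R t) = of_nat (k t)}"
    using measurable_space[OF D_meas] by (auto simp: B_def)
  then have "emeasure M (A \<inter> {\<omega>\<in>space M. \<forall>t<m. emeasure (D \<omega>) (R t) = of_nat (k t)}) =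
      (\<integral>\<^sup>+\<omega>\<in>A. emeasure (K \<omega>) B \<partial>M)"
    using dis[OF B] by simp
  also have "\<dots> = (\<integral>\<^sup>+\<omega>\<in>A. ennreal (\<Prod>t<m. poisson_prob (k t) (measure (\<mu> \<omega>) (R t))) \<partial>M)"
  proof (rule nn_integral_cong_AE)
    show "AE \<omega> in M. emeasure (K \<omega>) B * indicator A \<omega> =
        ennreal (\<Prod>t<m. poisson_prob (k t) (measure (\<mu> \<omega>) (R t))) * indicator A \<omega>"
      using pp AE_space
    proof eventually_elim
      case (elim \<omega>)
      have "K \<omega> \<in> space (prob_algebra (point_measures T))"
        using measurable_space[OF K] elim(2) by simp
      then have K\<omega>: "prob_space (K \<omega>)" "sets (K \<omega>) = sets (point_measures T)"
        by (auto simp: space_prob_algebra)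
      interpret K: prob_space "K \<omega>" by fact
      have space_K: "space (K \<omega>) = space (point_measures T)"
        using K\<omega>(2) by (rule sets_eq_imp_space_eq)
      have "K.prob B = (\<Prod>t<m. poisson_prob (k t) (measure (\<mu> \<omega>) (R t)))"
      \<comment> \<open>For \<open>m = 0\<close> the event \<open>B\<close> is the whole space;
        \<open>indep_varsD\<close> is applied with a nonempty index set.\<close>
      proof (cases "m = 0")
        case True
        then show ?thesis
          by (simp add: B_def space_K[symmetric] K.prob_space)
      next
        case False
        let ?X = "\<lambda>t N. emeasure N (R t)"
        have "K.indep_vars (\<lambda>_. borel) ?X {..<m}"
          using R T[OF elim(2)] by (intro poisson_process_indep_vars[OF elim(1)]) auto
        then have "K.prob (\<Inter>t\<in>{..<m}. ?X t -` {of_nat (k t)} \<inter> space (K \<omega>)) =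
            (\<Prod>t\<in>{..<m}. K.prob (?X t -` {of_nat (k t)} \<inter> space (K \<omega>)))"
          using False by (intro K.indep_varsD[where I="{..<m}"]) auto
        also have "(\<Inter>t\<in>{..<m}. ?X t -` {of_nat (k t)} \<inter> space (K \<omega>)) = B"
          using False by (auto simp: B_def space_K)
        also have "(\<Prod>t\<in>{..<m}. K.prob (?X t -` {of_nat (k t)} \<inter> space (K \<omega>))) =
            (\<Prod>t<m. poisson_prob (k t) (measure (\<mu> \<omega>) (R t)))"
        proof (rule prod.cong)
          fix t
          have "?X t -` {of_nat (k t)} \<inter> space (K \<omega>) = {N\<in>space (K \<omega>). emeasure N (R t) = of_nat (k t)}"
            by auto
          then show "K.prob (?X t -` {of_nat (k t)} \<inter> space (K \<omega>)) = poisson_prob (k t) (measure (\<mu> \<omega>) (R t))"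
            using poisson_process_prob[OF elim(1), of "R t" "k t"] R T[OF elim(2)] fin[OF elim(2)]
            by (simp add: poisson_prob_def)
        qed simp
        finally show ?thesis .
      qed
      then show ?case
        by (simp add: K.emeasure_eq_measure)
    qed
  qed
  finally show ?thesis .
qed

text \<open>The conditions are invariant under \<open>U \<mapsto> -U\<close>, so that one argument covers both
  \<open>W\<^sub>p\<close> and \<open>W\<^sub>m\<close>.\<close>

locale exchangeable_atomic = prob_space M for M :: "'a measure" +
  fixes U :: "'a \<Rightarrow> real set \<Rightarrow> real"
  assumes atomic: "\<And>\<omega>. \<omega> \<in> space M \<Longrightarrow> purely_atomic (U \<omega>)"
    and cell_measurable: "\<And>\<delta> k. 0 < \<delta> \<Longrightarrow> (\<lambda>\<omega>. U \<omega> (cell \<delta> k)) \<in> borel_measurable M"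
    and cells_distr_eq: "\<And>\<delta> \<sigma> q. 0 < \<delta> \<Longrightarrow> inj \<sigma> \<Longrightarrow>
      distr M (\<Pi>\<^sub>M k\<in>{..<q}. borel) (\<lambda>\<omega>. \<lambda>k\<in>{..<q}. U \<omega> (cell \<delta> (\<sigma> k))) =
      distr M (\<Pi>\<^sub>M k\<in>{..<q}. borel) (\<lambda>\<omega>. \<lambda>k\<in>{..<q}. U \<omega> (cell \<delta> k))"
begin

abbreviation V :: "'a \<Rightarrow> real measure" where
  "V \<omega> \<equiv> jordan_pos (U \<omega>)"

lemma V_cell_measurable [measurable]:
  assumes "0 < \<delta>"
  shows "(\<lambda>\<omega>. measure (V \<omega>) (cell \<delta> k)) \<in> borel_measurable M"
proof (rule borel_measurable_LIMSEQ_real)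
  show "(\<lambda>m. \<Sum>r<2 ^ m. max 0 (U \<omega> (cell (\<delta> / 2 ^ m) (k * 2 ^ m + r)))) \<longlonglongrightarrow> measure (V \<omega>) (cell \<delta> k)"
    if "\<omega> \<in> space M" for \<omega>
    using that assms by (intro jordan_pos_cell_LIMSEQ atomic)
  show "(\<lambda>\<omega>. \<Sum>r<2 ^ m. max 0 (U \<omega> (cell (\<delta> / 2 ^ m) (k * 2 ^ m + r)))) \<in> borel_measurable M" for m
    using assms by (intro borel_measurable_sum borel_measurable_max borel_measurable_const cell_measurable) simp
qed

lemma poisson_prob_measurable [measurable]: "poisson_prob k \<in> borel_measurable borel"
  unfolding poisson_prob_def by measurable

text \<open>At each refinement m, both sides are approximated by the same bounded function of the
  values of \<open>U\<close> on fine cells, read along \<open>block_map \<sigma>\<close> and along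
  the identity, and these two vectors have the same law. Dominated convergence then recovers the
  masses. The index t runs over the pairs of the first q cells.\<close>

lemma expectation_cells_eq:
  assumes "0 < \<delta>" and \<sigma>: "inj \<sigma>"
  shows "expectation (\<lambda>\<omega>. \<Prod>t<q * q. poisson_prob (a t)
      (measure (V \<omega>) (cell \<delta> (\<sigma> (t div q))) * measure (V \<omega>) (cell \<delta> (\<sigma> (t mod q))))) =
    expectation (\<lambda>\<omega>. \<Prod>t<q * q. poisson_prob (a t)
      (measure (V \<omega>) (cell \<delta> (t div q)) * measure (V \<omega>) (cell \<delta> (t mod q))))"
proof -
  define S where "S m \<tau> k \<omega> = (\<Sum>r<2 ^ m. max 0 (U \<omega> (cell (\<delta> / 2 ^ m) (\<tau> k * 2 ^ m + r))))"
    for m \<tau> and k :: nat and \<omega>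
  define \<phi> where "\<phi> y = (\<Prod>t<q * q. poisson_prob (a t) (y (t div q) * y (t mod q)))" for y :: "nat \<Rightarrow> real"
  have S_meas [measurable]: "S m \<tau> k \<in> borel_measurable M" for m \<tau> k
    unfolding S_def using assms
    by (intro borel_measurable_sum borel_measurable_max borel_measurable_const cell_measurable) simp
  have S_nonneg: "0 \<le> S m \<tau> k \<omega>" for m \<tau> k \<omega>
    unfolding S_def by (intro sum_nonneg) simp
  have lim: "(\<lambda>m. expectation (\<lambda>\<omega>. \<phi> (\<lambda>k. S m \<tau> k \<omega>))) \<longlonglongrightarrow>
      expectation (\<lambda>\<omega>. \<phi> (\<lambda>k. measure (V \<omega>) (cell \<delta> (\<tau> k))))" for \<tau>
  proof (rule integral_dominated_convergence[where w="\<lambda>_. 1"])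
    show "(\<lambda>\<omega>. \<phi> (\<lambda>k. measure (V \<omega>) (cell \<delta> (\<tau> k)))) \<in> borel_measurable M"
      unfolding \<phi>_def using assms by measurable
    show "(\<lambda>\<omega>. \<phi> (\<lambda>k. S m \<tau> k \<omega>)) \<in> borel_measurable M" for m
      unfolding \<phi>_def by measurable
    show "AE \<omega> in M. (\<lambda>m. \<phi> (\<lambda>k. S m \<tau> k \<omega>)) \<longlonglongrightarrow> \<phi> (\<lambda>k. measure (V \<omega>) (cell \<delta> (\<tau> k)))"
    proof (rule AE_I2)
      fix \<omega> assume "\<omega> \<in> space M"
      then have "(\<lambda>m. S m \<tau> k \<omega>) \<longlonglongrightarrow> measure (V \<omega>) (cell \<delta> (\<tau> k))" for k
        unfolding S_def using assms by (intro jordan_pos_cell_LIMSEQ atomic)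
      then show "(\<lambda>m. \<phi> (\<lambda>k. S m \<tau> k \<omega>)) \<longlonglongrightarrow> \<phi> (\<lambda>k. measure (V \<omega>) (cell \<delta> (\<tau> k)))"
        unfolding \<phi>_def poisson_prob_def by (intro tendsto_intros) auto
    qed
    show "AE \<omega> in M. norm (\<phi> (\<lambda>k. S m \<tau> k \<omega>)) \<le> 1" for m
      unfolding \<phi>_def
      by (intro AE_I2) (auto simp: S_nonneg poisson_prob_nonneg poisson_prob_le_1 abs_prod intro!: prod_le_1)
  qed simp
  have "expectation (\<lambda>\<omega>. \<phi> (\<lambda>k. S m \<sigma> k \<omega>)) = expectation (\<lambda>\<omega>. \<phi> (\<lambda>k. S m id k \<omega>))" for m
  proof -
    let ?\<sigma>' = "block_map \<sigma> (2 ^ m)"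
    have "inj ?\<sigma>'"
      using \<sigma> by (intro inj_block_map) auto
    let ?I = "{..<q * 2 ^ m}"
    let ?g = "\<lambda>y. \<Prod>t<q * q. poisson_prob (a t)
      ((\<Sum>r<2 ^ m. max 0 (y ((t div q) * 2 ^ m + r))) * (\<Sum>r<2 ^ m. max 0 (y ((t mod q) * 2 ^ m + r))))"
    have tq: "t div q < q" "t mod q < q" if "t < q * q" for t
      using that by (auto simp: less_mult_imp_div_less intro!: mod_less_divisor gr0I)
    have g_meas: "?g \<in> (\<Pi>\<^sub>M k\<in>?I. borel) \<rightarrow>\<^sub>M borel"
      by (intro borel_measurable_prod measurable_compose[OF _ poisson_prob_measurable]
          borel_measurable_times borel_measurable_sum borel_measurable_max borel_measurable_const
          measurable_component_singleton) (auto intro!: block_index_less tq)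
    have vec_meas: "(\<lambda>\<omega>. \<lambda>k\<in>?I. U \<omega> (cell (\<delta> / 2 ^ m) (\<tau> k))) \<in> M \<rightarrow>\<^sub>M (\<Pi>\<^sub>M k\<in>?I. borel)" for \<tau>
      using assms by (intro measurable_restrict cell_measurable) simp
    \<comment> \<open>Here \<tau> acts on fine cells and \<upsilon> on coarse ones; the premise says
      that \<tau> moves each coarse cell as a whole, in the way \<upsilon> prescribes.\<close>
    have eq: "expectation (\<lambda>\<omega>. \<phi> (\<lambda>k. S m \<upsilon> k \<omega>)) =
       (\<integral>y. ?g y \<partial>distr M (\<Pi>\<^sub>M k\<in>?I. borel) (\<lambda>\<omega>. \<lambda>k\<in>?I. U \<omega> (cell (\<delta> / 2 ^ m) (\<tau> k))))"
      if "\<And>k r. r < 2 ^ m \<Longrightarrow> \<tau> (k * 2 ^ m + r) = \<upsilon> k * 2 ^ m + r" for \<tau> \<upsilon>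
      unfolding integral_distr[OF vec_meas g_meas]
      unfolding \<phi>_def S_def
      by (intro Bochner_Integration.integral_cong prod.cong refl arg_cong2[where f="(*)"]
          arg_cong[where f="poisson_prob _"] sum.cong) (auto simp: block_index_less tq that)
    have "expectation (\<lambda>\<omega>. \<phi> (\<lambda>k. S m \<sigma> k \<omega>)) =
       (\<integral>y. ?g y \<partial>distr M (\<Pi>\<^sub>M k\<in>?I. borel) (\<lambda>\<omega>. \<lambda>k\<in>?I. U \<omega> (cell (\<delta> / 2 ^ m) (?\<sigma>' k))))"
      by (rule eq) (rule block_map_eq)
    also have "\<dots> = (\<integral>y. ?g y \<partial>distr M (\<Pi>\<^sub>M k\<in>?I. borel) (\<lambda>\<omega>. \<lambda>k\<in>?I. U \<omega> (cell (\<delta> / 2 ^ m) k)))"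
      using assms by (subst cells_distr_eq[OF _ \<open>inj ?\<sigma>'\<close>]) auto
    also have "\<dots> = expectation (\<lambda>\<omega>. \<phi> (\<lambda>k. S m id k \<omega>))"
      by (rule eq[symmetric]) simp
    finally show ?thesis .
  qed
  then have "expectation (\<lambda>\<omega>. \<phi> (\<lambda>k. measure (V \<omega>) (cell \<delta> (\<sigma> k)))) =
      expectation (\<lambda>\<omega>. \<phi> (\<lambda>k. measure (V \<omega>) (cell \<delta> (id k))))"
    using lim[of \<sigma>] lim[of id] LIMSEQ_unique by auto
  then show ?thesis
    by (simp add: \<phi>_def)
qed

end

section \<open>Counts on products of cells\<close>

definition point_count :: "'b measure \<Rightarrow> 'b set \<Rightarrow> nat" where
  "point_count N A = nat \<lfloor>enn2real (emeasure N A)\<rfloor>"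

lemma point_count_measurable [measurable]:
  assumes [measurable]: "A \<in> sets S"
  shows "(\<lambda>N. point_count N A) \<in> point_measures S \<rightarrow>\<^sub>M count_space UNIV"
  unfolding point_count_def by measurable

lemma emeasure_eq_point_count:
  assumes "N \<in> space (point_measures S)" "A \<in> sets S" "emeasure N A < \<infinity>"
  shows "emeasure N A = of_nat (point_count N A)"
  using emeasure_point_measures[OF assms(1,2)] assms(3) by (auto simp: point_count_def)

lemma rectangle_in_sets_quadrant:
  "B \<in> bounded_borel {0..} \<Longrightarrow> C \<in> bounded_borel {0..} \<Longrightarrow> B \<times> C \<in> sets quadrant"
  by (intro pair_measureI bounded_borel_half_line)

text \<open>Row-major numbering: \<open>t = k * q + l\<close> stands for the pair of the cells
  numbered k and l before \<open>\<sigma>\<close> is applied. A single index is used because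
  independence of counts is stated for families indexed by the naturals.\<close>

definition cell_pair :: "real \<Rightarrow> (nat \<Rightarrow> nat) \<Rightarrow> nat \<Rightarrow> nat \<Rightarrow> (real \<times> real) set" where
  "cell_pair \<delta> \<sigma> q t = cell \<delta> (\<sigma> (t div q)) \<times> cell \<delta> (\<sigma> (t mod q))"

lemma cell_pair_in_sets_quadrant: "0 < \<delta> \<Longrightarrow> cell_pair \<delta> \<sigma> q t \<in> sets quadrant"
  by (simp add: cell_pair_def rectangle_in_sets_quadrant cell_in_bounded_borel)

lemma bounded_rectangle: "B \<in> bounded_borel {0::real..} \<Longrightarrow> C \<in> bounded_borel {0::real..} \<Longrightarrow> bounded (B \<times> C)"
  by (auto simp: bounded_borel_def intro: bounded_Times)

text \<open>Natural numbers replace extended ones so that the vector ranges over a countable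
  discrete space. \<open>point_count\<close> sends an infinite mass to 0, but a locally finite
  process has finite mass on these bounded rectangles.\<close>

definition cell_counts :: "real \<Rightarrow> (nat \<Rightarrow> nat) \<Rightarrow> nat \<Rightarrow> (real \<times> real) measure \<Rightarrow> nat \<Rightarrow> nat" where
  "cell_counts \<delta> \<sigma> q N = (\<lambda>t\<in>{..<q * q}. point_count N (cell_pair \<delta> \<sigma> q t))"

lemma cell_counts_measurable:
  "0 < \<delta> \<Longrightarrow> cell_counts \<delta> \<sigma> q \<in> point_measures quadrant \<rightarrow>\<^sub>M (\<Pi>\<^sub>M t\<in>{..<q * q}. count_space UNIV)"
  unfolding cell_counts_def
  by (intro measurable_restrict point_count_measurable cell_pair_in_sets_quadrant)

text \<open>One sign of the model: it is used for \<open>W\<close> with \<open>D\<^sub>p\<close> and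
  for \<open>- W\<close> with \<open>D\<^sub>m\<close>.\<close>

locale poisson_network = exchangeable_atomic +
  fixes D :: "'a \<Rightarrow> (real \<times> real) measure"
  assumes locally_finite: "locally_finite_point_process M quadrant D"
    and conditional: "conditionally_poisson M half_line V quadrant (\<lambda>\<omega>. V \<omega> \<Otimes>\<^sub>M V \<omega>) D"
begin

lemma D_measurable [measurable]: "D \<in> M \<rightarrow>\<^sub>M point_measures quadrant"
  using locally_finite by (simp add: locally_finite_point_process_def)

lemma D_rectangle_finite:
  assumes "\<omega> \<in> space M" "B \<in> bounded_borel {0..}" "C \<in> bounded_borel {0..}"
  shows "emeasure (D \<omega>) (B \<times> C) < \<infinity>"
  using assms locally_finite
  by (auto simp: locally_finite_point_process_def rectangle_in_sets_quadrant bounded_rectangle)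

lemma D_rectangle_count:
  assumes "\<omega> \<in> space M" "B \<in> bounded_borel {0..}" "C \<in> bounded_borel {0..}"
  shows "emeasure (D \<omega>) (B \<times> C) = of_nat (point_count (D \<omega>) (B \<times> C))"
  using assms measurable_space[OF D_measurable]
  by (intro emeasure_eq_point_count[where S=quadrant] D_rectangle_finite rectangle_in_sets_quadrant)

text \<open>Given \<open>V\<close> the counts are independent Poisson variables whose means are
  products of cell masses. So the law of the vector depends on \<open>V\<close> only through the
  joint law of finitely many cell masses.\<close>

lemma emeasure_cell_counts:
  assumes \<delta>: "0 < \<delta>" and \<sigma>: "inj \<sigma>"
  shows "emeasure M {\<omega>\<in>space M. \<forall>t<q * q. point_count (D \<omega>) (cell_pair \<delta> \<sigma> q t) = a t} =
    ennreal (expectation (\<lambda>\<omega>. \<Prod>t<q * q. poisson_prob (a t)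
      (measure (V \<omega>) (cell \<delta> (\<sigma> (t div q))) * measure (V \<omega>) (cell \<delta> (\<sigma> (t mod q))))))"
proof -
  let ?F = "vimage_algebra (space M) V (measure_algebra half_line)"
  have cb: "cell \<delta> k \<in> bounded_borel {0..}" for k
    using \<delta> by (rule cell_in_bounded_borel)
  have count: "emeasure (D \<omega>) (cell_pair \<delta> \<sigma> q t) = of_nat (point_count (D \<omega>) (cell_pair \<delta> \<sigma> q t))"
    if "\<omega> \<in> space M" for \<omega> t
    unfolding cell_pair_def using that cb by (intro D_rectangle_count)
  have "{\<omega>\<in>space M. \<forall>t<q * q. point_count (D \<omega>) (cell_pair \<delta> \<sigma> q t) = a t} =
      space M \<inter> {\<omega>\<in>space M. \<forall>t<q * q. emeasure (D \<omega>) (cell_pair \<delta> \<sigma> q t) = of_nat (a t)}"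
    by (simp add: count Int_def cong: conj_cong)
  also have "emeasure M \<dots> = (\<integral>\<^sup>+\<omega>\<in>space M. ennreal (\<Prod>t<q * q. poisson_prob (a t)
      (measure (V \<omega> \<Otimes>\<^sub>M V \<omega>) (cell_pair \<delta> \<sigma> q t))) \<partial>M)"
  proof (rule conditionally_poisson_emeasure[OF conditional])
    show "sets (V \<omega> \<Otimes>\<^sub>M V \<omega>) = sets quadrant" for \<omega>
      by (intro sets_pair_measure_cong) simp_all
    show "cell_pair \<delta> \<sigma> q t \<in> sets quadrant" for t
      using \<delta> by (rule cell_pair_in_sets_quadrant)
    show "disjoint_family_on (cell_pair \<delta> \<sigma> q) {..<q * q}"
    proof (unfold disjoint_family_on_def, intro ballI impI)
      fix s t :: nat assume "s \<noteq> t"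
      then have "s div q \<noteq> t div q \<or> s mod q \<noteq> t mod q"
        by (metis div_mult_mod_eq)
      then show "cell_pair \<delta> \<sigma> q s \<inter> cell_pair \<delta> \<sigma> q t = {}"
        using \<delta> \<sigma> by (auto simp: cell_pair_def mem_cell_iff inj_def)
    qed
    show "emeasure (V \<omega> \<Otimes>\<^sub>M V \<omega>) (cell_pair \<delta> \<sigma> q t) < \<infinity>" if "\<omega> \<in> space M" for \<omega> t
      unfolding cell_pair_def using that cb by (subst emeasure_jordan_pos_rectangle) (auto intro: atomic)
    show "space M \<in> sets ?F"
      using sets.top[of ?F] by simp
  qed (rule D_measurable)
  also have "\<dots> = (\<integral>\<^sup>+\<omega>. ennreal (\<Prod>t<q * q. poisson_prob (a t)
      (measure (V \<omega>) (cell \<delta> (\<sigma> (t div q))) * measure (V \<omega>) (cell \<delta> (\<sigma> (t mod q))))) \<partial>M)"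
    using cb by (intro nn_integral_cong)
      (simp add: cell_pair_def measure_def[of "_ \<Otimes>\<^sub>M _"] emeasure_jordan_pos_rectangle atomic)
  also have "\<dots> = ennreal (expectation (\<lambda>\<omega>. \<Prod>t<q * q. poisson_prob (a t)
      (measure (V \<omega>) (cell \<delta> (\<sigma> (t div q))) * measure (V \<omega>) (cell \<delta> (\<sigma> (t mod q))))))"
  proof (rule nn_integral_eq_integral)
    show "integrable M (\<lambda>\<omega>. \<Prod>t<q * q. poisson_prob (a t)
      (measure (V \<omega>) (cell \<delta> (\<sigma> (t div q))) * measure (V \<omega>) (cell \<delta> (\<sigma> (t mod q)))))"
      using \<delta> by (intro integrable_const_bound[where B=1])
        (auto simp: poisson_prob_nonneg poisson_prob_le_1 abs_prod intro!: prod_le_1)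
  qed (auto simp: poisson_prob_nonneg intro!: prod_nonneg)
  finally show ?thesis .
qed

text \<open>On a countable discrete space a law is given by its point masses, and these are
  expectations to which \<open>expectation_cells_eq\<close> applies.\<close>

lemma cell_counts_distr_eq:
  assumes \<delta>: "0 < \<delta>" and \<sigma>: "inj \<sigma>"
  shows "distr M (\<Pi>\<^sub>M t\<in>{..<q * q}. count_space UNIV) (\<lambda>\<omega>. cell_counts \<delta> \<sigma> q (D \<omega>)) =
         distr M (\<Pi>\<^sub>M t\<in>{..<q * q}. count_space UNIV) (\<lambda>\<omega>. cell_counts \<delta> id q (D \<omega>))"
proof -
  let ?P = "\<Pi>\<^sub>M t\<in>{..<q * q}. count_space (UNIV :: nat set)"
  let ?E = "PiE {..<q * q} (\<lambda>_. UNIV :: nat set)"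
  have P: "?P = count_space ?E"
    by (rule count_space_PiM_finite) auto
  have meas: "(\<lambda>\<omega>. cell_counts \<delta> \<tau> q (D \<omega>)) \<in> M \<rightarrow>\<^sub>M ?P" for \<tau>
    using measurable_comp[OF D_measurable cell_counts_measurable[OF \<delta>]] by (simp add: comp_def)
  have em: "emeasure (distr M ?P (\<lambda>\<omega>. cell_counts \<delta> \<tau> q (D \<omega>))) {a} =
      ennreal (expectation (\<lambda>\<omega>. \<Prod>t<q * q. poisson_prob (a t)
      (measure (V \<omega>) (cell \<delta> (\<tau> (t div q))) * measure (V \<omega>) (cell \<delta> (\<tau> (t mod q))))))"
    if a: "a \<in> ?E" and "inj \<tau>" for a \<tau>
  proof -
    have "(\<lambda>\<omega>. cell_counts \<delta> \<tau> q (D \<omega>)) -` {a} \<inter> space M =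
        {\<omega>\<in>space M. \<forall>t<q * q. point_count (D \<omega>) (cell_pair \<delta> \<tau> q t) = a t}"
      using a by (auto simp: cell_counts_def fun_eq_iff PiE_iff extensional_def)
    moreover have "{a} \<in> sets ?P"
      using a unfolding P by simp
    ultimately show ?thesis
      using that by (simp add: emeasure_distr[OF meas] emeasure_cell_counts[OF \<delta>])
  qed
  show ?thesis
  proof (rule measure_eqI_countable)
    show "sets (distr M ?P (\<lambda>\<omega>. cell_counts \<delta> \<sigma> q (D \<omega>))) = Pow ?E"
      "sets (distr M ?P (\<lambda>\<omega>. cell_counts \<delta> id q (D \<omega>))) = Pow ?E"
      unfolding sets_distr P by simp_all
    show "countable ?E"
      by (rule countable_PiE) auto
    show "emeasure (distr M ?P (\<lambda>\<omega>. cell_counts \<delta> \<sigma> q (D \<omega>))) {a} =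
        emeasure (distr M ?P (\<lambda>\<omega>. cell_counts \<delta> id q (D \<omega>))) {a}" if "a \<in> ?E" for a
      unfolding em[OF that \<sigma>] em[OF that inj_on_id]
      by (subst expectation_cells_eq[OF \<delta> \<sigma>]) simp
  qed
qed

end

section \<open>Points lie over atoms\<close>

context poisson_network
begin

abbreviation F_V :: "'a measure" where
  "F_V \<equiv> vimage_algebra (space M) V (measure_algebra half_line)"

lemma V_in_measure_algebra: "V \<in> space M \<rightarrow> space (measure_algebra half_line)"
  by (simp add: space_measure_algebra)

text \<open>\<open>V_cell_measurable\<close> gives measurability on \<open>M\<close>; conditioning
  requires events in the \<sigma>-algebra generated by \<open>V\<close> itself.\<close>

lemma V_emeasure_measurable_F_V:
  assumes "B \<in> sets half_line"
  shows "(\<lambda>\<omega>. measure (V \<omega>) B) \<in> borel_measurable F_V"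
proof -
  have "(\<lambda>\<omega>. emeasure (V \<omega>) B) \<in> borel_measurable F_V"
    using measurable_comp[OF measurable_vimage_algebra1[OF V_in_measure_algebra]
        measurable_emeasure_measure_algebra[OF assms]]
    by (simp add: comp_def)
  then show ?thesis
    unfolding measure_def by (rule borel_measurable_enn2real)
qed

text \<open>A Poisson variable with mean v is nonzero with probability 1 - exp(-v), which is at most
  v. \<open>A\<close> lies in both \<sigma>-algebras because the conditional law is tested on events
  of \<open>F_V\<close>, while hits are measured in \<open>M\<close>.\<close>

lemma emeasure_hit_le:
  assumes \<delta>: "0 < \<delta>" "0 < \<delta>'" and A: "A \<in> sets F_V" "A \<in> sets M"
  shows "emeasure M (A \<inter> {\<omega>\<in>space M. emeasure (D \<omega>) (cell \<delta> k \<times> cell \<delta>' k') \<noteq> 0}) \<le>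
    (\<integral>\<^sup>+\<omega>\<in>A. ennreal (measure (V \<omega>) (cell \<delta> k) * measure (V \<omega>) (cell \<delta>' k')) \<partial>M)"
proof -
  let ?R = "cell \<delta> k \<times> cell \<delta>' k'"
  let ?v = "\<lambda>\<omega>. measure (V \<omega>) (cell \<delta> k) * measure (V \<omega>) (cell \<delta>' k')"
  have cb: "cell \<delta> k \<in> bounded_borel {0..}" "cell \<delta>' k' \<in> bounded_borel {0..}"
    using \<delta> by (auto intro: cell_in_bounded_borel)
  have R: "?R \<in> sets quadrant"
    using cb by (rule rectangle_in_sets_quadrant)
  have [measurable]: "(\<lambda>\<omega>. emeasure (D \<omega>) ?R) \<in> borel_measurable M"
    using measurable_comp[OF D_measurable measurable_emeasure_point_measures[OF R]] by (simp add: comp_def)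
  note [measurable] = A(2)
  have [measurable]: "?v \<in> borel_measurable M"
    using \<delta> by (intro borel_measurable_times V_cell_measurable)
  let ?H0 = "A \<inter> {\<omega>\<in>space M. emeasure (D \<omega>) ?R = 0}"
  let ?H1 = "A \<inter> {\<omega>\<in>space M. emeasure (D \<omega>) ?R \<noteq> 0}"
  have AM: "A \<subseteq> space M"
    using A(2) by (rule sets.sets_into_space)
  \<comment> \<open>The single rectangle is treated as a family with one member and prescribed count
    0.\<close>
  have "emeasure M ?H0 = emeasure M (A \<inter> {\<omega>\<in>space M. \<forall>t<Suc 0. emeasure (D \<omega>) ?R = of_nat 0})"
    by (intro arg_cong[where f="emeasure M"]) auto
  also have "\<dots> = (\<integral>\<^sup>+\<omega>\<in>A. ennreal (\<Prod>t<Suc 0. poisson_prob 0 (measure (V \<omega> \<Otimes>\<^sub>M V \<omega>) ?R)) \<partial>M)"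
  proof (rule conditionally_poisson_emeasure[OF conditional, where R="\<lambda>_. ?R" and k="\<lambda>_. 0"])
    show "sets (V \<omega> \<Otimes>\<^sub>M V \<omega>) = sets quadrant" for \<omega>
      by (intro sets_pair_measure_cong) simp_all
    show "disjoint_family_on (\<lambda>_. ?R) {..<Suc 0}"
      by (auto simp: disjoint_family_on_def)
    show "emeasure (V \<omega> \<Otimes>\<^sub>M V \<omega>) ?R < \<infinity>" if "\<omega> \<in> space M" for \<omega>
      using that cb by (subst emeasure_jordan_pos_rectangle) (auto intro: atomic)
  qed (fact R A D_measurable)+
  also have "\<dots> = (\<integral>\<^sup>+\<omega>. ennreal (exp (- ?v \<omega>)) * indicator A \<omega> \<partial>M)"
    using cb by (intro nn_integral_cong)
      (simp add: measure_def[of "_ \<Otimes>\<^sub>M _"] emeasure_jordan_pos_rectangle atomic poisson_prob_def)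
  finally have H0: "emeasure M ?H0 = (\<integral>\<^sup>+\<omega>. ennreal (exp (- ?v \<omega>)) * indicator A \<omega> \<partial>M)" .
  have "emeasure M ?H0 + emeasure M ?H1 = emeasure M (?H0 \<union> ?H1)"
    by (rule plus_emeasure) auto
  also have "?H0 \<union> ?H1 = A"
    using AM by auto
  also have "emeasure M A = (\<integral>\<^sup>+\<omega>. indicator A \<omega> \<partial>M)"
    using A(2) by simp
  \<comment> \<open>Splitting the constant 1 produces the probability of no hit as a finite summand
    on both sides, so it can be cancelled without subtracting extended reals.\<close>
  also have "\<dots> = (\<integral>\<^sup>+\<omega>. ennreal (exp (- ?v \<omega>)) * indicator A \<omega> + ennreal (1 - exp (- ?v \<omega>)) * indicator A \<omega> \<partial>M)"
    by (intro nn_integral_cong) (auto simp: indicator_def ennreal_plus[symmetric] simp del: ennreal_plus)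
  also have "\<dots> = emeasure M ?H0 + (\<integral>\<^sup>+\<omega>. ennreal (1 - exp (- ?v \<omega>)) * indicator A \<omega> \<partial>M)"
    unfolding H0 by (rule nn_integral_add) measurable
  finally have "emeasure M ?H1 = (\<integral>\<^sup>+\<omega>. ennreal (1 - exp (- ?v \<omega>)) * indicator A \<omega> \<partial>M)"
    by (simp add: ennreal_add_left_cancel)
  also have "\<dots> \<le> (\<integral>\<^sup>+\<omega>. ennreal (?v \<omega>) * indicator A \<omega> \<partial>M)"
  proof (intro nn_integral_mono mult_right_mono ennreal_leI)
    fix \<omega>
    show "1 - exp (- ?v \<omega>) \<le> ?v \<omega>"
      using exp_ge_add_one_self[of "- ?v \<omega>"] by linarith
  qed simp
  finally show ?thesis .
qed

lemma sum_refined_cells: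
  assumes "\<omega> \<in> space M" "0 < \<delta>"
  shows "(\<Sum>k<2 ^ n. measure (V \<omega>) (cell (\<delta> / 2 ^ n) k)) = measure (V \<omega>) (cell \<delta> 0)"
proof -
  have eq: "cell \<delta> 0 = (\<Union>k<2 ^ n. cell (\<delta> / 2 ^ n) k)"
    using cell_refine[OF assms(2), of "2 ^ n" 0] by simp
  show ?thesis
    unfolding eq
  proof (rule measure_finite_Union[symmetric])
    show "disjoint_family_on (cell (\<delta> / 2 ^ n)) {..<2 ^ n}"
      using disjoint_family_cell[of "\<delta> / 2 ^ n"] assms by (auto intro: disjoint_family_on_mono)
    show "emeasure (V \<omega>) (cell (\<delta> / 2 ^ n) k) \<noteq> \<infinity>" for k
      using emeasure_jordan_pos_finite[OF atomic[OF assms(1)] cell_in_bounded_borel[of "\<delta> / 2 ^ n" k]] assms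
      by simp
  qed (use assms cell_in_sets_half_line[of "\<delta> / 2 ^ n"] in auto)
qed

text \<open>Conditionally on \<open>V\<close>, the probability of a point of \<open>D\<close> over the cells of mass less
  than \<open>\<epsilon>\<close> is at most the mass of those cells times the mass of the other side. It tends to
  \<open>0\<close> with \<open>\<epsilon>\<close>, uniformly in the mesh, because \<open>V\<close> is purely atomic.\<close>

lemma AE_no_point_over_small_cells:
  assumes \<delta>: "0 < \<delta>"
  shows "AE \<omega> in M. \<not> (\<forall>j. eventually (\<lambda>n. \<exists>k<2 ^ n.
     measure (V \<omega>) (cell (\<delta> / 2 ^ n) k) < inverse (real (Suc j)) \<and>
     emeasure (D \<omega>) (if b then cell (\<delta> / 2 ^ n) k \<times> cell \<delta> 0 else cell \<delta> 0 \<times> cell (\<delta> / 2 ^ n) k) \<noteq> 0) sequentially)"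
proof -
  let ?J = "cell \<delta> 0"
  let ?c = "\<lambda>n k. cell (\<delta> / 2 ^ n) k"
  \<comment> \<open>The flag \<open>b\<close> selects the coordinate in which the light cell
    lies.\<close>
  let ?R = "\<lambda>n k. if b then ?c n k \<times> ?J else ?J \<times> ?c n k"
  let ?v = "\<lambda>n k \<omega>. measure (V \<omega>) (?c n k)"
  let ?e = "\<lambda>j. inverse (real (Suc j))"
  have \<delta>n: "0 < \<delta> / 2 ^ n" for n :: nat
    using \<delta> by simp
  have v_meas [measurable]: "?v n k \<in> borel_measurable M" for n k
    using \<delta>n by (rule V_cell_measurable)
  have J_meas [measurable]: "(\<lambda>\<omega>. measure (V \<omega>) ?J) \<in> borel_measurable M"
    using \<delta> by (rule V_cell_measurable)
  have R: "?R n k \<in> sets quadrant" for n k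
    using cell_in_bounded_borel[OF \<delta>] cell_in_bounded_borel[OF \<delta>n] by (simp add: rectangle_in_sets_quadrant)
  have D_meas [measurable]: "(\<lambda>\<omega>. emeasure (D \<omega>) (?R n k)) \<in> borel_measurable M" for n k
    using measurable_comp[OF D_measurable measurable_emeasure_point_measures[OF R]] by (simp add: comp_def)
  define E where "E j n = {\<omega>\<in>space M. \<exists>k<2 ^ n. ?v n k \<omega> < ?e j \<and> emeasure (D \<omega>) (?R n k) \<noteq> 0}" for j n
  \<comment> \<open>Truncation by the total mass: no moment of \<open>V\<close> is available, and on
    \<open>G r\<close> the integrands are dominated by the square of r.\<close>
  define G where "G r = {\<omega>\<in>space M. measure (V \<omega>) ?J \<le> real r}" for r :: nat
  define T where "T j n \<omega> = (\<Sum>k<2 ^ n. if ?v n k \<omega> < ?e j then ?v n k \<omega> else 0)" for j n \<omega>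
  \<comment> \<open>The supremum over n is taken before integrating, so one bound serves all meshes;
    \<open>small_cells_mass_LIMSEQ\<close> shows that it vanishes as j grows.\<close>
  define \<beta> where "\<beta> r j = (\<integral>\<^sup>+\<omega>. (ennreal (real r) * (SUP n. ennreal (T j n \<omega>))) * indicator (G r) \<omega> \<partial>M)" for r j
  have E_meas [measurable]: "E j n \<in> sets M" for j n
    unfolding E_def by measurable
  have G_meas [measurable]: "G r \<in> sets M" for r
    unfolding G_def by measurable
  have T_meas [measurable]: "T j n \<in> borel_measurable M" for j n
    unfolding T_def by measurable
  have T_nonneg: "0 \<le> T j n \<omega>" for j n \<omega>
    unfolding T_def by (intro sum_nonneg) auto
  have GE: "emeasure M (G r \<inter> E j n) \<le> \<beta> r j" for r j n
  proof -
    let ?A = "\<lambda>k. G r \<inter> {\<omega>\<in>space M. ?v n k \<omega> < ?e j}"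
    have A: "?A k \<in> sets M" for k
      by measurable
    have A': "?A k \<in> sets F_V" for k
    proof -
      have "?A k = {\<omega>\<in>space F_V. measure (V \<omega>) ?J \<le> real r \<and> ?v n k \<omega> < ?e j}"
        by (auto simp: G_def)
      also have "\<dots> \<in> sets F_V"
        using V_emeasure_measurable_F_V[OF cell_in_sets_half_line[OF \<delta>], of 0]
          V_emeasure_measurable_F_V[OF cell_in_sets_half_line[OF \<delta>n], of n k] by measurable
      finally show ?thesis .
    qed
    have hit: "emeasure M (?A k \<inter> {\<omega>\<in>space M. emeasure (D \<omega>) (?R n k) \<noteq> 0}) \<le>
        (\<integral>\<^sup>+\<omega>\<in>?A k. ennreal (?v n k \<omega> * measure (V \<omega>) ?J) \<partial>M)" for k
    proof (cases b)
      case True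
      then show ?thesis
        using emeasure_hit_le[OF \<delta>n \<delta> A'[of k] A[of k], of n k 0] by (simp only: if_True)
    next
      case False
      then show ?thesis
        using emeasure_hit_le[OF \<delta> \<delta>n A'[of k] A[of k], of 0 n k]
        by (simp only: if_False mult.commute[of "?v n k _"])
    qed
    have "emeasure M (G r \<inter> E j n) \<le> emeasure M (\<Union>k<2 ^ n. ?A k \<inter> {\<omega>\<in>space M. emeasure (D \<omega>) (?R n k) \<noteq> 0})"
      by (rule emeasure_mono) (auto simp: E_def)
    also have "\<dots> \<le> (\<Sum>k<2 ^ n. emeasure M (?A k \<inter> {\<omega>\<in>space M. emeasure (D \<omega>) (?R n k) \<noteq> 0}))"
      by (rule emeasure_subadditive_finite) auto
    also have "\<dots> \<le> (\<Sum>k<2 ^ n. \<integral>\<^sup>+\<omega>\<in>?A k. ennreal (?v n k \<omega> * measure (V \<omega>) ?J) \<partial>M)"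
      by (rule sum_mono) (rule hit)
    also have "\<dots> = (\<integral>\<^sup>+\<omega>. (\<Sum>k<2 ^ n. ennreal (?v n k \<omega> * measure (V \<omega>) ?J) * indicator (?A k) \<omega>) \<partial>M)"
      by (rule nn_integral_sum[symmetric]) measurable
    also have "\<dots> \<le> (\<integral>\<^sup>+\<omega>. (ennreal (real r) * ennreal (T j n \<omega>)) * indicator (G r) \<omega> \<partial>M)"
    proof (rule nn_integral_mono)
      fix \<omega> assume \<omega>: "\<omega> \<in> space M"
      show "(\<Sum>k<2 ^ n. ennreal (?v n k \<omega> * measure (V \<omega>) ?J) * indicator (?A k) \<omega>) \<le>
          (ennreal (real r) * ennreal (T j n \<omega>)) * indicator (G r) \<omega>"
      proof (cases "\<omega> \<in> G r")
        case True
        then have le: "measure (V \<omega>) ?J \<le> real r"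
          by (simp add: G_def)
        have "(\<Sum>k<2 ^ n. ennreal (?v n k \<omega> * measure (V \<omega>) ?J) * indicator (?A k) \<omega>) \<le>
            (\<Sum>k<2 ^ n. ennreal (real r * (if ?v n k \<omega> < ?e j then ?v n k \<omega> else 0)))"
          using True \<omega> le
          by (intro sum_mono) (auto simp: indicator_def mult.commute[of "real r"] intro!: ennreal_leI mult_left_mono)
        also have "\<dots> = ennreal (real r * T j n \<omega>)"
          unfolding T_def sum_distrib_left by (rule sum_ennreal) auto
        finally show ?thesis
          using True by (simp add: ennreal_mult T_nonneg)
      qed simp
    qed
    also have "\<dots> \<le> \<beta> r j"
      unfolding \<beta>_def by (intro nn_integral_mono mult_right_mono mult_left_mono SUP_upper) auto
    finally show ?thesis .
  qed
  have \<beta>: "\<beta> r \<longlonglongrightarrow> 0" for r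
  proof -
    have "(\<lambda>j. \<integral>\<^sup>+\<omega>. (ennreal (real r) * (SUP n. ennreal (T j n \<omega>))) * indicator (G r) \<omega> \<partial>M) \<longlonglongrightarrow>
        (\<integral>\<^sup>+\<omega>. 0 \<partial>M)"
    proof (rule nn_integral_dominated_convergence[where w="\<lambda>_. ennreal (real r * real r)"])
      show "AE \<omega> in M. (ennreal (real r) * (SUP n. ennreal (T j n \<omega>))) * indicator (G r) \<omega> \<le> ennreal (real r * real r)" for j
      proof (rule AE_I2)
        fix \<omega> assume \<omega>: "\<omega> \<in> space M"
        show "(ennreal (real r) * (SUP n. ennreal (T j n \<omega>))) * indicator (G r) \<omega> \<le> ennreal (real r * real r)"
        proof (cases "\<omega> \<in> G r")
          case True
          have "T j n \<omega> \<le> real r" for n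
          proof -
            have "T j n \<omega> \<le> (\<Sum>k<2 ^ n. ?v n k \<omega>)"
              unfolding T_def by (intro sum_mono) auto
            also have "\<dots> \<le> real r"
              using True sum_refined_cells[OF \<omega> \<delta>] by (simp add: G_def)
            finally show ?thesis .
          qed
          then have "(SUP n. ennreal (T j n \<omega>)) \<le> ennreal (real r)"
            by (intro SUP_least ennreal_leI)
          then show ?thesis
            using True by (simp add: ennreal_mult mult_left_mono)
        qed simp
      qed
      show "AE \<omega> in M. (\<lambda>j. (ennreal (real r) * (SUP n. ennreal (T j n \<omega>))) * indicator (G r) \<omega>) \<longlonglongrightarrow> 0"
      proof (rule AE_I2)
        fix \<omega> assume \<omega>: "\<omega> \<in> space M"
        obtain f where f: "f \<longlonglongrightarrow> 0" "\<And>j n. T j n \<omega> \<le> f j"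
          using small_cells_mass_LIMSEQ[OF atomic[OF \<omega>] \<delta>] unfolding T_def by blast
        have "(\<lambda>j. ennreal (real r * f j)) \<longlonglongrightarrow> ennreal (real r * 0)"
          by (intro tendsto_ennrealI tendsto_mult tendsto_const f)
        then have lim: "(\<lambda>j. ennreal (real r * f j)) \<longlonglongrightarrow> 0"
          by simp
        show "(\<lambda>j. (ennreal (real r) * (SUP n. ennreal (T j n \<omega>))) * indicator (G r) \<omega>) \<longlonglongrightarrow> 0"
        proof (rule tendsto_sandwich[OF _ _ tendsto_const lim])
          show "eventually (\<lambda>j. (ennreal (real r) * (SUP n. ennreal (T j n \<omega>))) * indicator (G r) \<omega> \<le> ennreal (real r * f j)) sequentially"
          proof (intro always_eventually allI)
            fix j
            have f0: "0 \<le> f j"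
              using T_nonneg f(2) order_trans by blast
            have "(SUP n. ennreal (T j n \<omega>)) \<le> ennreal (f j)"
              using f(2) by (intro SUP_least ennreal_leI)
            then show "(ennreal (real r) * (SUP n. ennreal (T j n \<omega>))) * indicator (G r) \<omega> \<le> ennreal (real r * f j)"
              using f0 by (auto simp: ennreal_mult indicator_def intro!: mult_left_mono)
          qed
        qed simp
      qed
    qed (auto simp: emeasure_space_1 ennreal_mult_less_top)
    then show ?thesis
      unfolding \<beta>_def by simp
  qed
  \<comment> \<open>The lower limit in n of the events \<open>E j n\<close>. It is an increasing
    union of sets each contained in a single \<open>E j m\<close>, so the bound in \<open>GE\<close>
    survives.\<close>
  define Bad where "Bad j = (\<Union>m. \<Inter>n\<in>{m..}. E j n)" for j
  have Bad_meas [measurable]: "Bad j \<in> sets M" for j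
    unfolding Bad_def by measurable
  have GBad: "emeasure M (G r \<inter> Bad j) \<le> \<beta> r j" for r j
  proof -
    have L: "G r \<inter> (\<Inter>n\<in>{m..}. E j n) \<in> sets M" for m
      by measurable
    have "G r \<inter> Bad j = (\<Union>m. G r \<inter> (\<Inter>n\<in>{m..}. E j n))"
      by (auto simp: Bad_def)
    also have "emeasure M \<dots> = (SUP m. emeasure M (G r \<inter> (\<Inter>n\<in>{m..}. E j n)))"
      using L by (intro SUP_emeasure_incseq[symmetric]) (auto simp: incseq_def)
    also have "\<dots> \<le> \<beta> r j"
    proof (rule SUP_least)
      fix m
      have "emeasure M (G r \<inter> (\<Inter>n\<in>{m..}. E j n)) \<le> emeasure M (G r \<inter> E j m)"
        by (rule emeasure_mono) auto
      also note GE
      finally show "emeasure M (G r \<inter> (\<Inter>n\<in>{m..}. E j n)) \<le> \<beta> r j" .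
    qed
    finally show ?thesis .
  qed
  have "emeasure M (G r \<inter> (\<Inter>j. Bad j)) = 0" for r
  proof -
    \<comment> \<open>The intersection lies in every \<open>Bad j\<close>, so j may tend to infinity
      in the bound while r stays fixed.\<close>
    have "emeasure M (G r \<inter> (\<Inter>j. Bad j)) \<le> \<beta> r j" for j
      using GBad[of r j] by (rule order_trans[rotated]) (intro emeasure_mono; auto)
    then have "emeasure M (G r \<inter> (\<Inter>j. Bad j)) \<le> 0"
      by (intro LIMSEQ_le_const[OF \<beta>[of r]]) auto
    then show ?thesis
      by simp
  qed
  then have "AE \<omega> in M. \<omega> \<notin> G r \<inter> (\<Inter>j. Bad j)" for r
    by (intro AE_not_in) (auto simp: null_sets_def)
  then have "AE \<omega> in M. \<forall>r. \<omega> \<notin> G r \<inter> (\<Inter>j. Bad j)"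
    unfolding AE_all_countable by (rule allI)
  then show ?thesis
    using AE_space
  proof eventually_elim
    case (elim \<omega>)
    obtain r where "measure (V \<omega>) ?J \<le> real r"
      using real_arch_simple by blast
    with elim have "\<omega> \<notin> (\<Inter>j. Bad j)"
      by (auto simp: G_def)
    then obtain j where j: "\<omega> \<notin> Bad j"
      by auto
    show ?case
    proof
      assume *: "\<forall>j. eventually (\<lambda>n. \<exists>k<2 ^ n. ?v n k \<omega> < ?e j \<and> emeasure (D \<omega>) (?R n k) \<noteq> 0) sequentially"
      have "eventually (\<lambda>n. \<omega> \<in> E j n) sequentially"
        using *[rule_format, of j] by (rule eventually_mono) (use elim in \<open>simp add: E_def\<close>)
      with j show False
        by (auto simp: Bad_def eventually_sequentially)
    qed
  qed
qed

text \<open>If a coordinate of a point of \<open>D\<close> is not a positive atom, the cells around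
  it become lighter than every threshold while \<open>D\<close> keeps hitting their strips, which
  \<open>AE_no_point_over_small_cells\<close> excludes. The exceptional sets are indexed by box size
  and coordinate only, hence countably many, and all x and y are covered at once.\<close>

lemma AE_points_in_atoms:
  "AE \<omega> in M. \<forall>x\<ge>0. \<forall>y\<ge>0. emeasure (D \<omega>) {(x, y)} \<noteq> 0 \<longrightarrow> 0 < U \<omega> {x} \<and> 0 < U \<omega> {y}"
proof -
  have "AE \<omega> in M. \<forall>N. \<forall>b. \<not> (\<forall>j. eventually (\<lambda>n. \<exists>k<2 ^ n.
     measure (V \<omega>) (cell (real (Suc N) / 2 ^ n) k) < inverse (real (Suc j)) \<and>
     emeasure (D \<omega>) (if b then cell (real (Suc N) / 2 ^ n) k \<times> cell (real (Suc N)) 0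
       else cell (real (Suc N)) 0 \<times> cell (real (Suc N) / 2 ^ n) k) \<noteq> 0) sequentially)"
    unfolding AE_all_countable by (intro allI AE_no_point_over_small_cells) simp
  then show ?thesis
    using AE_space
  proof eventually_elim
    case (elim \<omega>)
    have key: "0 < U \<omega> {z}"
      if xy: "0 \<le> x" "0 \<le> y" "emeasure (D \<omega>) {(x, y)} \<noteq> 0" and z: "z = (if b then x else y)" for x y z b
    proof (rule ccontr)
      assume "\<not> 0 < U \<omega> {z}"
      have z0: "0 \<le> z"
        using xy z by simp
      obtain N where N: "max x y < real N"
        using reals_Archimedean2 by blast
      let ?N = "real (Suc N)"
      have N0: "0 < ?N"
        by simp
      have J: "x \<in> cell ?N 0" "y \<in> cell ?N 0" "z \<in> cell ?N 0"
        using xy z N by (auto simp: cell_def)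
      let ?k = "\<lambda>n. cell_index (?N / 2 ^ n) z"
      have k: "?k n < 2 ^ n" for n
        using J(3) cell_refine[OF N0, of "2 ^ n" 0] by (auto simp: mem_cell_iff)
      have "(\<lambda>n. measure (V \<omega>) (dyadic_cell ?N n z)) \<longlonglongrightarrow> measure (V \<omega>) {z}"
        using emeasure_jordan_pos_finite[OF atomic[OF elim(2)]]
        by (intro measure_dyadic_cell_LIMSEQ N0 z0) auto
      also have "measure (V \<omega>) {z} = 0"
        using \<open>\<not> 0 < U \<omega> {z}\<close> z0 by (simp add: measure_jordan_pos_singleton)
      finally have lim: "(\<lambda>n. measure (V \<omega>) (cell (?N / 2 ^ n) (?k n))) \<longlonglongrightarrow> 0"
        by (simp add: dyadic_cell_def)
      have hit: "emeasure (D \<omega>) (if b then cell (?N / 2 ^ n) (?k n) \<times> cell ?N 0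
          else cell ?N 0 \<times> cell (?N / 2 ^ n) (?k n)) \<noteq> 0" (is "emeasure _ ?R \<noteq> 0") for n
      proof -
        have "cell ?N 0 \<in> bounded_borel {0..}" "cell (?N / 2 ^ n) (?k n) \<in> bounded_borel {0..}"
          by (intro cell_in_bounded_borel; simp)+
        then have "?R \<in> sets (D \<omega>)"
          using measurable_space[OF D_measurable elim(2)]
          by (simp add: sets_point_measures_eq rectangle_in_sets_quadrant)
        moreover have "(x, y) \<in> ?R"
          using J z z0 N0 mem_dyadic_cell[OF N0 z0, of n] by (auto simp: dyadic_cell_def)
        ultimately have "emeasure (D \<omega>) {(x, y)} \<le> emeasure (D \<omega>) ?R"
          by (intro emeasure_mono) auto
        with xy(3) show ?thesis
          by auto
      qed
      have "eventually (\<lambda>n. \<exists>k<2 ^ n.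
         measure (V \<omega>) (cell (?N / 2 ^ n) k) < inverse (real (Suc j)) \<and>
         emeasure (D \<omega>) (if b then cell (?N / 2 ^ n) k \<times> cell ?N 0 else cell ?N 0 \<times> cell (?N / 2 ^ n) k) \<noteq> 0) sequentially" for j
      proof -
        have "eventually (\<lambda>n. measure (V \<omega>) (cell (?N / 2 ^ n) (?k n)) < inverse (real (Suc j))) sequentially"
          by (rule order_tendstoD(2)[OF lim]) simp
        then show ?thesis
        proof eventually_elim
          case (elim n)
          with k[of n] hit[of n] show ?case
            by (intro exI[of _ "?k n"] conjI)
        qed
      qed
      with elim(1) show False
        by blast
    qed
    show ?case
    proof (intro allI impI conjI)
      fix x y :: real assume "0 \<le> x" "0 \<le> y" "emeasure (D \<omega>) {(x, y)} \<noteq> 0"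
      then show "0 < U \<omega> {x}" "0 < U \<omega> {y}"
        using key[of x y x True] key[of x y y False] by simp_all
    qed
  qed
qed

end

section \<open>The signed graph as a limit over cells\<close>

text \<open>On the integers this is the sign function. It is not additive, so in general it may be
  evaluated on cells instead of points only when the cells separate the points.\<close>

definition edge :: "real \<Rightarrow> real" where
  "edge t = sgn t * min \<bar>t\<bar> 1"

lemma edge_0 [simp]: "edge 0 = 0"
  by (simp add: edge_def)

lemma edge_measurable [measurable]: "edge \<in> borel_measurable borel"
  unfolding edge_def by measurable

text \<open>\<open>S\<close> may contain points of mass 0. This leaves room to close it under
  reflection, so that (x, y) and (y, x) are always seen together.\<close>

definition supported_on :: "((real \<times> real) set \<Rightarrow> real) \<Rightarrow> (real \<times> real) set \<Rightarrow> (real \<times> real) set \<Rightarrow> bool" where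
  "supported_on d R S \<longleftrightarrow> finite S \<and> S \<subseteq> R \<and> S\<inverse> = S \<and>
     (\<forall>C\<in>sets borel. C \<subseteq> R \<longrightarrow> d C = (\<Sum>p\<in>S \<inter> C. d {p}))"

lemma supported_onD:
  assumes "supported_on d R S" "C \<in> sets borel" "C \<subseteq> R"
  shows "d C = (\<Sum>p\<in>S \<inter> C. d {p})"
  using assms by (simp add: supported_on_def)

text \<open>The inclusion of the quadrant into the plane is measurable, so preimages of Borel sets
  of the plane belong to the product of the traces.\<close>

lemma borel_in_sets_quadrant:
  assumes "C \<in> sets borel" "C \<subseteq> {0..} \<times> {0..}"
  shows "C \<in> sets quadrant"
proof -
  have "(\<lambda>p. (fst p, snd p)) \<in> quadrant \<rightarrow>\<^sub>M borel \<Otimes>\<^sub>M borel"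
    by (intro measurable_Pair measurable_compose[OF measurable_fst] measurable_compose[OF measurable_snd]
        measurable_restrict_space1) auto
  then have "(\<lambda>p. (fst p, snd p)) -` C \<inter> space quadrant \<in> sets quadrant"
    using assms(1) by (intro measurable_sets[where A=borel]) (simp_all add: borel_prod)
  also have "(\<lambda>p. (fst p, snd p)) -` C \<inter> space quadrant = C"
    using assms(2) by (auto simp: space_pair_measure space_restrict_space)
  finally show ?thesis .
qed

lemma converse_borel:
  assumes "C \<in> sets (borel :: (real \<times> real) measure)"
  shows "C\<inverse> \<in> sets borel"
proof -
  have "(\<lambda>p::real \<times> real. (snd p, fst p)) \<in> borel \<rightarrow>\<^sub>M borel"
    by (intro borel_measurable_continuous_onI continuous_intros)
  from measurable_sets[OF this assms] show ?thesis
    by (simp add: vimage_def converse_def) (simp add: case_prod_unfold Collect_case_prod_Sigma cong: conj_cong)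
qed

text \<open>A point measure is a sum of Dirac measures over indices. Finite mass of \<open>R\<close>
  means that finitely many indices fall into it, and their positions form the support.\<close>

lemma point_measure_finite_support:
  assumes N: "N \<in> space (point_measures quadrant)" and R: "R \<in> sets quadrant" "emeasure N R < \<infinity>"
  shows "\<exists>S. finite S \<and> S \<subseteq> R \<and> (\<forall>C\<in>sets quadrant. C \<subseteq> R \<longrightarrow> measure N C = (\<Sum>p\<in>S \<inter> C. measure N {p}))"
proof -
  obtain I :: "nat set" and x where x: "x \<in> I \<rightarrow> space quadrant" "N = distr (count_space I) quadrant x"
    using N by (rule point_measures_cases)
  have em: "emeasure N C = emeasure (count_space I) (x -` C \<inter> I)" if "C \<in> sets quadrant" for C
    using that x by (simp add: emeasure_distr)
  have sets_N: "sets N = sets quadrant"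
    by (simp add: x)
  have "emeasure (count_space I) (x -` R \<inter> I) < \<infinity>"
    using R em by simp
  then have fin: "finite (x -` R \<inter> I)"
    by (auto simp: emeasure_count_space split: if_splits)
  define S where "S = x ` (x -` R \<inter> I)"
  have S: "finite S" "S \<subseteq> R"
    using fin by (auto simp: S_def)
  have sing: "{p} \<in> sets quadrant" if "p \<in> R" for p
  proof -
    have "p \<in> {0..} \<times> {0..}"
      using sets.sets_into_space[OF R(1)] that by (auto simp: space_pair_measure space_restrict_space)
    then show ?thesis
      by (intro borel_in_sets_quadrant) auto
  qed
  have "measure N C = (\<Sum>p\<in>S \<inter> C. measure N {p})" if C: "C \<in> sets quadrant" "C \<subseteq> R" for C
  proof -
    have SC: "S \<inter> C \<in> sets quadrant"
    proof (rule sets.countable)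
      show "{p} \<in> sets quadrant" if "p \<in> S \<inter> C" for p
        using that S(2) by (intro sing) blast
      show "countable (S \<inter> C)"
        by (intro countable_finite finite_Int disjI1 S(1))
    qed
    have "emeasure N C = emeasure N (S \<inter> C)"
      unfolding em[OF C(1)] em[OF SC] using C(2)
      by (intro arg_cong[where f="emeasure _"]) (auto simp: S_def)
    then have "measure N C = measure N (S \<inter> C)"
      by (simp add: measure_def)
    also have "\<dots> = (\<Sum>p\<in>S \<inter> C. measure N {p})"
    proof (rule measure_eq_sum_singleton)
      show "finite (S \<inter> C)"
        using S by simp
      show "{p} \<in> sets N" if "p \<in> S \<inter> C" for p
        unfolding sets_N using that S(2) by (intro sing) blast
      show "emeasure N {p} \<noteq> \<infinity>" if "p \<in> S \<inter> C" for p
        using emeasure_mono[of "{p}" R N] that S R by (auto simp: sets_N top_unique)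
    qed
    finally show ?thesis .
  qed
  with S show ?thesis
    by blast
qed

definition square :: "real \<Rightarrow> (real \<times> real) set" where
  "square h = cell h 0 \<times> cell h 0"

lemma converse_square [simp]: "(square h)\<inverse> = square h"
  by (auto simp: square_def)

lemma square_eq: "square h = {0..<h} \<times> {0..<h}"
  by (simp add: square_def cell_def)

lemma borel_subset_square_in_sets_quadrant: "C \<in> sets borel \<Longrightarrow> C \<subseteq> square h \<Longrightarrow> C \<in> sets quadrant"
  by (rule borel_in_sets_quadrant) (auto simp: square_eq)

lemma signed_difference_supported_on:
  assumes N: "N \<in> space (point_measures quadrant)" "N' \<in> space (point_measures quadrant)"
    and fin: "emeasure N (square h) < \<infinity>" "emeasure N' (square h) < \<infinity>" and h: "0 < h"
  shows "\<exists>S. supported_on (signed_difference N N') (square h) S"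
proof -
  have R: "square h \<in> sets quadrant"
    unfolding square_def using h by (intro rectangle_in_sets_quadrant cell_in_bounded_borel)
  obtain S where S: "finite S" "S \<subseteq> square h"
    "\<And>C. C \<in> sets quadrant \<Longrightarrow> C \<subseteq> square h \<Longrightarrow> measure N C = (\<Sum>p\<in>S \<inter> C. measure N {p})"
    using point_measure_finite_support[OF N(1) R fin(1)] by blast
  obtain S' where S': "finite S'" "S' \<subseteq> square h"
    "\<And>C. C \<in> sets quadrant \<Longrightarrow> C \<subseteq> square h \<Longrightarrow> measure N' C = (\<Sum>p\<in>S' \<inter> C. measure N' {p})"
    using point_measure_finite_support[OF N(2) R fin(2)] by blast
  \<comment> \<open>One set for both measures, closed under reflection as
    \<open>supported_on\<close> demands.\<close>
  define T where "T = S \<union> S' \<union> (S \<union> S')\<inverse>"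
  have T: "finite T" "T \<subseteq> square h" "T\<inverse> = T"
    using S(1,2) S'(1,2) by (auto simp: T_def square_eq)
  have ext: "measure K C = (\<Sum>p\<in>T \<inter> C. measure K {p})"
    if K: "\<And>C. C \<in> sets quadrant \<Longrightarrow> C \<subseteq> square h \<Longrightarrow> measure K C = (\<Sum>p\<in>S0 \<inter> C. measure K {p})"
      "S0 \<subseteq> T" and C: "C \<in> sets quadrant" "C \<subseteq> square h" for K :: "(real \<times> real) measure" and S0 C
  proof -
    \<comment> \<open>The added points are harmless: \<open>{p}\<close> misses \<open>S0\<close> and
      so has mass 0.\<close>
    have "measure K {p} = 0" if "p \<in> T \<inter> C - S0 \<inter> C" for p
    proof -
      have "{p} \<subseteq> square h"
        using that C by auto
      then have "measure K {p} = (\<Sum>q\<in>S0 \<inter> {p}. measure K {q})"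
        by (intro K borel_subset_square_in_sets_quadrant) auto
      also have "S0 \<inter> {p} = {}"
        using that by auto
      finally show ?thesis
        by simp
    qed
    then have "(\<Sum>p\<in>S0 \<inter> C. measure K {p}) = (\<Sum>p\<in>T \<inter> C. measure K {p})"
      using T K(2) by (intro sum.mono_neutral_left) auto
    then show ?thesis
      using K(1)[OF C] by simp
  qed
  have "signed_difference N N' C = (\<Sum>p\<in>T \<inter> C. signed_difference N N' {p})"
    if "C \<in> sets borel" "C \<subseteq> square h" for C
  proof -
    have C: "C \<in> sets quadrant"
      using that by (rule borel_subset_square_in_sets_quadrant)
    have "measure N C = (\<Sum>p\<in>T \<inter> C. measure N {p})"
      by (rule ext[OF S(3) _ C that(2)]) (auto simp: T_def)
    moreover have "measure N' C = (\<Sum>p\<in>T \<inter> C. measure N' {p})"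
      by (rule ext[OF S'(3) _ C that(2)]) (auto simp: T_def)
    ultimately show ?thesis
      by (simp add: signed_difference_def sum_subtractf)
  qed
  then have "supported_on (signed_difference N N') (square h) T"
    using T by (simp add: supported_on_def)
  then show ?thesis ..
qed

lemma supported_on_singleton:
  assumes "supported_on d R S" "p \<in> R" "p \<notin> S"
  shows "d {p} = 0"
proof -
  have "d {p} = (\<Sum>q\<in>S \<inter> {p}. d {q})"
    using assms(2) by (intro supported_onD[OF assms(1)]) auto
  also have "S \<inter> {p} = {}"
    using assms by auto
  finally show ?thesis
    by simp
qed

text \<open>The sum over atoms and the finite sum over \<open>S\<close> differ in vanishing terms
  only: outside \<open>S\<close> both masses of a pair are 0, as \<open>S\<close> is symmetric, and
  points of \<open>S\<close> that are not over atoms get 0 from the condition.\<close>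

lemma signed_graph_eq_sum:
  assumes d: "supported_on d (square h) S" and B: "B \<subseteq> square h"
  shows "signed_graph w d B = (\<Sum>(x, y)\<in>S \<inter> B.
    (if w {x} \<noteq> 0 \<and> w {y} \<noteq> 0 then edge (d {(x, y)} + d {(y, x)}) else 0))"
proof -
  let ?g = "\<lambda>(x, y). if w {x} \<noteq> 0 \<and> w {y} \<noteq> 0 then edge (d {(x, y)} + d {(y, x)}) else 0"
  have S: "finite S" "S\<inverse> = S" "S \<subseteq> square h"
    using d by (auto simp: supported_on_def)
  have "signed_graph w d B = infsum ?g (S \<inter> B)"
    unfolding signed_graph_def
  proof (rule infsum_cong_neutral)
    fix p assume p: "p \<in> S \<inter> B - B \<inter> atoms w \<times> atoms w"
    then have "0 \<le> fst p" "0 \<le> snd p"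
      using S by (auto simp: square_eq)
    then show "?g p = 0"
      using p by (auto simp: atoms_def mem_Times_iff case_prod_unfold)
  next
    fix p assume p: "p \<in> B \<inter> atoms w \<times> atoms w - S \<inter> B"
    obtain x y where xy: "p = (x, y)"
      by (cases p)
    have "(x, y) \<in> square h" "(y, x) \<in> square h"
      using p B xy by (auto simp: square_eq)
    moreover have "(x, y) \<notin> S" "(y, x) \<notin> S"
      using p xy S(2) by auto
    ultimately have "d {(x, y)} = 0" "d {(y, x)} = 0"
      using supported_on_singleton[OF d] by auto
    then show "(case p of (x, y) \<Rightarrow> sgn (d {(x, y)} + d {(y, x)}) * min \<bar>d {(x, y)} + d {(y, x)}\<bar> 1) = 0"
      by (simp add: xy)
  next
    fix p assume "p \<in> B \<inter> atoms w \<times> atoms w \<inter> (S \<inter> B)"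
    then show "(case p of (x, y) \<Rightarrow> sgn (d {(x, y)} + d {(y, x)}) * min \<bar>d {(x, y)} + d {(y, x)}\<bar> 1) = ?g p"
      by (auto simp: atoms_def edge_def)
  qed
  also have "\<dots> = sum ?g (S \<inter> B)"
    using S by (intro infsum_finite) simp
  finally show ?thesis .
qed

text \<open>Once the mesh separates the coordinates of \<open>S\<close>, a product of two cells
  contains at most one point of \<open>S\<close> and its reflection at most the mirrored point, so
  cells and points have the same edge weight. The weights u are quantified inside and may thus vary
  with n: the constant 1 serves exchangeability, truncated weights serve measurability.\<close>

lemma eventually_cells_edge_sum:
  assumes d: "supported_on d (square h) S" and h: "0 < h" and B: "B \<in> sets borel" "B \<subseteq> square h"
    and g: "0 < g"
    and Q: "\<And>n. finite (Q n)" "\<And>n. B \<subseteq> (\<Union>(k, l)\<in>Q n. cell (g / 2 ^ n) k \<times> cell (g / 2 ^ n) l)"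
  shows "eventually (\<lambda>n. \<forall>u.
    (\<Sum>(k, l)\<in>Q n. u k * u l * edge (d (B \<inter> cell (g / 2 ^ n) k \<times> cell (g / 2 ^ n) l) +
        d ((B \<inter> cell (g / 2 ^ n) k \<times> cell (g / 2 ^ n) l)\<inverse>))) =
    (\<Sum>(x, y)\<in>S \<inter> B. u (cell_index (g / 2 ^ n) x) * u (cell_index (g / 2 ^ n) y) *
        edge (d {(x, y)} + d {(y, x)}))) sequentially"
proof -
  have S: "finite S" "S\<inverse> = S" "S \<subseteq> square h"
    using d by (auto simp: supported_on_def)
  have dC: "d C = (\<Sum>p\<in>S \<inter> C. d {p})" if "C \<in> sets borel" "C \<subseteq> square h" for C
    using d that by (rule supported_onD)
  \<comment> \<open>First coordinates suffice: by symmetry of \<open>S\<close> every second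
    coordinate is also a first one.\<close>
  have "eventually (\<lambda>n. inj_on (cell_index (g / 2 ^ n)) (fst ` S)) sequentially"
    using S by (intro eventually_inj_on_cell_index g) (auto simp: square_eq)
  then show ?thesis
  proof eventually_elim
    case (elim n)
    let ?\<delta> = "g / 2 ^ n"
    let ?c = "cell ?\<delta>"
    let ?\<kappa> = "cell_index ?\<delta>"
    have \<delta>: "0 < ?\<delta>"
      using g by simp
    have inj: "x = x'" if "?\<kappa> x = ?\<kappa> x'" "(x, y) \<in> S" "(x', y') \<in> S" for x x' y y'
      using elim that(1) by (rule inj_onD) (use that in force)+
    have sym: "(y, x) \<in> S" if "(x, y) \<in> S" for x y
      using that S(2) by auto
    have inj': "y = y'" if "?\<kappa> y = ?\<kappa> y'" "(x, y) \<in> S" "(x', y') \<in> S" for x x' y y'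
      using inj[OF that(1) sym[OF that(2)] sym[OF that(3)]] .
    have nonneg: "0 \<le> x" "0 \<le> y" if "(x, y) \<in> S" for x y
      using that S(3) by (auto simp: square_eq)
    let ?e = "\<lambda>k l. edge (d (B \<inter> ?c k \<times> ?c l) + d ((B \<inter> ?c k \<times> ?c l)\<inverse>))"
    have C: "B \<inter> ?c k \<times> ?c l \<in> sets borel" "B \<inter> ?c k \<times> ?c l \<subseteq> square h"
      "(B \<inter> ?c k \<times> ?c l)\<inverse> \<in> sets borel" "(B \<inter> ?c k \<times> ?c l)\<inverse> \<subseteq> square h" for k l
    proof -
      show 1: "B \<inter> ?c k \<times> ?c l \<in> sets borel"
        using pair_measureI[OF cell_borel cell_borel, of ?\<delta> k ?\<delta> l]
        unfolding borel_prod by (rule sets.Int[OF B(1)])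
      then show "(B \<inter> ?c k \<times> ?c l)\<inverse> \<in> sets borel"
        by (rule converse_borel)
    qed (use B(2) in \<open>auto simp: square_eq\<close>)
    have e: "?e (?\<kappa> x) (?\<kappa> y) = edge (d {(x, y)} + d {(y, x)})" if xy: "(x, y) \<in> S \<inter> B" for x y
    proof -
      have "S \<inter> (B \<inter> ?c (?\<kappa> x) \<times> ?c (?\<kappa> y)) = {(x, y)}"
        using xy nonneg \<delta> by (auto simp: mem_cell_iff dest: inj inj')
      moreover from this have "S \<inter> (B \<inter> ?c (?\<kappa> x) \<times> ?c (?\<kappa> y))\<inverse> = {(y, x)}"
        using S(2) by auto
      ultimately show ?thesis
        using dC[OF C(1,2), of "?\<kappa> x" "?\<kappa> y"] dC[OF C(3,4), of "?\<kappa> x" "?\<kappa> y"] by simp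
    qed
    let ?\<kappa>\<kappa> = "\<lambda>(x, y). (?\<kappa> x, ?\<kappa> y)"
    have img: "?\<kappa>\<kappa> ` (S \<inter> B) \<subseteq> Q n"
    proof
      fix z assume "z \<in> ?\<kappa>\<kappa> ` (S \<inter> B)"
      then obtain x y where xy: "(x, y) \<in> S \<inter> B" "z = (?\<kappa> x, ?\<kappa> y)"
        by auto
      then obtain k l where "(k, l) \<in> Q n" "x \<in> ?c k" "y \<in> ?c l"
        using Q(2)[of n] by blast
      then show "z \<in> Q n"
        using xy \<delta> by (simp add: mem_cell_iff)
    qed
    have zero: "?e k l = 0" if kl: "(k, l) \<notin> ?\<kappa>\<kappa> ` (S \<inter> B)" for k l
    proof -
      have "S \<inter> (B \<inter> ?c k \<times> ?c l) = {}"
        using kl \<delta> by (force simp: mem_cell_iff)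
      moreover from this have "S \<inter> (B \<inter> ?c k \<times> ?c l)\<inverse> = {}"
        using S(2) by auto
      ultimately show ?thesis
        using dC[OF C(1,2), of k l] dC[OF C(3,4), of k l] by simp
    qed
    have inj\<kappa>: "inj_on ?\<kappa>\<kappa> (S \<inter> B)"
      by (auto simp: inj_on_def intro: inj inj')
    show ?case
    proof
      fix u :: "nat \<Rightarrow> real"
      have "(\<Sum>(k, l)\<in>Q n. u k * u l * ?e k l) = (\<Sum>(k, l)\<in>?\<kappa>\<kappa> ` (S \<inter> B). u k * u l * ?e k l)"
        using Q(1) img zero by (intro sum.mono_neutral_right) auto
      also have "\<dots> = (\<Sum>(x, y)\<in>S \<inter> B. u (?\<kappa> x) * u (?\<kappa> y) * ?e (?\<kappa> x) (?\<kappa> y))"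
        by (subst sum.reindex[OF inj\<kappa>]) (simp add: case_prod_unfold)
      also have "\<dots> = (\<Sum>(x, y)\<in>S \<inter> B. u (?\<kappa> x) * u (?\<kappa> y) * edge (d {(x, y)} + d {(y, x)}))"
        using e by (intro sum.cong) auto
      finally show "(\<Sum>(k, l)\<in>Q n. u k * u l * ?e k l) =
          (\<Sum>(x, y)\<in>S \<inter> B. u (?\<kappa> x) * u (?\<kappa> y) * edge (d {(x, y)} + d {(y, x)}))" .
    qed
  qed
qed

section \<open>Measurability and countable additivity of the signed graph\<close>

lemma bounded_borel_subset_square:
  assumes "B \<in> bounded_borel ({0..} \<times> {0..})"
  shows "\<exists>h>0. B \<subseteq> square h"
proof -
  obtain a where a: "\<And>p. p \<in> B \<Longrightarrow> norm p \<le> a"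
    using assms by (auto simp: bounded_borel_def bounded_iff)
  \<comment> \<open>The bound a may be negative if \<open>B\<close> is empty, and
    \<open>square\<close> is half-open; hence the absolute value and the added 1.\<close>
  have "B \<subseteq> square (\<bar>a\<bar> + 1)"
  proof
    fix p assume p: "p \<in> B"
    then have "p \<in> {0..} \<times> {0..}"
      using assms by (auto simp: bounded_borel_def)
    moreover have "\<bar>fst p\<bar> \<le> a" "\<bar>snd p\<bar> \<le> a"
      using a[OF p] norm_fst_le[of "fst p" "snd p"] norm_snd_le[of "snd p" "fst p"] by auto
    ultimately show "p \<in> square (\<bar>a\<bar> + 1)"
      by (auto simp: square_eq mem_Times_iff)
  qed
  then show ?thesis
    by (intro exI[of _ "\<bar>a\<bar> + 1"]) auto
qed

lemma truncated_scaling_LIMSEQ: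
  "(\<lambda>j. min 1 (real j * \<bar>a\<bar>)) \<longlonglongrightarrow> (if a \<noteq> 0 then 1 else 0)"
proof (cases "a = 0")
  case False
  then have a: "0 < \<bar>a\<bar>"
    by simp
  have "eventually (\<lambda>j. min 1 (real j * \<bar>a\<bar>) = 1) sequentially"
    using eventually_ge_at_top[of "nat \<lceil>1 / \<bar>a\<bar>\<rceil>"]
  proof eventually_elim
    case (elim j)
    then have "1 / \<bar>a\<bar> \<le> real j"
      by linarith
    then show ?case
      using a by (simp add: field_simps)
  qed
  then show ?thesis
    using False by (auto intro: tendsto_eventually)
qed simp

lemma signed_difference_measurable:
  assumes D: "D \<in> M \<rightarrow>\<^sub>M point_measures S" "D' \<in> M \<rightarrow>\<^sub>M point_measures S" and C: "C \<in> sets S"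
  shows "(\<lambda>\<omega>. signed_difference (D \<omega>) (D' \<omega>) C) \<in> borel_measurable M"
proof -
  have "(\<lambda>\<omega>. emeasure (D \<omega>) C) \<in> borel_measurable M" "(\<lambda>\<omega>. emeasure (D' \<omega>) C) \<in> borel_measurable M"
    using D measurable_comp[OF _ measurable_emeasure_point_measures[OF C]] by (auto simp: comp_def)
  then show ?thesis
    unfolding signed_difference_def measure_def by measurable
qed

lemma locally_finite_supported_on:
  assumes "locally_finite_point_process M quadrant D" "locally_finite_point_process M quadrant D'"
    and "\<omega> \<in> space M" "0 < h"
  shows "\<exists>S. supported_on (signed_difference (D \<omega>) (D' \<omega>)) (square h) S"
proof (rule signed_difference_supported_on)
  have "square h \<in> sets quadrant" "bounded (square h)"
    using \<open>0 < h\<close> by (auto simp: square_def intro: rectangle_in_sets_quadrant bounded_rectangle cell_in_bounded_borel)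
  then show "emeasure (D \<omega>) (square h) < \<infinity>" "emeasure (D' \<omega>) (square h) < \<infinity>"
    using assms by (auto simp: locally_finite_point_process_def)
qed (use assms in \<open>auto simp: locally_finite_point_process_def dest: measurable_space\<close>)

text \<open>The measurability proof weights the cells with \<open>min 1 (j \<bar>w(cell)\<bar>)\<close>, which converges
  under refinement for fixed \<open>j\<close>; letting \<open>j\<close> tend to infinity afterwards gives the indicator
  of the atoms. The indicators of \<open>w(cell) \<noteq> 0\<close> need not converge to it.\<close>

lemma random_signed_measure_signed_graph:
  assumes D: "locally_finite_point_process M quadrant D" "locally_finite_point_process M quadrant D'"
    and w: "\<And>\<omega>. \<omega> \<in> space M \<Longrightarrow> purely_atomic (w \<omega>)"
    and w_meas: "\<And>\<delta> k. 0 < \<delta> \<Longrightarrow> (\<lambda>\<omega>. w \<omega> (cell \<delta> k)) \<in> borel_measurable M"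
  shows "random_signed_measure M ({0..} \<times> {0..}) (\<lambda>\<omega>. signed_graph (w \<omega>) (signed_difference (D \<omega>) (D' \<omega>)))"
  unfolding random_signed_measure_def
proof (intro conjI ballI allI impI)
  let ?d = "\<lambda>\<omega>. signed_difference (D \<omega>) (D' \<omega>)"
  have D_meas: "D \<in> M \<rightarrow>\<^sub>M point_measures quadrant" "D' \<in> M \<rightarrow>\<^sub>M point_measures quadrant"
    using D by (auto simp: locally_finite_point_process_def)
  {
    fix B :: "(real \<times> real) set" assume B: "B \<in> bounded_borel ({0..} \<times> {0..})"
    then have B_borel: "B \<in> sets borel"
      by (simp add: bounded_borel_def)
    obtain h where h: "0 < h" "B \<subseteq> square h"
      using bounded_borel_subset_square[OF B] by blast
    \<comment> \<open>The supports are chosen separately for each \<omega>, with no measurability in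
      \<omega>. They occur in the limits \<open>X j\<close> only; the approximants
      \<open>Y j n\<close> are built from fixed cells.\<close>
    obtain S where S: "\<And>\<omega>. \<omega> \<in> space M \<Longrightarrow> supported_on (?d \<omega>) (square h) (S \<omega>)"
      using locally_finite_supported_on[OF D _ h(1)] by metis
    define u where "u j n \<omega> k = min 1 (real j * \<bar>w \<omega> (cell (h / 2 ^ n) k)\<bar>)" for j n :: nat and \<omega> k
    define c where "c n k l = B \<inter> cell (h / 2 ^ n) k \<times> cell (h / 2 ^ n) l" for n k l
    define Y where "Y j n \<omega> = (\<Sum>(k, l)\<in>{..<2 ^ n} \<times> {..<2 ^ n}. u j n \<omega> k * u j n \<omega> l *
        edge (?d \<omega> (c n k l) + ?d \<omega> ((c n k l)\<inverse>)))" for j n \<omega>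
    define v where "v j \<omega> x = min 1 (real j * \<bar>w \<omega> {x}\<bar>)" for j :: nat and \<omega> x
    define X where "X j \<omega> = (\<Sum>(x, y)\<in>S \<omega> \<inter> B. v j \<omega> x * v j \<omega> y *
        edge (?d \<omega> {(x, y)} + ?d \<omega> {(y, x)}))" for j \<omega>
    have c: "c n k l \<in> sets quadrant" "(c n k l)\<inverse> \<in> sets quadrant" for n k l
    proof -
      have c_borel: "c n k l \<in> sets borel"
        using pair_measureI[OF cell_borel cell_borel, of "h / 2 ^ n" k "h / 2 ^ n" l]
        unfolding borel_prod c_def by (rule sets.Int[OF B_borel])
      then show "c n k l \<in> sets quadrant"
        by (rule borel_subset_square_in_sets_quadrant) (use h(2) in \<open>auto simp: c_def\<close>)
      show "(c n k l)\<inverse> \<in> sets quadrant"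
        using converse_borel[OF c_borel] h(2)
        by (intro borel_subset_square_in_sets_quadrant) (auto simp: c_def square_eq)
    qed
    have u_meas: "(\<lambda>\<omega>. u j n \<omega> k) \<in> borel_measurable M" for j n k
      unfolding u_def using h(1)
      by (intro borel_measurable_min borel_measurable_const borel_measurable_times borel_measurable_abs w_meas) simp
    have d_meas: "(\<lambda>\<omega>. ?d \<omega> (c n k l)) \<in> borel_measurable M" "(\<lambda>\<omega>. ?d \<omega> ((c n k l)\<inverse>)) \<in> borel_measurable M" for n k l
      using D_meas c by (auto intro: signed_difference_measurable)
    have Y_meas: "Y j n \<in> borel_measurable M" for j n
      unfolding Y_def case_prod_unfold
      by (intro borel_measurable_sum borel_measurable_times u_meas
          measurable_compose[OF _ edge_measurable] borel_measurable_add d_meas)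
    have Y_lim: "(\<lambda>n. Y j n \<omega>) \<longlonglongrightarrow> X j \<omega>" if \<omega>: "\<omega> \<in> space M" for j \<omega>
    proof (rule Lim_transform_eventually)
      have cover: "B \<subseteq> (\<Union>(k, l)\<in>{..<2 ^ n} \<times> {..<2 ^ n}. cell (h / 2 ^ n) k \<times> cell (h / 2 ^ n) l)" for n :: nat
        using h(2) cell_refine[OF h(1), of "2 ^ n" 0] by (fastforce simp: square_def)
      have "eventually (\<lambda>n. \<forall>u.
        (\<Sum>(k, l)\<in>{..<2 ^ n} \<times> {..<2 ^ n}. u k * u l * edge (?d \<omega> (c n k l) + ?d \<omega> ((c n k l)\<inverse>))) =
        (\<Sum>(x, y)\<in>S \<omega> \<inter> B. u (cell_index (h / 2 ^ n) x) * u (cell_index (h / 2 ^ n) y) *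
            edge (?d \<omega> {(x, y)} + ?d \<omega> {(y, x)}))) sequentially"
        unfolding c_def by (rule eventually_cells_edge_sum[OF S[OF \<omega>] h(1) B_borel h(2) h(1) _ cover]) simp
      then show "eventually (\<lambda>n. (\<Sum>(x, y)\<in>S \<omega> \<inter> B. u j n \<omega> (cell_index (h / 2 ^ n) x) *
          u j n \<omega> (cell_index (h / 2 ^ n) y) * edge (?d \<omega> {(x, y)} + ?d \<omega> {(y, x)})) = Y j n \<omega>) sequentially"
        unfolding Y_def by eventually_elim simp
      have u_lim: "(\<lambda>n. u j n \<omega> (cell_index (h / 2 ^ n) x)) \<longlonglongrightarrow> v j \<omega> x" if "0 \<le> x" for x
        using purely_atomic_dyadic_cell_LIMSEQ[OF w[OF \<omega>] h(1) that]
        unfolding u_def v_def dyadic_cell_def by (intro tendsto_intros)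
      have "0 \<le> fst p" "0 \<le> snd p" if "p \<in> S \<omega> \<inter> B" for p
        using that h(2) by (auto simp: square_eq)
      then show "(\<lambda>n. \<Sum>(x, y)\<in>S \<omega> \<inter> B. u j n \<omega> (cell_index (h / 2 ^ n) x) *
          u j n \<omega> (cell_index (h / 2 ^ n) y) * edge (?d \<omega> {(x, y)} + ?d \<omega> {(y, x)})) \<longlonglongrightarrow> X j \<omega>"
        unfolding X_def case_prod_unfold by (intro tendsto_sum tendsto_mult u_lim tendsto_const)
    qed
    have X_meas: "X j \<in> borel_measurable M" for j
      using Y_lim Y_meas by (rule borel_measurable_LIMSEQ_real)
    have X_lim: "(\<lambda>j. X j \<omega>) \<longlonglongrightarrow> signed_graph (w \<omega>) (?d \<omega>) B" if \<omega>: "\<omega> \<in> space M" for \<omega>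
    proof -
      have "(\<lambda>j. X j \<omega>) \<longlonglongrightarrow> (\<Sum>(x, y)\<in>S \<omega> \<inter> B. (if w \<omega> {x} \<noteq> 0 then 1 else 0) *
          (if w \<omega> {y} \<noteq> 0 then 1 else 0) * edge (?d \<omega> {(x, y)} + ?d \<omega> {(y, x)}))"
        unfolding X_def v_def case_prod_unfold
        by (intro tendsto_sum tendsto_mult truncated_scaling_LIMSEQ tendsto_const)
      also have "(\<Sum>(x, y)\<in>S \<omega> \<inter> B. (if w \<omega> {x} \<noteq> 0 then 1 else 0) *
          (if w \<omega> {y} \<noteq> 0 then 1 else 0) * edge (?d \<omega> {(x, y)} + ?d \<omega> {(y, x)})) = signed_graph (w \<omega>) (?d \<omega>) B"
        unfolding signed_graph_eq_sum[OF S[OF \<omega>] h(2)] by (intro sum.cong) auto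
      finally show ?thesis .
    qed
    show "(\<lambda>\<omega>. signed_graph (w \<omega>) (?d \<omega>) B) \<in> borel_measurable M"
      using X_lim X_meas by (rule borel_measurable_LIMSEQ_real)
  next
    fix \<omega> and B :: "nat \<Rightarrow> (real \<times> real) set"
    assume \<omega>: "\<omega> \<in> space M"
      and B: "(\<forall>i. B i \<in> bounded_borel ({0..} \<times> {0..})) \<and> disjoint_family B \<and> bounded (\<Union>i. B i)"
    then have "(\<Union>i. B i) \<in> bounded_borel ({0..} \<times> {0..})"
      by (auto simp: bounded_borel_def)
    then obtain h where h: "0 < h" "(\<Union>i. B i) \<subseteq> square h"
      using bounded_borel_subset_square by blast
    obtain S where S: "supported_on (?d \<omega>) (square h) S"
      using locally_finite_supported_on[OF D \<omega> h(1)] by blast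
    \<comment> \<open>For fixed \<omega> the signed graph on the square is a finite combination of
      point masses, so countable additivity reduces to that of indicators.\<close>
    define g where "g p = (case p of (x, y) \<Rightarrow>
      if w \<omega> {x} \<noteq> 0 \<and> w \<omega> {y} \<noteq> 0 then edge (?d \<omega> {(x, y)} + ?d \<omega> {(y, x)}) else 0)" for p
    have eq: "signed_graph (w \<omega>) (?d \<omega>) C = (\<Sum>p\<in>S. g p * indicator C p)" if "C \<subseteq> square h" for C
    proof -
      have "signed_graph (w \<omega>) (?d \<omega>) C = (\<Sum>p\<in>S \<inter> C. g p)"
        unfolding signed_graph_eq_sum[OF S that] g_def ..
      also have "\<dots> = (\<Sum>p\<in>S. g p * indicator C p)"
        using S by (intro sum.mono_neutral_cong_left) (auto simp: supported_on_def indicator_def)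
      finally show ?thesis .
    qed
    have "(\<lambda>i. \<Sum>p\<in>S. g p * indicator (B i) p) sums (\<Sum>p\<in>S. g p * indicator (\<Union>i. B i) p)"
      using B by (intro sums_sum sums_mult indicator_sums) (auto simp: disjoint_family_on_def)
    moreover have "B i \<subseteq> square h" for i
      using h(2) by blast
    ultimately show "(\<lambda>i. signed_graph (w \<omega>) (?d \<omega>) (B i)) sums signed_graph (w \<omega>) (?d \<omega>) (\<Union>i. B i)"
      using h(2) by (simp add: eq)
  }
qed

lemma CRSM_exchangeable_atomic:
  assumes "levy_measure \<rho>" and W: "CRSM M \<rho> (restrict_space lborel {0..}) W"
  shows "exchangeable_atomic M W"
proof (intro exchangeable_atomic.intro exchangeable_atomic_axioms.intro)
  show "prob_space M"
    using W by (auto simp: CRSM_def poisson_process_def)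
  show "(\<lambda>\<omega>. W \<omega> (cell \<delta> k)) \<in> borel_measurable M" if "0 < \<delta>" for \<delta> k
    using W that by (auto simp: CRSM_def completely_random_signed_measure_def
        random_signed_measure_def space_lborel_half_line cell_in_bounded_borel)
qed (use assms in \<open>auto intro: CRSM_purely_atomic CRSM_cells_distr_eq\<close>)

lemma exchangeable_atomic_uminus:
  assumes "exchangeable_atomic M U"
  shows "exchangeable_atomic M (\<lambda>\<omega> B. - U \<omega> B)"
proof -
  interpret exchangeable_atomic M U by fact
  show ?thesis
  proof
    fix \<delta> :: real and \<sigma> :: "nat \<Rightarrow> nat" and q :: nat
    assume \<delta>: "0 < \<delta>" and \<sigma>: "inj \<sigma>"
    let ?P = "\<Pi>\<^sub>M k\<in>{..<q}. (borel :: real measure)"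
    have neg: "(\<lambda>y. \<lambda>k\<in>{..<q}. - y k) \<in> ?P \<rightarrow>\<^sub>M ?P"
      by (intro measurable_restrict borel_measurable_uminus measurable_component_singleton)
    have vec: "(\<lambda>\<omega>. \<lambda>k\<in>{..<q}. U \<omega> (cell \<delta> (\<tau> k))) \<in> M \<rightarrow>\<^sub>M ?P" for \<tau>
      using \<delta> by (intro measurable_restrict cell_measurable)
    have eq: "distr M ?P (\<lambda>\<omega>. \<lambda>k\<in>{..<q}. - U \<omega> (cell \<delta> (\<tau> k))) =
        distr (distr M ?P (\<lambda>\<omega>. \<lambda>k\<in>{..<q}. U \<omega> (cell \<delta> (\<tau> k)))) ?P (\<lambda>y. \<lambda>k\<in>{..<q}. - y k)" for \<tau>
      unfolding distr_distr[OF neg vec] by (intro distr_cong) (auto simp: restrict_def)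
    show "distr M ?P (\<lambda>\<omega>. \<lambda>k\<in>{..<q}. - U \<omega> (cell \<delta> (\<sigma> k))) = distr M ?P (\<lambda>\<omega>. \<lambda>k\<in>{..<q}. - U \<omega> (cell \<delta> k))"
      unfolding eq eq[of "\<lambda>k. k"] cells_distr_eq[OF \<delta> \<sigma>] ..
  qed (auto intro: purely_atomic_uminus atomic cell_measurable)
qed

text \<open>The indicators are eventually constant almost surely. Asking for eventual equality
  spares any continuity condition on the limiting event.\<close>

lemma (in prob_space) prob_LIMSEQ_eventually_eq:
  assumes [measurable]: "\<And>n. A n \<in> events" "A' \<in> events"
    and AE: "AE \<omega> in M. eventually (\<lambda>n. \<omega> \<in> A n \<longleftrightarrow> \<omega> \<in> A') sequentially"
  shows "(\<lambda>n. prob (A n)) \<longlonglongrightarrow> prob A'"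
proof -
  have "(\<lambda>n. \<integral>\<omega>. indicat_real (A n) \<omega> \<partial>M) \<longlonglongrightarrow> (\<integral>\<omega>. indicat_real A' \<omega> \<partial>M)"
  proof (rule integral_dominated_convergence[where w="\<lambda>_. 1"])
    show "AE \<omega> in M. (\<lambda>n. indicat_real (A n) \<omega>) \<longlonglongrightarrow> indicat_real A' \<omega>"
      using AE
    proof eventually_elim
      case (elim \<omega>)
      then have "eventually (\<lambda>n. indicat_real (A n) \<omega> = indicat_real A' \<omega>) sequentially"
        by eventually_elim (simp add: indicator_def)
      then show ?case
        by (rule tendsto_eventually)
    qed
  qed (auto simp: indicator_def)
  then show ?thesis
    by (simp add: Int_absorb2 sets.sets_into_space)
qed

section \<open>Joint exchangeability\<close>

text \<open>The value of \<open>signed_graph\<close> on the pair of cells i and j of length h,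
  provided that the fine cells separate all points and all points lie over atoms. It sees
  \<open>d\<close> on cells only.\<close>

definition cell_edge_sum :: "real \<Rightarrow> ((real \<times> real) set \<Rightarrow> real) \<Rightarrow> nat \<Rightarrow> nat \<Rightarrow> nat \<Rightarrow> real" where
  "cell_edge_sum h d n i j = (\<Sum>r<2 ^ n. \<Sum>s<2 ^ n. edge (
     d (cell (h / 2 ^ n) (i * 2 ^ n + r) \<times> cell (h / 2 ^ n) (j * 2 ^ n + s)) +
     d (cell (h / 2 ^ n) (j * 2 ^ n + s) \<times> cell (h / 2 ^ n) (i * 2 ^ n + r))))"

text \<open>In a square containing both cells the support is finite, so fine cells separate its
  points. The assumption on atoms removes the condition on \<open>w\<close> from the sum, which
  leaves a function of \<open>d\<close> alone.\<close>

lemma eventually_cell_edge_sum: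
  assumes h: "0 < h" and supp: "\<And>H. 0 < H \<Longrightarrow> \<exists>S. supported_on d (square H) S"
    and atoms: "\<And>x y. 0 \<le> x \<Longrightarrow> 0 \<le> y \<Longrightarrow> d {(x, y)} \<noteq> 0 \<Longrightarrow> w {x} \<noteq> 0 \<and> w {y} \<noteq> 0"
  shows "eventually (\<lambda>n. cell_edge_sum h d n i j = signed_graph w d (cell h i \<times> cell h j)) sequentially"
proof -
  let ?B = "cell h i \<times> cell h j"
  define H where "H = h * (real (max i j) + 1)"
  have H: "0 < H"
    using h by (simp add: H_def add_nonneg_pos)
  have sub: "cell h k \<subseteq> {0..<H}" if "k \<le> max i j" for k
  proof
    fix x assume x: "x \<in> cell h k"
    then have "x < h * (real k + 1)" "0 \<le> x"
      using h cell_subset_half_line[OF h, of k] by (auto simp: cell_def)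
    moreover have "h * (real k + 1) \<le> H"
      unfolding H_def using h that by (intro mult_left_mono) auto
    ultimately show "x \<in> {0..<H}"
      by simp
  qed
  have B: "?B \<in> sets borel" "?B \<subseteq> square H"
  proof -
    show "?B \<in> sets borel"
      using pair_measureI[OF cell_borel cell_borel, of h i h j] unfolding borel_prod .
    show "?B \<subseteq> square H"
      using sub[of i] sub[of j] by (auto simp: square_eq)
  qed
  obtain S where S: "supported_on d (square H) S"
    using supp[OF H] by blast
  have ref: "cell h k = (\<Union>r<2 ^ n. cell (h / 2 ^ n) (k * 2 ^ n + r))" for k n
    using cell_refine[OF h, of "2 ^ n" k] by simp
  let ?q = "\<lambda>n (r, s). (i * 2 ^ n + r, j * 2 ^ n + s) :: nat \<times> nat"
  let ?I = "\<lambda>n. {..<2 ^ n} \<times> {..<2 ^ n :: nat}"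
  have cover: "?B \<subseteq> (\<Union>(k, l)\<in>?q n ` ?I n. cell (h / 2 ^ n) k \<times> cell (h / 2 ^ n) l)" for n
    unfolding ref[of i n] ref[of j n] by auto
  have "eventually (\<lambda>n. \<forall>u.
    (\<Sum>(k, l)\<in>?q n ` ?I n. u k * u l * edge (d (?B \<inter> cell (h / 2 ^ n) k \<times> cell (h / 2 ^ n) l) +
        d ((?B \<inter> cell (h / 2 ^ n) k \<times> cell (h / 2 ^ n) l)\<inverse>))) =
    (\<Sum>(x, y)\<in>S \<inter> ?B. u (cell_index (h / 2 ^ n) x) * u (cell_index (h / 2 ^ n) y) *
        edge (d {(x, y)} + d {(y, x)}))) sequentially"
    by (rule eventually_cells_edge_sum[OF S H B h _ cover]) simp
  then show ?thesis
  proof eventually_elim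
    case (elim n)
    let ?c = "cell (h / 2 ^ n)"
    have "signed_graph w d ?B = (\<Sum>(x, y)\<in>S \<inter> ?B. edge (d {(x, y)} + d {(y, x)}))"
      unfolding signed_graph_eq_sum[OF S B(2)]
    proof (rule sum.cong, simp, safe)
      fix x y assume "(x, y) \<in> S" "x \<in> cell h i" "y \<in> cell h j"
      then have "0 \<le> x" "0 \<le> y"
        using cell_subset_half_line[OF h] by auto
      \<comment> \<open>If the sum of the two masses is nonzero, one of them is, and either of them
        forces both coordinates to be atoms.\<close>
      then have "w {x} \<noteq> 0 \<and> w {y} \<noteq> 0 \<or> d {(x, y)} + d {(y, x)} = 0"
        using atoms[of x y] atoms[of y x] by (cases "d {(x, y)} = 0"; cases "d {(y, x)} = 0") auto
      then show "(if w {x} \<noteq> 0 \<and> w {y} \<noteq> 0 then edge (d {(x, y)} + d {(y, x)}) else 0) =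
          edge (d {(x, y)} + d {(y, x)})"
        by auto
    qed
    also have "\<dots> = (\<Sum>(k, l)\<in>?q n ` ?I n. edge (d (?B \<inter> ?c k \<times> ?c l) + d ((?B \<inter> ?c k \<times> ?c l)\<inverse>)))"
      using elim[rule_format, of "\<lambda>_. 1"] by simp
    also have "\<dots> = (\<Sum>(r, s)\<in>?I n. edge (d (?B \<inter> ?c (i * 2 ^ n + r) \<times> ?c (j * 2 ^ n + s)) +
        d ((?B \<inter> ?c (i * 2 ^ n + r) \<times> ?c (j * 2 ^ n + s))\<inverse>)))"
      by (subst sum.reindex) (auto simp: inj_on_def case_prod_unfold)
    also have "\<dots> = (\<Sum>(r, s)\<in>?I n. edge (d (?c (i * 2 ^ n + r) \<times> ?c (j * 2 ^ n + s)) +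
        d (?c (j * 2 ^ n + s) \<times> ?c (i * 2 ^ n + r))))"
    proof (rule sum.cong, simp, safe)
      fix r s :: nat assume rs: "r < 2 ^ n" "s < 2 ^ n"
      have "?B \<inter> ?c (i * 2 ^ n + r) \<times> ?c (j * 2 ^ n + s) = ?c (i * 2 ^ n + r) \<times> ?c (j * 2 ^ n + s)"
        unfolding ref[of i n] ref[of j n] using rs by auto
      moreover have "(?c (i * 2 ^ n + r) \<times> ?c (j * 2 ^ n + s))\<inverse> = ?c (j * 2 ^ n + s) \<times> ?c (i * 2 ^ n + r)"
        by auto
      ultimately show "edge (d (?B \<inter> ?c (i * 2 ^ n + r) \<times> ?c (j * 2 ^ n + s)) +
            d ((?B \<inter> ?c (i * 2 ^ n + r) \<times> ?c (j * 2 ^ n + s))\<inverse>)) =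
          edge (d (?c (i * 2 ^ n + r) \<times> ?c (j * 2 ^ n + s)) + d (?c (j * 2 ^ n + s) \<times> ?c (i * 2 ^ n + r)))"
        by simp
    qed
    also have "\<dots> = cell_edge_sum h d n i j"
      unfolding cell_edge_sum_def by (rule sum.cartesian_product[symmetric])
    finally show ?case ..
  qed
qed

text \<open>Cells are half-open in order to partition the half-line, while blocks are closed and
  share endpoints. The two differ by a right endpoint, a multiple of h, which carries no
  atom.\<close>

lemma signed_graph_block_eq:
  assumes h: "0 < h" and w: "\<And>k. w {h * real k} = 0"
  shows "signed_graph w d (block h i \<times> block h j) = signed_graph w d (cell h i \<times> cell h j)"
proof -
  have "x \<in> block h k \<longleftrightarrow> x \<in> cell h k" if "w {x} \<noteq> 0" for x k
    using that w[of "Suc k"] by (auto simp: block_def cell_def less_le add.commute)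
  then have "block h i \<times> block h j \<inter> atoms w \<times> atoms w = cell h i \<times> cell h j \<inter> atoms w \<times> atoms w"
    by (auto simp: atoms_def)
  then show ?thesis
    by (simp add: signed_graph_def)
qed

text \<open>\<open>cell_edge_sum\<close> as a function of two count vectors over \<open>q\<close>
  cells, \<open>m\<close> to a block. No permutation appears in it: a permutation changes only the
  vectors that are inserted.\<close>

definition count_edge_sum :: "nat \<Rightarrow> nat \<Rightarrow> nat \<Rightarrow> nat \<Rightarrow> (nat \<Rightarrow> nat) \<times> (nat \<Rightarrow> nat) \<Rightarrow> real" where
  "count_edge_sum q m i j z = (\<Sum>r<m. \<Sum>s<m. edge (
     (real (fst z ((i * m + r) * q + (j * m + s))) - real (snd z ((i * m + r) * q + (j * m + s)))) +
     (real (fst z ((j * m + s) * q + (i * m + r))) - real (snd z ((j * m + s) * q + (i * m + r))))))"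

lemma count_edge_sum_measurable:
  fixes q m :: nat
  defines "P \<equiv> \<Pi>\<^sub>M t\<in>{..<q * q}. count_space (UNIV :: nat set)"
  assumes q: "q = N * m" and ij: "i < N" "j < N"
  shows "count_edge_sum q m i j \<in> borel_measurable (P \<Otimes>\<^sub>M P)"
proof -
  have comp: "(\<lambda>z. real (fst z t)) \<in> borel_measurable (P \<Otimes>\<^sub>M P)"
    "(\<lambda>z. real (snd z t)) \<in> borel_measurable (P \<Otimes>\<^sub>M P)" if "t < q * q" for t
  proof -
    have "(\<lambda>y. y t) \<in> P \<rightarrow>\<^sub>M count_space UNIV"
      unfolding P_def using that by (intro measurable_component_singleton) simp
    then have "(\<lambda>y. real (y t)) \<in> borel_measurable P"
      by (rule measurable_compose) simp
    then show "(\<lambda>z. real (fst z t)) \<in> borel_measurable (P \<Otimes>\<^sub>M P)"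
      "(\<lambda>z. real (snd z t)) \<in> borel_measurable (P \<Otimes>\<^sub>M P)"
      using measurable_compose[OF measurable_fst] measurable_compose[OF measurable_snd] by blast+
  qed
  have idx: "k * q + l < q * q" if "k < q" "l < q" for k l
    using that by (rule block_index_less)
  have "i * m + r < q" "j * m + r < q" if "r < m" for r
    unfolding q using ij that by (auto intro: block_index_less)
  then show ?thesis
    unfolding count_edge_sum_def
    by (intro borel_measurable_sum measurable_compose[OF _ edge_measurable] borel_measurable_add
        borel_measurable_diff comp idx) auto
qed

lemma (in poisson_network) measure_cell_pair:
  assumes "\<omega> \<in> space M" "0 < \<delta>" "k < q" "l < q"
  shows "measure (D \<omega>) (cell \<delta> (\<sigma> k) \<times> cell \<delta> (\<sigma> l)) = real (cell_counts \<delta> \<sigma> q (D \<omega>) (k * q + l))"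
proof -
  have "k * q + l < q * q" "(k * q + l) div q = k" "(k * q + l) mod q = l"
    using assms by (auto intro: block_index_less)
  moreover have "emeasure (D \<omega>) (cell \<delta> (\<sigma> k) \<times> cell \<delta> (\<sigma> l)) =
      of_nat (point_count (D \<omega>) (cell \<delta> (\<sigma> k) \<times> cell \<delta> (\<sigma> l)))"
    using assms by (intro D_rectangle_count cell_in_bounded_borel)
  ultimately show ?thesis
    by (simp add: cell_counts_def cell_pair_def measure_def)
qed

text \<open>At each mesh n the array \<open>F n\<close> is a fixed function of two independent count
  vectors, so its finite-dimensional laws are invariant. Almost surely each entry agrees with that
  of Z for all large n, so the probabilities of finite-dimensional events converge, and these
  determine the law of the infinite array.\<close>

lemma signed_graph_jointly_exchangeable:
  assumes p: "poisson_network M W Dp" and m: "poisson_network M (\<lambda>\<omega> B. - W \<omega> B) Dm"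
    and indep: "prob_space.indep_var M (point_measures quadrant) Dp (point_measures quadrant) Dm"
    and null: "\<And>x. 0 \<le> x \<Longrightarrow> AE \<omega> in M. W \<omega> {x} = 0"
  shows "jointly_exchangeable M (\<lambda>\<omega>. signed_graph (W \<omega>) (signed_difference (Dp \<omega>) (Dm \<omega>)))"
  unfolding jointly_exchangeable_def
proof (intro conjI allI impI)
  interpret p: poisson_network M W Dp by fact
  interpret m: poisson_network M "\<lambda>\<omega> B. - W \<omega> B" Dm by fact
  let ?d = "\<lambda>\<omega>. signed_difference (Dp \<omega>) (Dm \<omega>)"
  let ?Z = "\<lambda>\<omega>. signed_graph (W \<omega>) (?d \<omega>)"
  show Z: "random_signed_measure M ({0..} \<times> {0..}) ?Z"
    using p.locally_finite m.locally_finite p.atomic p.cell_measurable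
    by (rule random_signed_measure_signed_graph)
  fix h :: real and \<pi> :: "nat \<Rightarrow> nat"
  assume h: "0 < h" and "bij \<pi>"
  then have \<pi>: "inj \<pi>"
    by (simp add: bij_is_inj)
  define F where "F n \<omega> i j = cell_edge_sum h (?d \<omega>) n i j" for n \<omega> i j
  \<comment> \<open>Measurability of the events is proved together with their invariance, since both
    come from one representation by count vectors.\<close>
  have prob_eq: "{\<omega>\<in>space M. \<forall>p\<in>J. F n \<omega> (fst p) (snd p) \<in> A p} \<in> sets M"
    "{\<omega>\<in>space M. \<forall>p\<in>J. F n \<omega> (\<pi> (fst p)) (\<pi> (snd p)) \<in> A p} \<in> sets M"
    "p.prob {\<omega>\<in>space M. \<forall>p\<in>J. F n \<omega> (\<pi> (fst p)) (\<pi> (snd p)) \<in> A p} =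
     p.prob {\<omega>\<in>space M. \<forall>p\<in>J. F n \<omega> (fst p) (snd p) \<in> A p}"
    if J: "finite J" and A: "\<And>p. p \<in> J \<Longrightarrow> A p \<in> sets borel" for J :: "(nat \<times> nat) set" and A and n :: nat
  proof -
    \<comment> \<open>\<open>N\<close> bounds the block numbers in \<open>J\<close> before they are
      permuted; the images under \<pi> may be larger, but \<open>cell_counts\<close> applies the
      index map itself, so \<open>q\<close> indices suffice.\<close>
    obtain N where N: "fst p < N" "snd p < N" if "p \<in> J" for p
    proof
      show "fst p < Suc (Max (fst ` J \<union> snd ` J))" "snd p < Suc (Max (fst ` J \<union> snd ` J))" if "p \<in> J" for p
        using J that by (auto simp: less_Suc_eq_le intro!: Max_ge)
    qed
    define q where "q = N * 2 ^ n"
    define \<delta> where "\<delta> = h / 2 ^ n"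
    have \<delta>: "0 < \<delta>"
      using h by (simp add: \<delta>_def)
    let ?P = "\<Pi>\<^sub>M t\<in>{..<q * q}. count_space (UNIV :: nat set)"
    let ?X = "\<lambda>\<sigma> \<omega>. (cell_counts \<delta> \<sigma> q (Dp \<omega>), cell_counts \<delta> \<sigma> q (Dm \<omega>))"
    \<comment> \<open>Independence makes the law of the pair a product, so invariance of each
      marginal is enough.\<close>
    have X: "?X \<sigma> \<in> M \<rightarrow>\<^sub>M ?P \<Otimes>\<^sub>M ?P"
      "distr M ?P (\<lambda>\<omega>. cell_counts \<delta> \<sigma> q (Dp \<omega>)) \<Otimes>\<^sub>M distr M ?P (\<lambda>\<omega>. cell_counts \<delta> \<sigma> q (Dm \<omega>)) =
       distr M (?P \<Otimes>\<^sub>M ?P) (?X \<sigma>)" for \<sigma>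
    proof -
      have cc: "cell_counts \<delta> \<sigma> q \<in> point_measures quadrant \<rightarrow>\<^sub>M ?P"
        using \<delta> by (rule cell_counts_measurable)
      have "p.indep_var ?P (cell_counts \<delta> \<sigma> q \<circ> Dp) ?P (cell_counts \<delta> \<sigma> q \<circ> Dm)"
        by (rule p.indep_var_compose[OF indep cc cc])
      then have *: "(\<lambda>\<omega>. cell_counts \<delta> \<sigma> q (Dp \<omega>)) \<in> M \<rightarrow>\<^sub>M ?P"
        "(\<lambda>\<omega>. cell_counts \<delta> \<sigma> q (Dm \<omega>)) \<in> M \<rightarrow>\<^sub>M ?P"
        "distr M ?P (\<lambda>\<omega>. cell_counts \<delta> \<sigma> q (Dp \<omega>)) \<Otimes>\<^sub>M distr M ?P (\<lambda>\<omega>. cell_counts \<delta> \<sigma> q (Dm \<omega>)) =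
         distr M (?P \<Otimes>\<^sub>M ?P) (?X \<sigma>)"
        unfolding p.indep_var_distribution_eq comp_def by simp_all
      show "?X \<sigma> \<in> M \<rightarrow>\<^sub>M ?P \<Otimes>\<^sub>M ?P"
        using *(1,2) by (rule measurable_Pair)
      show "distr M ?P (\<lambda>\<omega>. cell_counts \<delta> \<sigma> q (Dp \<omega>)) \<Otimes>\<^sub>M distr M ?P (\<lambda>\<omega>. cell_counts \<delta> \<sigma> q (Dm \<omega>)) =
         distr M (?P \<Otimes>\<^sub>M ?P) (?X \<sigma>)"
        by (rule *(3))
    qed
    define H where "H = {z \<in> space (?P \<Otimes>\<^sub>M ?P). \<forall>p\<in>J. count_edge_sum q (2 ^ n) (fst p) (snd p) z \<in> A p}"
    have H: "H \<in> sets (?P \<Otimes>\<^sub>M ?P)"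
      unfolding H_def
    proof (rule sets.sets_Collect_finite_All[OF _ J])
      fix p assume pJ: "p \<in> J"
      have "count_edge_sum q (2 ^ n) (fst p) (snd p) -` A p \<inter> space (?P \<Otimes>\<^sub>M ?P) \<in> sets (?P \<Otimes>\<^sub>M ?P)"
        by (rule measurable_sets[OF count_edge_sum_measurable[OF q_def N[OF pJ]] A[OF pJ]])
      then show "{z \<in> space (?P \<Otimes>\<^sub>M ?P). count_edge_sum q (2 ^ n) (fst p) (snd p) z \<in> A p} \<in> sets (?P \<Otimes>\<^sub>M ?P)"
        by (simp add: vimage_def Int_def conj_commute)
    qed
    have F_eq: "F n \<omega> (\<tau> i) (\<tau> j) = count_edge_sum q (2 ^ n) i j (?X (block_map \<tau> (2 ^ n)) \<omega>)"
      if \<omega>: "\<omega> \<in> space M" and ij: "i < N" "j < N" for \<omega> \<tau> i j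
    proof -
      have d: "?d \<omega> (cell \<delta> (\<tau> a * 2 ^ n + r) \<times> cell \<delta> (\<tau> b * 2 ^ n + s)) =
          real (fst (?X (block_map \<tau> (2 ^ n)) \<omega>) ((a * 2 ^ n + r) * q + (b * 2 ^ n + s))) -
          real (snd (?X (block_map \<tau> (2 ^ n)) \<omega>) ((a * 2 ^ n + r) * q + (b * 2 ^ n + s)))"
        if "a < N" "b < N" "r < 2 ^ n" "s < 2 ^ n" for a b r s
      proof -
        have "a * 2 ^ n + r < q" "b * 2 ^ n + s < q"
          unfolding q_def using that by (auto intro: block_index_less)
        then show ?thesis
          using p.measure_cell_pair[OF \<omega> \<delta>, of "a * 2 ^ n + r" q "b * 2 ^ n + s" "block_map \<tau> (2 ^ n)"]
            m.measure_cell_pair[OF \<omega> \<delta>, of "a * 2 ^ n + r" q "b * 2 ^ n + s" "block_map \<tau> (2 ^ n)"] that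
          by (simp add: signed_difference_def block_map_eq)
      qed
      show ?thesis
        unfolding F_def cell_edge_sum_def count_edge_sum_def \<delta>_def[symmetric]
        using d ij by (intro sum.cong refl arg_cong[where f=edge] arg_cong2[where f="(+)"]) auto
    qed
    have event: "{\<omega>\<in>space M. \<forall>p\<in>J. F n \<omega> (\<tau> (fst p)) (\<tau> (snd p)) \<in> A p} =
        ?X (block_map \<tau> (2 ^ n)) -` H \<inter> space M" for \<tau>
      using N F_eq measurable_space[OF X(1)] by (auto simp: H_def)
    have event_id: "{\<omega>\<in>space M. \<forall>p\<in>J. F n \<omega> (fst p) (snd p) \<in> A p} =
        ?X (block_map id (2 ^ n)) -` H \<inter> space M"
      using event[of id] by simp
    show "{\<omega>\<in>space M. \<forall>p\<in>J. F n \<omega> (fst p) (snd p) \<in> A p} \<in> sets M"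
      unfolding event_id by (rule measurable_sets[OF X(1) H])
    show "{\<omega>\<in>space M. \<forall>p\<in>J. F n \<omega> (\<pi> (fst p)) (\<pi> (snd p)) \<in> A p} \<in> sets M"
      unfolding event by (rule measurable_sets[OF X(1) H])
    have "block_map id (2 ^ n) = id"
      by (intro ext) (simp only: block_map_def id_apply div_mult_mod_eq)
    then have "distr M (?P \<Otimes>\<^sub>M ?P) (?X (block_map \<pi> (2 ^ n))) = distr M (?P \<Otimes>\<^sub>M ?P) (?X (block_map id (2 ^ n)))"
      using p.cell_counts_distr_eq[OF \<delta> inj_block_map[OF \<pi>]] m.cell_counts_distr_eq[OF \<delta> inj_block_map[OF \<pi>]]
      by (simp add: X(2)[symmetric])
    then show "p.prob {\<omega>\<in>space M. \<forall>p\<in>J. F n \<omega> (\<pi> (fst p)) (\<pi> (snd p)) \<in> A p} =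
        p.prob {\<omega>\<in>space M. \<forall>p\<in>J. F n \<omega> (fst p) (snd p) \<in> A p}"
      unfolding event event_id
      by (subst (1 2) measure_distr[OF X(1) H, symmetric]) simp
  qed
  \<comment> \<open>The block endpoints are countably many, so they are free of atoms
    simultaneously.\<close>
  have "AE \<omega> in M. \<forall>k. W \<omega> {h * real k} = 0"
    unfolding AE_all_countable using h by (intro allI null) simp
  then have lim: "AE \<omega> in M. \<forall>i j. eventually (\<lambda>n. F n \<omega> i j = ?Z \<omega> (block h i \<times> block h j)) sequentially"
    using p.AE_points_in_atoms m.AE_points_in_atoms AE_space
  proof eventually_elim
    case (elim \<omega>)
    show ?case
    proof (intro allI)
      fix i j
      have "eventually (\<lambda>n. F n \<omega> i j = ?Z \<omega> (cell h i \<times> cell h j)) sequentially"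
        unfolding F_def
      proof (rule eventually_cell_edge_sum[OF h])
        show "\<exists>S. supported_on (?d \<omega>) (square H) S" if "0 < H" for H
          using p.locally_finite m.locally_finite elim(4) that by (rule locally_finite_supported_on)
        fix x y :: real assume xy: "0 \<le> x" "0 \<le> y" "?d \<omega> {(x, y)} \<noteq> 0"
        then have "emeasure (Dp \<omega>) {(x, y)} \<noteq> 0 \<or> emeasure (Dm \<omega>) {(x, y)} \<noteq> 0"
          by (auto simp: signed_difference_def measure_def)
        then have "0 < W \<omega> {x} \<and> 0 < W \<omega> {y} \<or> 0 < - W \<omega> {x} \<and> 0 < - W \<omega> {y}"
          using elim(2,3) xy(1,2) by blast
        then show "W \<omega> {x} \<noteq> 0 \<and> W \<omega> {y} \<noteq> 0"
          by auto
      qed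
      then show "eventually (\<lambda>n. F n \<omega> i j = ?Z \<omega> (block h i \<times> block h j)) sequentially"
        using elim(1) by (simp add: signed_graph_block_eq[OF h])
    qed
  qed
  have Z_meas: "(\<lambda>\<omega>. ?Z \<omega> (block h i \<times> block h j)) \<in> borel_measurable M" for i j
  proof -
    have "block h k \<in> sets borel" "block h k \<subseteq> {0..}" "bounded (block h k)" for k
      using h by (auto simp: block_def intro: order_trans[of 0 "h * real k"])
    then have "block h i \<times> block h j \<in> bounded_borel ({0..} \<times> {0..})"
      using pair_measureI[of "block h i" borel "block h j" borel] unfolding borel_prod
      by (auto simp: bounded_borel_def intro: bounded_Times)
    then show ?thesis
      using Z by (simp add: random_signed_measure_def)
  qed
  define B where "B \<tau> J A = {\<omega>\<in>space M. \<forall>p\<in>J. ?Z \<omega> (block h (\<tau> (fst p)) \<times> block h (\<tau> (snd p))) \<in> A p}"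
    for \<tau> :: "nat \<Rightarrow> nat" and J :: "(nat \<times> nat) set" and A
  have B_meas: "B \<tau> J A \<in> sets M" if J: "finite J" and A: "\<And>p. p \<in> J \<Longrightarrow> A p \<in> sets borel" for \<tau> J A
    unfolding B_def
  proof (rule sets.sets_Collect_finite_All[OF _ J])
    fix p assume "p \<in> J"
    then show "{\<omega>\<in>space M. ?Z \<omega> (block h (\<tau> (fst p)) \<times> block h (\<tau> (snd p))) \<in> A p} \<in> sets M"
      using measurable_sets[OF Z_meas A] by (simp add: vimage_def Int_def conj_commute)
  qed
  have B_lim: "(\<lambda>n. p.prob {\<omega>\<in>space M. \<forall>p\<in>J. F n \<omega> (\<tau> (fst p)) (\<tau> (snd p)) \<in> A p}) \<longlonglongrightarrow> p.prob (B \<tau> J A)"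
    if J: "finite J" and A: "\<And>p. p \<in> J \<Longrightarrow> A p \<in> sets borel"
    and F: "\<And>n. {\<omega>\<in>space M. \<forall>p\<in>J. F n \<omega> (\<tau> (fst p)) (\<tau> (snd p)) \<in> A p} \<in> sets M" for \<tau> J A
  proof (rule p.prob_LIMSEQ_eventually_eq[OF F B_meas[OF J A]])
    show "AE \<omega> in M. eventually (\<lambda>n. \<omega> \<in> {\<omega>\<in>space M. \<forall>p\<in>J. F n \<omega> (\<tau> (fst p)) (\<tau> (snd p)) \<in> A p} \<longleftrightarrow>
        \<omega> \<in> B \<tau> J A) sequentially"
      using lim
    proof eventually_elim
      case (elim \<omega>)
      then have "eventually (\<lambda>n. \<forall>p\<in>J. F n \<omega> (\<tau> (fst p)) (\<tau> (snd p)) =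
          ?Z \<omega> (block h (\<tau> (fst p)) \<times> block h (\<tau> (snd p)))) sequentially"
        using J by (intro eventually_ball_finite) auto
      then show ?case
        by eventually_elim (auto simp: B_def)
    qed
  qed
  have prob_B: "p.prob (B \<pi> J A) = p.prob (B id J A)"
    if J: "finite J" and A: "\<And>p. p \<in> J \<Longrightarrow> A p \<in> sets borel" for J A
  proof (rule LIMSEQ_unique)
    show "(\<lambda>n. p.prob {\<omega>\<in>space M. \<forall>p\<in>J. F n \<omega> (fst p) (snd p) \<in> A p}) \<longlonglongrightarrow> p.prob (B id J A)"
      using B_lim[of J A id, OF J A] prob_eq(1)[of J A, OF J A] by simp
    show "(\<lambda>n. p.prob {\<omega>\<in>space M. \<forall>p\<in>J. F n \<omega> (fst p) (snd p) \<in> A p}) \<longlonglongrightarrow> p.prob (B \<pi> J A)"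
      using B_lim[of J A \<pi>, OF J A] prob_eq(2,3)[of J A, OF J A] by simp
  qed
  let ?f = "\<lambda>\<tau> \<omega> (i, j). ?Z \<omega> (block h (\<tau> i) \<times> block h (\<tau> j))"
  let ?PM = "\<Pi>\<^sub>M _\<in>(UNIV :: (nat \<times> nat) set). (borel :: real measure)"
  have f_meas: "?f \<tau> \<in> M \<rightarrow>\<^sub>M ?PM" for \<tau>
    by (rule measurable_PiM_single') (auto simp: case_prod_unfold intro: Z_meas)
  have "distr M ?PM (?f id) = distr M ?PM (?f \<pi>)"
  proof (rule measure_eqI_PiM_infinite)
    fix A :: "nat \<times> nat \<Rightarrow> real set" and J :: "(nat \<times> nat) set"
    assume J: "finite J" "J \<subseteq> UNIV" and A: "\<And>p. p \<in> J \<Longrightarrow> A p \<in> sets borel"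
    let ?E = "prod_emb UNIV (\<lambda>_. borel) J (Pi\<^sub>E J A)"
    have E: "?E \<in> sets ?PM"
      using J A by (intro sets_PiM_I) auto
    have "?f \<tau> -` ?E \<inter> space M = B \<tau> J A" for \<tau>
    proof (rule set_eqI)
      fix \<omega>
      show "\<omega> \<in> ?f \<tau> -` ?E \<inter> space M \<longleftrightarrow> \<omega> \<in> B \<tau> J A"
        by (simp add: prod_emb_def B_def PiE_iff case_prod_unfold conj_commute)
    qed
    then have "emeasure (distr M ?PM (?f \<tau>)) ?E = ennreal (p.prob (B \<tau> J A))" for \<tau>
      using E by (simp add: emeasure_distr[OF f_meas] p.emeasure_eq_measure)
    then show "emeasure (distr M ?PM (?f id)) ?E = emeasure (distr M ?PM (?f \<pi>)) ?E"
      using prob_B[of J A, OF J(1) A] by (simp only:)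
  next
    show "finite_measure (distr M ?PM (?f id))"
      by (rule prob_space.finite_measure[OF p.prob_space_distr[OF f_meas]])
  qed simp_all
  then show "distr M ?PM (\<lambda>\<omega> (i, j). ?Z \<omega> (block h i \<times> block h j)) =
      distr M ?PM (\<lambda>\<omega> (i, j). ?Z \<omega> (block h (\<pi> i) \<times> block h (\<pi> j)))"
    by simp
qed

theorem proposition4p4:
  fixes M :: "'a measure" and \<rho> :: "real measure"
    and W :: "'a \<Rightarrow> real set \<Rightarrow> real"
    and W\<^sub>p W\<^sub>m :: "'a \<Rightarrow> real measure"
    and D\<^sub>p D\<^sub>m :: "'a \<Rightarrow> (real \<times> real) measure"
    and D Z :: "'a \<Rightarrow> (real \<times> real) set \<Rightarrow> real"
  assumes "prob_space M"
    and "levy_measure \<rho>"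
    and "CRSM M \<rho> (restrict_space lborel {0..}) W"
    and W\<^sub>p_def: "W\<^sub>p = (\<lambda>\<omega>. jordan_pos (W \<omega>))"
    and W\<^sub>m_def: "W\<^sub>m = (\<lambda>\<omega>. jordan_neg (W \<omega>))"
    and "locally_finite_point_process M quadrant D\<^sub>p"
    and "locally_finite_point_process M quadrant D\<^sub>m"
    and "conditionally_poisson M half_line W\<^sub>p quadrant (\<lambda>\<omega>. W\<^sub>p \<omega> \<Otimes>\<^sub>M W\<^sub>p \<omega>) D\<^sub>p"
    and "conditionally_poisson M half_line W\<^sub>m quadrant (\<lambda>\<omega>. W\<^sub>m \<omega> \<Otimes>\<^sub>M W\<^sub>m \<omega>) D\<^sub>m"
    and "prob_space.indep_var M (point_measures quadrant) D\<^sub>p (point_measures quadrant) D\<^sub>m"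
    and D_def: "D = (\<lambda>\<omega>. signed_difference (D\<^sub>p \<omega>) (D\<^sub>m \<omega>))"
    and Z_def: "Z = (\<lambda>\<omega>. signed_graph (W \<omega>) (D \<omega>))"
  shows "jointly_exchangeable M Z"
proof -
  have W: "exchangeable_atomic M W"
    using assms(2,3) by (rule CRSM_exchangeable_atomic)
  have "poisson_network M W D\<^sub>p"
    using assms(6,8) unfolding W\<^sub>p_def
    by (intro poisson_network.intro poisson_network_axioms.intro W)
  moreover have "poisson_network M (\<lambda>\<omega> B. - W \<omega> B) D\<^sub>m"
    using assms(7,9) unfolding W\<^sub>m_def jordan_neg_eq
    by (intro poisson_network.intro poisson_network_axioms.intro exchangeable_atomic_uminus W)
  ultimately show ?thesis
    unfolding Z_def D_def using assms(10) CRSM_singleton_eq_0[OF assms(2,3)]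
    by (rule signed_graph_jointly_exchangeable)
qed

end
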